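(* Let $\rho_0>0$ and $1\le p<d$. Let $S,T:\mathcal{O}(\mathbb{R}^d)\times\mathcal{A}_{lf}^d\to\mathbb{R}$ be measurable translation invariant functionals that are smooth of order $p$. Assume that $S$ is localized and almost subadditive of order $p$, and that $T$ is superadditive (on rectangles). If $S$ and $T$ are pointwise close of order $p$, then there exists a deterministic $\overline{S}\in[0,+\infty)$ such that for all $D\in\mathcal{O}(\mathbb{R}^d)$ we have almost surely $$\lim_{R\to\infty}\frac{S(D_R,\xi^{D_R})}{|D_R|}=\lim_{R\to\infty}\frac{S(D_R,\xi)}{|D_R|}=\overline{S},$$ where $D_R=\{Rx:x\in D\}$, and $\xi$ and $\xi^{D_R}$ are the random parking measures with parameter $\rho_0$ in $\mathbb{R}^d$ and in $D_R$ respectively (all constructed from the same Poisson process).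
   Context: **Sets.** $\mathcal{O}(\mathbb{R}^d)$ is the set of bounded nonempty Lipschitz subsets of $\mathbb{R}^d$: a bounded measurable set $D$ is Lipschitz if $\partial D$ is a finite union of relatively open subsets $U_k\subset\partial D$, each of which is, up to a rotation, (part of) the graph of a Lipschitz function on $\mathbb{R}^{d-1}$, with $D$ lying (up to boundary points) locally on one side of the graph. $|D|$ is Lebesgue measure and $\operatorname{diam}$ the Euclidean diameter. $\mathcal{A}_f^d$ and $\mathcal{A}_{lf}^d$ are the spaces of finite, respectively locally finite, point sets in $\mathbb{R}^d$. **Properties of a measurable functional $S:\mathcal{O}(\mathbb{R}^d)\times\mathcal{A}_{lf}^d\to\mathbb{R}$.** - Translation invariant: $S(D+y,\zeta+y)=S(D,\zeta)$ for all $y\in\mathbb{R}^d$, $D\in\mathcal{O}(\mathbb{R}^d)$, $\zeta\in\mathcal{A}_{lf}^d$. - Localized: there is $\tilde S:\mathcal{A}_f^d\to\mathbb{R}$ with $S(D,\zeta)=\tilde S(\zeta\cap D)$ for all $\zeta\in\mathcal{A}_{lf}^d$, $D\in\mathcal{O}(\mathbb{R}^d)$. - Almost subadditive of order $p$: there is $C>0$ such that for all $\zeta_1,\zeta_2\in\mathcal{A}_{lf}^d$ and $D\in\mathcal{O}(\mathbb{R}^d)$, $S(D,\zeta_1\cup\zeta_2)\le S(D,\zeta_1)+S(D,\zeta_2)+C\operatorname{diam}(D)^p$. - Superadditive on rectangles: for any partition of a semi-open rectangle $D$ into finitely many semi-open rectangles $D_1,\dots,D_k$ and every $\zeta\in\mathcal{A}_{lf}^d$,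 $S(D,\zeta)\ge\sum_{i=1}^kS(D_i,\zeta)$. - Smooth of order $p$: there is $C>0$ such that for every rectilinear cube $D$ and all $\zeta_1,\zeta_2\in\mathcal{A}_{lf}^d$, $|S(D,\zeta_1\cup\zeta_2)-S(D,\zeta_1)|\le C\operatorname{diam}(D)^p(\operatorname{card}(\zeta_2\cap D))^{(d-p)/d}$. Two measurable functionals $S_1,S_2$ are pointwise close of order $p$ if there is a function $g:\{0,1,2,\dots\}\to[0,\infty)$ with $\lim_{k\to\infty}k^{(p-d)/d}g(k)=0$ such that for every rectilinear cube $D$ and every $\zeta\in\mathcal{A}_{lf}^d$, $|S_1(D,\zeta)-S_2(D,\zeta)|\le\operatorname{diam}(D)^p\,g(\operatorname{card}(\zeta\cap D))$. **Random parking measure with parameter $\rho_0$.** Let $\mathcal{P}$ be a homogeneous Poisson process of unit intensity on $\mathbb{R}^d\times[0,\infty)$, and let $B$ be the open Euclidean ball of radius $\rho_0$ centred at the origin. Make $\mathcal{P}$ the vertex set of an oriented graph $\mathcal{G}$ with an edge $(X,T)\to(X',T')$ whenever $(X+B)\cap(X'+B)\neq\emptyset$ and $T<T'$ (ties $T=T'$ broken by lexicographic order of $X,X'$; they have probability zero). If there is an edge from $x$ to $y$, $y$ is an offspring of $x$ and $x$ a parent of $y$; a root is a vertex without parent. For a Borel set $A\subset\mathbb{R}^d$ (possibly unbounded), let $\mathcal{P}_A=\mathcal{P}\cap(A\times[0,\infty))$. Let $F_1(A)$ be the set of roots of the restriction of $\mathcal{G}$ to $\mathcal{P}_A$, $G_1(A)$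 the set of offspring of these roots, $H_1(A)=F_1(A)\cup G_1(A)$; recursively, $F_{i+1}(A)$ is the set of roots of the restriction of $\mathcal{G}$ to $\mathcal{P}_A\setminus(H_1(A)\cup\dots\cup H_i(A))$, $G_{i+1}(A)$ is the set of offspring of $F_{i+1}(A)$ in this restricted graph, and $H_{i+1}(A)=F_{i+1}(A)\cup G_{i+1}(A)$. The random parking measure $\xi^A$ in $A$ is the projection on $\mathbb{R}^d$ of $\bigcup_{i\ge1}F_i(A)$ (identified with a point set), and $\xi:=\xi^{\mathbb{R}^d}$. *)

theory Defs
  imports "HOL-Probability.Probability"
begin

text \<open>Vectors of \<open>\<real>\<^sup>d\<close> have type \<^typ>\<open>real ^ 'n\<close> with \<open>d = CARD('n)\<close>. The index type carries
  a linear order only where the lexicographic order of vectors is used.\<close>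


section \<open>Lipschitz sets\<close>

text \<open>The \<open>(d-1)\<close>-dimensional space on which the graph lives is the hyperplane orthogonal to a unit
  vector \<open>e\<close>; the choice of \<open>e\<close> is the choice of the rotation.\<close>

definition lipschitz_graph :: "real ^ 'n \<Rightarrow> (real ^ 'n \<Rightarrow> real) \<Rightarrow> (real ^ 'n) set" where
  "lipschitz_graph e \<phi> = {v + \<phi> v *\<^sub>R e | v. v \<bullet> e = 0}"

definition above_graph :: "real ^ 'n \<Rightarrow> (real ^ 'n \<Rightarrow> real) \<Rightarrow> (real ^ 'n) set" where
  "above_graph e \<phi> = {y. \<phi> (y - (y \<bullet> e) *\<^sub>R e) < y \<bullet> e}"

text \<open>In the last conjunct, up to boundary points the set \<open>D\<close> coincides near \<open>x\<close> with one side of the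
  graph. An inclusion would not do: it would admit sets with empty interior such as a sphere.
  Replacing \<open>e\<close> by \<open>-e\<close> covers sets lying below a graph.\<close>

definition lipschitz_piece :: "(real ^ 'n) set \<Rightarrow> (real ^ 'n) set \<Rightarrow> bool" where
  "lipschitz_piece D U \<longleftrightarrow>
     openin (top_of_set (frontier D)) U \<and>
     (\<exists>e \<phi> L. norm e = 1 \<and> L-lipschitz_on {v. v \<bullet> e = 0} \<phi> \<and> U \<subseteq> lipschitz_graph e \<phi> \<and>
        (\<forall>x\<in>U. \<exists>\<epsilon>>0. \<forall>y\<in>ball x \<epsilon> - frontier D. y \<in> D \<longleftrightarrow> y \<in> above_graph e \<phi>))"

definition lipschitz_sets :: "(real ^ 'n) set set" where
  "lipschitz_sets = {D. D \<noteq> {} \<and> bounded D \<and> D \<in> sets borel \<and>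
     (\<exists>\<U>. finite \<U> \<and> frontier D = \<Union>\<U> \<and> (\<forall>U\<in>\<U>. lipschitz_piece D U))}"


section \<open>Point sets, rectangles and cubes\<close>

definition locally_finite :: "'a::metric_space set \<Rightarrow> bool" where
  "locally_finite \<zeta> \<longleftrightarrow> (\<forall>K. bounded K \<longrightarrow> finite (\<zeta> \<inter> K))"

text \<open>The usual sigma-algebra on locally finite sets, generated by the counting maps.\<close>

definition lf_space :: "(real ^ 'n) set measure" where
  "lf_space = sigma {\<zeta>. locally_finite \<zeta>}
     {{\<zeta>. locally_finite \<zeta> \<and> card (\<zeta> \<inter> B) = k} | B k. B \<in> sets borel \<and> bounded B}"

definition semi_open_rectangle :: "(real ^ 'n) set \<Rightarrow> bool" where
  "semi_open_rectangle D \<longleftrightarrow>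
     (\<exists>a b. (\<forall>i. a $ i < b $ i) \<and> D = {x. \<forall>i. a $ i \<le> x $ i \<and> x $ i < b $ i})"

text \<open>A product of \<open>d\<close> intervals, each open, closed or half-open, of the same length \<open>s > 0\<close>
  (\<^const>\<open>is_interval\<close> says that \<open>D\<close> is a product of intervals).\<close>

definition rectilinear_cube :: "(real ^ 'n) set \<Rightarrow> bool" where
  "rectilinear_cube D \<longleftrightarrow>
     (\<exists>a s. s > 0 \<and> is_interval D \<and> box a (a + (\<chi> i. s)) \<subseteq> D \<and> D \<subseteq> cbox a (a + (\<chi> i. s)))"


section \<open>Functionals of a domain and a point set\<close>

text \<open>A functional is a total function of which only the values \<open>S D \<zeta>\<close> with
  \<open>D \<in> lipschitz_sets\<close> and \<open>locally_finite \<zeta>\<close> are meaningful.\<close>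

type_synonym 'n functional = "(real ^ 'n) set \<Rightarrow> (real ^ 'n) set \<Rightarrow> real"

text \<open>There is no sigma-algebra on the domains: measurability refers to the point set.\<close>

definition measurable_functional :: "'n::finite functional \<Rightarrow> bool" where
  "measurable_functional S \<longleftrightarrow> (\<forall>D\<in>lipschitz_sets. S D \<in> borel_measurable lf_space)"

definition translation_invariant :: "'n::finite functional \<Rightarrow> bool" where
  "translation_invariant S \<longleftrightarrow>
     (\<forall>y. \<forall>D\<in>lipschitz_sets. \<forall>\<zeta>. locally_finite \<zeta> \<longrightarrow> S ((+) y ` D) ((+) y ` \<zeta>) = S D \<zeta>)"

definition localized :: "'n::finite functional \<Rightarrow> bool" where
  "localized S \<longleftrightarrow>
     (\<exists>S'. \<forall>D\<in>lipschitz_sets. \<forall>\<zeta>. locally_finite \<zeta> \<longrightarrow> S D \<zeta> = S' (\<zeta> \<inter> D))"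

definition almost_subadditive :: "real \<Rightarrow> 'n::finite functional \<Rightarrow> bool" where
  "almost_subadditive p S \<longleftrightarrow>
     (\<exists>C>0. \<forall>\<zeta>\<^sub>1 \<zeta>\<^sub>2. \<forall>D\<in>lipschitz_sets. locally_finite \<zeta>\<^sub>1 \<longrightarrow> locally_finite \<zeta>\<^sub>2 \<longrightarrow>
        S D (\<zeta>\<^sub>1 \<union> \<zeta>\<^sub>2) \<le> S D \<zeta>\<^sub>1 + S D \<zeta>\<^sub>2 + C * diameter D powr p)"

definition superadditive_on_rectangles :: "'n::finite functional \<Rightarrow> bool" where
  "superadditive_on_rectangles S \<longleftrightarrow>
     (\<forall>D \<D> \<zeta>. semi_open_rectangle D \<longrightarrow> finite \<D> \<longrightarrow> partition_on D \<D> \<longrightarrow>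
        (\<forall>D'\<in>\<D>. semi_open_rectangle D') \<longrightarrow> locally_finite \<zeta> \<longrightarrow>
        (\<Sum>D'\<in>\<D>. S D' \<zeta>) \<le> S D \<zeta>)"

definition smooth_of_order :: "real \<Rightarrow> 'n::finite functional \<Rightarrow> bool" where
  "smooth_of_order p S \<longleftrightarrow>
     (\<exists>C>0. \<forall>D \<zeta>\<^sub>1 \<zeta>\<^sub>2. rectilinear_cube D \<longrightarrow> locally_finite \<zeta>\<^sub>1 \<longrightarrow> locally_finite \<zeta>\<^sub>2 \<longrightarrow>
        \<bar>S D (\<zeta>\<^sub>1 \<union> \<zeta>\<^sub>2) - S D \<zeta>\<^sub>1\<bar>
          \<le> C * diameter D powr p
              * real (card (\<zeta>\<^sub>2 \<inter> D)) powr ((real CARD('n) - p) / real CARD('n)))"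

definition pointwise_close :: "real \<Rightarrow> 'n::finite functional \<Rightarrow> 'n functional \<Rightarrow> bool" where
  "pointwise_close p S\<^sub>1 S\<^sub>2 \<longleftrightarrow>
     (\<exists>g :: nat \<Rightarrow> real. (\<forall>k. g k \<ge> 0) \<and>
        (\<lambda>k. real k powr ((p - real CARD('n)) / real CARD('n)) * g k) \<longlonglongrightarrow> 0 \<and>
        (\<forall>D \<zeta>. rectilinear_cube D \<longrightarrow> locally_finite \<zeta> \<longrightarrow>
           \<bar>S\<^sub>1 D \<zeta> - S\<^sub>2 D \<zeta>\<bar> \<le> diameter D powr p * g (card (\<zeta> \<inter> D))))"


section \<open>Poisson processes\<close>

text \<open>Homogeneous Poisson process of unit intensity on \<open>E\<close>, as a random locally finite subset
  of \<open>E\<close>.\<close>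

definition unit_poisson_process ::
    "'w measure \<Rightarrow> 'b::euclidean_space set \<Rightarrow> ('w \<Rightarrow> 'b set) \<Rightarrow> bool" where
  "unit_poisson_process M E P \<longleftrightarrow>
     prob_space M \<and>
     (\<forall>\<omega>\<in>space M. P \<omega> \<subseteq> E \<and> locally_finite (P \<omega>)) \<and>
     (\<forall>B. B \<in> sets borel \<longrightarrow> bounded B \<longrightarrow> B \<subseteq> E \<longrightarrow>
        (\<lambda>\<omega>. card (P \<omega> \<inter> B)) \<in> measurable M (count_space UNIV) \<and>
        (\<forall>k. measure M {\<omega> \<in> space M. card (P \<omega> \<inter> B) = k}
               = exp (- measure lborel B) * measure lborel B ^ k / fact k)) \<and>
     (\<forall>(I :: nat set) B. finite I \<longrightarrow> disjoint_family_on B I \<longrightarrow>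
        (\<forall>i\<in>I. B i \<in> sets borel \<and> bounded (B i) \<and> B i \<subseteq> E) \<longrightarrow>
        prob_space.indep_vars M (\<lambda>_. count_space UNIV) (\<lambda>i \<omega>. card (P \<omega> \<inter> B i)) I)"


section \<open>The random parking measure\<close>

definition lex_less :: "real ^ 'n::{finite,linorder} \<Rightarrow> real ^ 'n::{finite,linorder} \<Rightarrow> bool" where
  "lex_less x y \<longleftrightarrow> (\<exists>i. x $ i < y $ i \<and> (\<forall>j<i. x $ j = y $ j))"

definition parking_edge ::
    "real \<Rightarrow> (real ^ 'n::{finite,linorder}) \<times> real \<Rightarrow> (real ^ 'n::{finite,linorder}) \<times> real \<Rightarrow> bool" where
  "parking_edge \<rho> = (\<lambda>(X, T) (X', T').
     ball X \<rho> \<inter> ball X' \<rho> \<noteq> {} \<and> (T < T' \<or> (T = T' \<and> lex_less X X')))"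

definition graph_roots :: "('a \<Rightarrow> 'a \<Rightarrow> bool) \<Rightarrow> 'a set \<Rightarrow> 'a set" where
  "graph_roots E V = {y \<in> V. \<not> (\<exists>x\<in>V. E x y)}"

definition graph_offspring :: "('a \<Rightarrow> 'a \<Rightarrow> bool) \<Rightarrow> 'a set \<Rightarrow> 'a set \<Rightarrow> 'a set" where
  "graph_offspring E V W = {y \<in> V. \<exists>x\<in>W. E x y}"

text \<open>\<open>parking_rest \<rho> V i\<close> is \<open>V - (H\<^sub>1 \<union> \<dots> \<union> H\<^sub>i)\<close> and \<open>parking_accepted \<rho> V i\<close> is \<open>F\<^sub>i\<^sub>+\<^sub>1\<close>, for the
  process started from the vertex set \<open>V\<close>.\<close>

primrec parking_rest ::
    "real \<Rightarrow> ((real ^ 'n::{finite,linorder}) \<times> real) set \<Rightarrow> nat \<Rightarrow> ((real ^ 'n::{finite,linorder}) \<times> real) set" where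
  "parking_rest \<rho> V 0 = V"
| "parking_rest \<rho> V (Suc i) =
     (let W = parking_rest \<rho> V i; F = graph_roots (parking_edge \<rho>) W
      in W - (F \<union> graph_offspring (parking_edge \<rho>) W F))"

definition parking_accepted ::
    "real \<Rightarrow> ((real ^ 'n::{finite,linorder}) \<times> real) set \<Rightarrow> nat \<Rightarrow> ((real ^ 'n::{finite,linorder}) \<times> real) set" where
  "parking_accepted \<rho> V i = graph_roots (parking_edge \<rho>) (parking_rest \<rho> V i)"

definition random_parking ::
    "real \<Rightarrow> (real ^ 'n::{finite,linorder}) set \<Rightarrow> ((real ^ 'n::{finite,linorder}) \<times> real) set \<Rightarrow> (real ^ 'n::{finite,linorder}) set" where
  "random_parking \<rho> A P = fst ` (\<Union>i. parking_accepted \<rho> (P \<inter> (A \<times> {0..})) i)"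

end

theory Submission
  imports Defs
begin

text \<open>Accepted points are at distance at least \<open>2 * \<rho>\<^sub>0\<close> of each other, so their number in a cube is at most
  proportional to the volume, and on such sets \<open>S\<close> is deterministically nearly additive: almost
  subadditivity, applied along dyadic bisections with errors summable since \<open>p < d\<close>, bounds \<open>S\<close> of a large
  cube above by the sum over its cells of side \<open>r\<close>, and superadditivity of \<open>T\<close> with closeness of \<open>S\<close> and \<open>T\<close>
  bounds it below, with an error that is small compared to the volume when \<open>r\<close> is large.

  On each cell, smoothness lets one replace the parking process by the one restricted to that cell,
  at a cost governed by the number of unit cells whose accepted points cannot be decided inside
  the cell. These are rare because almost surely every point has finitely many ancestors: backward
  chains do not percolate in a thin time slab. The restricted quantities are identically
  distributed and independent for different cells, hence obey the strong law over the cells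
  contained in \<open>R D\<close>. Cells meeting the boundary are negligible because the frontier of a Lipschitz set
  is a null set. Comparing two values of \<open>r\<close> on a large cube shows that the means per volume form a
  Cauchy sequence. The limit is nonnegative by almost subadditivity with \<open>\<zeta>\<^sub>1 = \<zeta>\<^sub>2\<close>, which gives
  \<open>S(D, \<zeta>) \<ge> - C * diam(D) powr p\<close>.\<close>

section \<open>The parking process on a deterministic point set\<close>

text \<open>Time is unbounded: over every unit cell lie infinitely many points, and the late ones
  descend from points far away. A criterion asking that all of them be free of outside influence
  would fail. Hence the second alternative in \<open>determined\<close>: only finitely many accepted
  points lie near a bounded set, each has finitely many ancestors, and these few points reject all
  the others.

  The strong law rests on second moments alone. Cell values are bounded and pairwise independent,
  and \<open>1 \<le> p < d\<close> forces \<open>d \<ge> 2\<close>, so variances of order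
  \<open>1 / n ^ d\<close> are summable along all integers \<open>n\<close>, without passing to a
  subsequence. A real scale \<open>R\<close> is compared with its integer part; the two scalings of
  \<open>D\<close> differ only in cells near the scaled frontier.

  The final error bounds hold for every region \<open>A\<close> containing \<open>R D\<close>
  simultaneously. The choices \<open>A = R D\<close> and \<open>A = UNIV\<close> then give both
  limits on one event of probability one, and since the cell means never mention \<open>D\<close>,
  the limit is the same for all domains.\<close>

lemma ball_Int_ball_nonempty_iff:
  fixes x y :: "'a::real_normed_vector"
  assumes "r > 0"
  shows "ball x r \<inter> ball y r \<noteq> {} \<longleftrightarrow> dist x y < 2 * r"
proof
  assume "ball x r \<inter> ball y r \<noteq> {}"
  then obtain z where "dist x z < r" "dist y z < r" by auto
  then show "dist x y < 2 * r" using dist_triangle2[of x y z] by simp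
next
  assume "dist x y < 2 * r"
  then have "midpoint x y \<in> ball x r \<inter> ball y r"
    by (simp add: dist_midpoint)
  then show "ball x r \<inter> ball y r \<noteq> {}" by blast
qed

lemma parking_edge_iff:
  assumes "\<rho> > 0"
  shows "parking_edge \<rho> u v \<longleftrightarrow> dist (fst u) (fst v) < 2 * \<rho> \<and>
    (snd u < snd v \<or> (snd u = snd v \<and> lex_less (fst u) (fst v)))"
  using ball_Int_ball_nonempty_iff[OF assms, of "fst u" "fst v"]
  by (auto simp: parking_edge_def split: prod.splits)

lemma lex_less_irrefl: "\<not> lex_less x x"
  by (simp add: lex_less_def)

lemma lex_less_trans:
  assumes "lex_less x y" "lex_less y z" shows "lex_less x z"
proof -
  obtain i j where i: "x $ i < y $ i" "\<forall>k<i. x $ k = y $ k"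
    and j: "y $ j < z $ j" "\<forall>k<j. y $ k = z $ k"
    using assms by (auto simp: lex_less_def)
  show ?thesis
  proof (cases i j rule: linorder_cases)
    case less then show ?thesis using i j unfolding lex_less_def by (intro exI[of _ i]) auto
  next
    case equal then show ?thesis using i j unfolding lex_less_def by (intro exI[of _ i]) auto
  next
    case greater then show ?thesis using i j unfolding lex_less_def by (intro exI[of _ j]) auto
  qed
qed

text \<open>The first differing coordinate decides, and it exists because there are finitely many
  coordinates.\<close>

lemma lex_less_total:
  assumes "x \<noteq> y" shows "lex_less x y \<or> lex_less y x"
proof -
  let ?A = "{i. x $ i \<noteq> y $ i}"
  have "?A \<noteq> {}" using assms by (auto simp: vec_eq_iff)
  then have m: "Min ?A \<in> ?A" by (intro Min_in) auto
  have "x $ k = y $ k" if "k < Min ?A" for k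
    using that Min_le[of ?A k] by (auto simp: not_less[symmetric])
  with m show ?thesis unfolding lex_less_def
    by (metis (mono_tags, lifting) linorder_neqE mem_Collect_eq)
qed

section \<open>Acceptance as a recursion over parents\<close>

definition accepted ::
    "real \<Rightarrow> ((real ^ 'n::{finite,linorder}) \<times> real) set \<Rightarrow> ((real ^ 'n::{finite,linorder}) \<times> real) set" where
  "accepted \<rho> V = (\<Union>i. parking_accepted \<rho> V i)"

lemma random_parking_eq: "random_parking \<rho> A P = fst ` accepted \<rho> (P \<inter> (A \<times> {0..}))"
  by (simp add: random_parking_def accepted_def)

text \<open>Pairs are (parent, child), so well-foundedness of this relation forbids infinite chains
  of ancestors, and induction along it proceeds from parents to children.\<close>

definition edges_on :: "('a \<Rightarrow> 'a \<Rightarrow> bool) \<Rightarrow> 'a set \<Rightarrow> ('a \<times> 'a) set" where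
  "edges_on E V = {(y, x). y \<in> V \<and> x \<in> V \<and> E y x}"

text \<open>The almost sure properties on which the deterministic analysis runs. They pass to
  subsets, so that one null set serves the restrictions to all regions.\<close>

definition parking_wf :: "real \<Rightarrow> ((real ^ 'n::{finite,linorder}) \<times> real) set \<Rightarrow> bool" where
  "parking_wf \<rho> V \<longleftrightarrow> V \<subseteq> UNIV \<times> {0..} \<and> locally_finite V \<and> wf (edges_on (parking_edge \<rho>) V)"

lemma parking_rest_subset: "parking_rest \<rho> V i \<subseteq> V"
  by (induction i) (auto simp: Let_def)

lemma parking_rest_antimono: "i \<le> j \<Longrightarrow> parking_rest \<rho> V j \<subseteq> parking_rest \<rho> V i"
  by (rule lift_Suc_antimono_le) (auto simp: Let_def)

lemma accepted_subset: "accepted \<rho> V \<subseteq> V"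
  using parking_rest_subset by (fastforce simp: accepted_def parking_accepted_def graph_roots_def)

lemma locally_finite_subset: "locally_finite V \<Longrightarrow> W \<subseteq> V \<Longrightarrow> locally_finite W"
  unfolding locally_finite_def by (meson Int_mono finite_subset subset_refl)

lemma parking_wf_subset: "parking_wf \<rho> V \<Longrightarrow> W \<subseteq> V \<Longrightarrow> parking_wf \<rho> W"
  unfolding parking_wf_def
  by (auto intro: locally_finite_subset elim!: wf_subset simp: edges_on_def)

text \<open>If \<open>y\<close> is accepted in an earlier layer than \<open>x\<close>, its offspring
  leave with it and \<open>x\<close> is gone by then; otherwise \<open>y\<close> is still present
  when \<open>x\<close> is declared a root.\<close>

lemma no_edge_accepted:
  assumes "x \<in> accepted \<rho> V" "y \<in> accepted \<rho> V"
  shows "\<not> parking_edge \<rho> y x"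
proof
  assume e: "parking_edge \<rho> y x"
  obtain i j where i: "x \<in> parking_accepted \<rho> V i" and j: "y \<in> parking_accepted \<rho> V j"
    using assms by (auto simp: accepted_def)
  show False
  proof (cases "j < i")
    case True
    have "x \<in> parking_rest \<rho> V i" using i by (simp add: parking_accepted_def graph_roots_def)
    then have "x \<in> parking_rest \<rho> V (Suc j)" using parking_rest_antimono[of "Suc j" i] True by auto
    then show False using j e
      by (auto simp: Let_def parking_accepted_def graph_offspring_def)
  next
    case False
    then have "y \<in> parking_rest \<rho> V i"
      using j parking_rest_antimono[of i j] by (auto simp: parking_accepted_def graph_roots_def)
    then show False using i e by (auto simp: parking_accepted_def graph_roots_def)
  qed
qed

text \<open>Parents arrive earlier and within distance \<open>2 * \<rho>\<close>; since times are
  nonnegative, they lie in a bounded space-time cylinder.\<close>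

lemma finite_parents:
  assumes "\<rho> > 0" "V \<subseteq> UNIV \<times> {0..}" "locally_finite V"
  shows "finite {y \<in> V. parking_edge \<rho> y x}"
proof -
  have "{y \<in> V. parking_edge \<rho> y x} \<subseteq> V \<inter> (cball (fst x) (2 * \<rho>) \<times> {0..snd x})"
    using assms(2) by (auto simp: parking_edge_iff[OF assms(1)] dist_commute)
  moreover have "bounded (cball (fst x) (2 * \<rho>) \<times> {0..snd x})"
    by (intro bounded_Times) auto
  ultimately show ?thesis using assms(3) unfolding locally_finite_def by (meson finite_subset)
qed

text \<open>By induction each of the finitely many parents has left by some common layer. If
  \<open>x\<close> is still there, it is a root of that layer and leaves with it.\<close>

lemma eventually_not_in_rest:
  assumes "\<rho> > 0" "parking_wf \<rho> V" "x \<in> V"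
  shows "\<exists>i. x \<notin> parking_rest \<rho> V i"
proof -
  have wf: "wf (edges_on (parking_edge \<rho>) V)" using assms by (simp add: parking_wf_def)
  from wf \<open>x \<in> V\<close> show ?thesis
  proof (induction x rule: wf_induct_rule)
    case (less x)
    let ?Y = "{y \<in> V. parking_edge \<rho> y x}"
    have fin: "finite ?Y" using assms by (intro finite_parents) (auto simp: parking_wf_def)
    have "\<forall>y\<in>?Y. \<exists>i. y \<notin> parking_rest \<rho> V i"
      using less by (auto simp: edges_on_def)
    then obtain f where f: "\<And>y. y \<in> ?Y \<Longrightarrow> y \<notin> parking_rest \<rho> V (f y)" by metis
    define m where "m = Max (insert 0 (f ` ?Y))"
    have "y \<notin> parking_rest \<rho> V m" if "y \<in> ?Y" for y
    proof -
      have "f y \<le> m" unfolding m_def using fin that by (intro Max_ge) auto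
      then show ?thesis using f[OF that] parking_rest_antimono[of "f y" m] by auto
    qed
    then have "x \<in> parking_rest \<rho> V m \<Longrightarrow> x \<in> graph_roots (parking_edge \<rho>) (parking_rest \<rho> V m)"
      using parking_rest_subset[of \<rho> V m] by (auto simp: graph_roots_def)
    then have "x \<notin> parking_rest \<rho> V (Suc m)" by (auto simp: Let_def)
    then show ?case by blast
  qed
qed

text \<open>Every point leaves at a first layer, either as a root or as offspring of a root accepted
  there. This removes the layers from the picture: all comparisons between regions below use only
  this recursion.\<close>

lemma accepted_iff:
  assumes "\<rho> > 0" "parking_wf \<rho> V" "x \<in> V"
  shows "x \<in> accepted \<rho> V \<longleftrightarrow> \<not> (\<exists>y\<in>accepted \<rho> V. parking_edge \<rho> y x)"
proof
  assume "\<not> (\<exists>y\<in>accepted \<rho> V. parking_edge \<rho> y x)"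
  moreover define i where "i = (LEAST i. x \<notin> parking_rest \<rho> V i)"
  have i: "x \<notin> parking_rest \<rho> V i"
    unfolding i_def using eventually_not_in_rest[OF assms] by (rule LeastI_ex)
  then obtain j where j: "i = Suc j" using assms(3) by (cases i) auto
  have "x \<in> parking_rest \<rho> V j" using j not_less_Least[of j] i_def by (metis lessI)
  with i j show "x \<in> accepted \<rho> V" using calculation
    by (fastforce simp: Let_def accepted_def parking_accepted_def graph_offspring_def)
qed (use no_edge_accepted in blast)

text \<open>Time with lexicographic tie-breaking is a total order, so two distinct points closer
  than \<open>2 * \<rho>\<close> are joined by an edge in one direction or the other.\<close>

lemma accepted_hard_core:
  assumes "\<rho> > 0" "u \<in> accepted \<rho> V" "v \<in> accepted \<rho> V" "u \<noteq> v"
  shows "dist (fst u) (fst v) \<ge> 2 * \<rho>"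
proof (rule ccontr)
  assume d: "\<not> ?thesis"
  have "parking_edge \<rho> u v \<or> parking_edge \<rho> v u"
    using d assms(4) lex_less_total[of "fst u" "fst v"]
    by (auto simp: parking_edge_iff[OF assms(1)] dist_commute prod_eq_iff)
  then show False using no_edge_accepted assms by blast
qed

lemma inj_on_fst_accepted:
  assumes "\<rho> > 0" shows "inj_on fst (accepted \<rho> V)"
  using accepted_hard_core[OF assms] assms by (force intro!: inj_onI)


text \<open>Descendants of points outside \<open>C\<close>. With \<open>C\<close> the \<open>2 * \<rho>\<close>-core of a region, every ancestor of the other
  points lies in that region, so that their fate does not depend on anything outside it.\<close>

primrec tainted_upto ::
    "real \<Rightarrow> (real ^ 'n::{finite,linorder}) set \<Rightarrow> ((real ^ 'n::{finite,linorder}) \<times> real) set \<Rightarrow> nat \<Rightarrow> ((real ^ 'n::{finite,linorder}) \<times> real) set" where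
  "tainted_upto \<rho> C V 0 = {x \<in> V. fst x \<notin> C}"
| "tainted_upto \<rho> C V (Suc i) = {x \<in> V. \<exists>y\<in>tainted_upto \<rho> C V i. parking_edge \<rho> y x}"

definition tainted ::
    "real \<Rightarrow> (real ^ 'n::{finite,linorder}) set \<Rightarrow> ((real ^ 'n::{finite,linorder}) \<times> real) set \<Rightarrow> ((real ^ 'n::{finite,linorder}) \<times> real) set" where
  "tainted \<rho> C V = (\<Union>i. tainted_upto \<rho> C V i)"

lemma tainted_upto_subset: "tainted_upto \<rho> C V i \<subseteq> V"
  by (cases i) auto

lemma tainted_subset: "tainted \<rho> C V \<subseteq> V"
  using tainted_upto_subset by (force simp: tainted_def)

lemma tainted_iff:
  "x \<in> tainted \<rho> C V \<longleftrightarrow> x \<in> V \<and> (fst x \<notin> C \<or> (\<exists>y\<in>tainted \<rho> C V. parking_edge \<rho> y x))"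
proof
  assume "x \<in> tainted \<rho> C V"
  then obtain i where "x \<in> tainted_upto \<rho> C V i" by (auto simp: tainted_def)
  then show "x \<in> V \<and> (fst x \<notin> C \<or> (\<exists>y\<in>tainted \<rho> C V. parking_edge \<rho> y x))"
    by (cases i) (auto simp: tainted_def)
next
  assume a: "x \<in> V \<and> (fst x \<notin> C \<or> (\<exists>y\<in>tainted \<rho> C V. parking_edge \<rho> y x))"
  show "x \<in> tainted \<rho> C V"
  proof (cases "fst x \<notin> C")
    case True then have "x \<in> tainted_upto \<rho> C V 0" using a by simp
    then show ?thesis unfolding tainted_def by blast
  next
    case False
    then obtain i where "x \<in> tainted_upto \<rho> C V (Suc i)" using a by (auto simp: tainted_def)
    then show ?thesis unfolding tainted_def by blast
  qed
qed

lemma untainted_mem: "x \<in> V \<Longrightarrow> x \<notin> tainted \<rho> C V \<Longrightarrow> fst x \<in> C"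
  by (subst (asm) tainted_iff) blast

lemma untainted_parent:
  "x \<in> V \<Longrightarrow> x \<notin> tainted \<rho> C V \<Longrightarrow> parking_edge \<rho> y x \<Longrightarrow> y \<notin> tainted \<rho> C V"
  by (subst (asm) tainted_iff) blast

lemma untaintedI:
  assumes "fst x \<in> C" "\<And>y. y \<in> V \<Longrightarrow> parking_edge \<rho> y x \<Longrightarrow> y \<notin> tainted \<rho> C V"
  shows "x \<notin> tainted \<rho> C V"
  using assms tainted_subset by (subst tainted_iff) blast

section \<open>Regions in which acceptance can be decided\<close>

definition core :: "real \<Rightarrow> 'a::metric_space set \<Rightarrow> 'a set" where
  "core r A = {z. ball z r \<subseteq> A}"

abbreviation over :: "'a set \<Rightarrow> ('a \<times> real) set" where
  "over A \<equiv> A \<times> {0..}"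

text \<open>Whether a point of \<open>c\<close> is accepted can be decided inside \<open>A\<close>: it has no descent from near the
  boundary, or it is shadowed by an accepted point without such descent.\<close>

definition determined ::
    "real \<Rightarrow> (real ^ 'n::{finite,linorder}) set \<Rightarrow> (real ^ 'n::{finite,linorder}) set \<Rightarrow> ((real ^ 'n::{finite,linorder}) \<times> real) set \<Rightarrow> bool" where
  "determined \<rho> c A V \<longleftrightarrow>
     (\<forall>x \<in> V \<inter> over A. fst x \<in> c \<longrightarrow>
        x \<notin> tainted \<rho> (core (2 * \<rho>) A) (V \<inter> over A) \<or>
        (\<exists>y \<in> accepted \<rho> (V \<inter> over A) - tainted \<rho> (core (2 * \<rho>) A) (V \<inter> over A).
           parking_edge \<rho> y x))"

lemma parent_in_region:
  assumes "\<rho> > 0" "V \<subseteq> UNIV \<times> {0..}" "fst x \<in> core (2 * \<rho>) A" "y \<in> V" "parking_edge \<rho> y x"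
  shows "y \<in> V \<inter> over A"
  using assms(2-5) by (force simp: parking_edge_iff[OF assms(1)] core_def dist_commute mem_Times_iff)

text \<open>Induction along ancestors: the core grows with the region, and a point untainted for
  \<open>A\<close> already has all its parents inside \<open>A\<close>, so that the larger region
  adds none.\<close>

lemma untainted_mono:
  assumes "\<rho> > 0" "parking_wf \<rho> V" "A \<subseteq> A'"
    and "x \<in> V \<inter> over A" "x \<notin> tainted \<rho> (core (2 * \<rho>) A) (V \<inter> over A)"
  shows "x \<notin> tainted \<rho> (core (2 * \<rho>) A') (V \<inter> over A')"
proof -
  have wf: "wf (edges_on (parking_edge \<rho>) V)" and V: "V \<subseteq> UNIV \<times> {0..}"
    using assms(2) by (auto simp: parking_wf_def)
  from wf assms(4,5) show ?thesis
  proof (induction x rule: wf_induct_rule)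
    case (less x)
    have c: "fst x \<in> core (2 * \<rho>) A" using untainted_mem[OF less.prems] .
    have p: "y \<notin> tainted \<rho> (core (2 * \<rho>) A') (V \<inter> over A')"
      if y: "parking_edge \<rho> y x" "y \<in> V" for y
    proof -
      have "y \<in> V \<inter> over A" using parent_in_region[OF assms(1) V c y(2,1)] .
      moreover have "y \<notin> tainted \<rho> (core (2 * \<rho>) A) (V \<inter> over A)"
        using untainted_parent[OF less.prems y(1)] .
      moreover have "(y, x) \<in> edges_on (parking_edge \<rho>) V"
        using y less.prems(1) by (simp add: edges_on_def)
      ultimately show ?thesis using less.IH by blast
    qed
    have "fst x \<in> core (2 * \<rho>) A'" using c assms(3) by (auto simp: core_def)
    then show ?case by (rule untaintedI) (use p in blast)
  qed
qed

text \<open>Both processes obey the recursion \<open>accepted_iff\<close>, and an untainted point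
  has the same parents in both, all of them untainted.\<close>

lemma accepted_untainted_iff:
  assumes "\<rho> > 0" "parking_wf \<rho> V"
    and "x \<in> V \<inter> over A" "x \<notin> tainted \<rho> (core (2 * \<rho>) A) (V \<inter> over A)"
  shows "x \<in> accepted \<rho> V \<longleftrightarrow> x \<in> accepted \<rho> (V \<inter> over A)"
proof -
  have wf: "wf (edges_on (parking_edge \<rho>) V)" and V: "V \<subseteq> UNIV \<times> {0..}"
    using assms(2) by (auto simp: parking_wf_def)
  have wfA: "parking_wf \<rho> (V \<inter> over A)" by (rule parking_wf_subset[OF assms(2)]) blast
  from wf assms(3,4) show ?thesis
  proof (induction x rule: wf_induct_rule)
    case (less x)
    have c: "fst x \<in> core (2 * \<rho>) A" using untainted_mem[OF less.prems] .
    have "y \<in> V \<inter> over A \<and> (y \<in> accepted \<rho> V \<longleftrightarrow> y \<in> accepted \<rho> (V \<inter> over A))"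
      if y: "parking_edge \<rho> y x" "y \<in> V" for y
    proof -
      have "y \<in> V \<inter> over A" using parent_in_region[OF assms(1) V c y(2,1)] .
      moreover have "y \<notin> tainted \<rho> (core (2 * \<rho>) A) (V \<inter> over A)"
        using untainted_parent[OF less.prems y(1)] .
      moreover have "(y, x) \<in> edges_on (parking_edge \<rho>) V"
        using y less.prems(1) by (simp add: edges_on_def)
      ultimately show ?thesis using less.IH by blast
    qed
    then have "(\<exists>y\<in>accepted \<rho> V. parking_edge \<rho> y x) \<longleftrightarrow>
        (\<exists>y\<in>accepted \<rho> (V \<inter> over A). parking_edge \<rho> y x)"
      using accepted_subset by blast
    then show ?case
      using accepted_iff[OF assms(1,2), of x] accepted_iff[OF assms(1) wfA, of x] less.prems by blast
  qed
qed

lemma over_Int_over: "A \<subseteq> A' \<Longrightarrow> V \<inter> over A' \<inter> over A = V \<inter> over A"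
  by blast

text \<open>A tainted point of \<open>c\<close> has an accepted untainted parent. That parent
  remains accepted in the larger region, so the tainted point is rejected in both.\<close>

lemma accepted_determined:
  assumes "\<rho> > 0" "parking_wf \<rho> V" "A \<subseteq> A'" "determined \<rho> c A V" "x \<in> V \<inter> over A" "fst x \<in> c"
  shows "x \<in> accepted \<rho> (V \<inter> over A') \<longleftrightarrow> x \<in> accepted \<rho> (V \<inter> over A)"
proof -
  have wf: "parking_wf \<rho> (V \<inter> over A')" by (rule parking_wf_subset[OF assms(2)]) blast
  have eq: "z \<in> accepted \<rho> (V \<inter> over A') \<longleftrightarrow> z \<in> accepted \<rho> (V \<inter> over A)"
    if "z \<in> V \<inter> over A" "z \<notin> tainted \<rho> (core (2 * \<rho>) A) (V \<inter> over A)" for z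
    using accepted_untainted_iff[OF assms(1) wf, of z A] that
    unfolding over_Int_over[OF assms(3)] by blast
  show ?thesis
  proof (cases "x \<in> tainted \<rho> (core (2 * \<rho>) A) (V \<inter> over A)")
    case True
    then obtain y where y: "y \<in> accepted \<rho> (V \<inter> over A)"
      "y \<notin> tainted \<rho> (core (2 * \<rho>) A) (V \<inter> over A)" "parking_edge \<rho> y x"
      using assms(4-6) unfolding determined_def by blast
    moreover have "y \<in> accepted \<rho> (V \<inter> over A')" using eq[of y] y accepted_subset by blast
    ultimately show ?thesis using no_edge_accepted by blast
  qed (use eq assms(5) in blast)
qed

lemma random_parking_determined:
  assumes "\<rho> > 0" "parking_wf \<rho> V" "A \<subseteq> A'" "determined \<rho> c A V" "c \<subseteq> A"
  shows "random_parking \<rho> A' V \<inter> c = random_parking \<rho> A V \<inter> c"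
proof -
  have "x \<in> accepted \<rho> (V \<inter> over A') \<longleftrightarrow> x \<in> accepted \<rho> (V \<inter> over A)" if "fst x \<in> c" for x
  proof (cases "x \<in> V \<inter> over A")
    case True then show ?thesis using accepted_determined[OF assms(1-4)] that by blast
  next
    case False
    have "x \<notin> V \<inter> over A'" using False that assms(3,5) by (auto simp: mem_Times_iff)
    with False show ?thesis using accepted_subset by blast
  qed
  then show ?thesis unfolding random_parking_eq by blast
qed

text \<open>Both alternatives survive enlargement: untainted points stay untainted, and an untainted
  rejecting parent stays accepted. This is how the probability in a large cell is bounded by the one
  in a window of fixed size.\<close>

lemma determined_mono:
  assumes "\<rho> > 0" "parking_wf \<rho> V" "A \<subseteq> A'" "determined \<rho> c A V" "c \<subseteq> A"
  shows "determined \<rho> c A' V"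
  unfolding determined_def
proof (intro ballI impI)
  fix x assume x: "x \<in> V \<inter> over A'" "fst x \<in> c"
  have wf: "parking_wf \<rho> (V \<inter> over A')" by (rule parking_wf_subset[OF assms(2)]) blast
  have xA: "x \<in> V \<inter> over A" using x assms(3,5) by (auto simp: mem_Times_iff)
  show "x \<notin> tainted \<rho> (core (2 * \<rho>) A') (V \<inter> over A') \<or>
        (\<exists>y \<in> accepted \<rho> (V \<inter> over A') - tainted \<rho> (core (2 * \<rho>) A') (V \<inter> over A').
           parking_edge \<rho> y x)"
  proof (cases "x \<in> tainted \<rho> (core (2 * \<rho>) A) (V \<inter> over A)")
    case True
    then obtain y where y: "y \<in> accepted \<rho> (V \<inter> over A)"
      "y \<notin> tainted \<rho> (core (2 * \<rho>) A) (V \<inter> over A)" "parking_edge \<rho> y x"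
      using assms(4) x xA unfolding determined_def by blast
    have yA: "y \<in> V \<inter> over A" using y accepted_subset by blast
    have "y \<in> accepted \<rho> (V \<inter> over A')"
      using accepted_untainted_iff[OF assms(1) wf, of y A] y yA assms(3)
      unfolding over_Int_over[OF assms(3)] by blast
    then show ?thesis using y untainted_mono[OF assms(1-3) yA y(2)] by blast
  qed (use untainted_mono[OF assms(1-3) xA] in blast)
qed

section \<open>Bounded sets are eventually determined\<close>

lemma finite_hard_core_Int_bounded:
  fixes Z :: "(real ^ 'n::finite) set"
  assumes "r > 0" "\<And>x y. x \<in> Z \<Longrightarrow> y \<in> Z \<Longrightarrow> x \<noteq> y \<Longrightarrow> dist x y \<ge> r" "bounded K"
  shows "finite (Z \<inter> K)"
proof (rule ccontr)
  assume "infinite (Z \<inter> K)"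
  moreover have "compact (closure K)" using assms(3) by simp
  ultimately obtain l where "l islimpt (Z \<inter> K)"
    using closure_subset[of K] by (metis Heine_Borel_imp_Bolzano_Weierstrass le_infI2)
  then have "l islimpt Z" by (rule islimpt_subset) blast
  moreover have "\<not> l islimpt Z"
    using assms(2) \<open>r > 0\<close> by (intro discrete_imp_not_islimpt[of r]) (auto simp: dist_commute not_less[symmetric])
  ultimately show False by blast
qed

text \<open>Induction along ancestors: once the region contains the ball of radius
  \<open>2 * \<rho>\<close> around \<open>x\<close> and has untainted all of its finitely many
  parents, nothing is left that could taint \<open>x\<close>.\<close>

lemma untainted_eventually:
  assumes "\<rho> > 0" "parking_wf \<rho> V" "x \<in> V"
    and A: "\<And>K. bounded K \<Longrightarrow> eventually (\<lambda>L::nat. K \<subseteq> A L) sequentially"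
  shows "eventually (\<lambda>L. x \<notin> tainted \<rho> (core (2 * \<rho>) (A L)) (V \<inter> over (A L))) sequentially"
proof -
  have wf: "wf (edges_on (parking_edge \<rho>) V)" and V: "V \<subseteq> UNIV \<times> {0..}" and lf: "locally_finite V"
    using assms(2) by (auto simp: parking_wf_def)
  from wf \<open>x \<in> V\<close> show ?thesis
  proof (induction x rule: wf_induct_rule)
    case (less x)
    let ?Y = "{y \<in> V. parking_edge \<rho> y x}"
    have fin: "finite ?Y" by (intro finite_parents assms V lf)
    have "eventually (\<lambda>L. \<forall>y\<in>?Y. y \<notin> tainted \<rho> (core (2 * \<rho>) (A L)) (V \<inter> over (A L))) sequentially"
      using less fin by (intro eventually_ball_finite) (auto simp: edges_on_def)
    moreover have "eventually (\<lambda>L. ball (fst x) (2 * \<rho>) \<subseteq> A L) sequentially"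
      by (intro A) auto
    ultimately show ?case
    proof eventually_elim
      case (elim L)
      have "fst x \<in> core (2 * \<rho>) (A L)" using elim by (simp add: core_def)
      then show ?case by (rule untaintedI) (use elim in blast)
    qed
  qed
qed

text \<open>A point over \<open>c\<close> is either accepted or has an accepted parent nearby. The
  accepted points in question are finitely many, so all of them are untainted from some region
  on.\<close>

lemma eventually_determined:
  assumes "\<rho> > 0" "parking_wf \<rho> V" "bounded c"
    and A: "\<And>K. bounded K \<Longrightarrow> eventually (\<lambda>L::nat. K \<subseteq> A L) sequentially"
  shows "eventually (\<lambda>L. determined \<rho> c (A L) V) sequentially"
proof -
  have V: "V \<subseteq> UNIV \<times> {0..}" and lf: "locally_finite V"
    using assms(2) by (auto simp: parking_wf_def)
  \<comment> \<open>Contains every location from which a point of \<open>c\<close> can be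
    rejected.\<close>
  define K where "K = (\<Union>x\<in>c. ball x (2 * \<rho>))"
  obtain a where a: "\<And>x. x \<in> c \<Longrightarrow> norm x \<le> a" using assms(3) by (auto simp: bounded_iff)
  have "norm y \<le> a + 2 * \<rho>" if "y \<in> K" for y
  proof -
    obtain x where "x \<in> c" "dist x y < 2 * \<rho>" using \<open>y \<in> K\<close> by (auto simp: K_def)
    then show ?thesis using a[of x] norm_triangle_ineq2[of y x] by (simp add: dist_norm norm_minus_commute)
  qed
  then have K: "bounded K" by (auto simp: bounded_iff)
  have cK: "c \<subseteq> K" using assms(1) by (auto simp: K_def)
  \<comment> \<open>This set is not confined to a bounded stretch of time, so its finiteness comes
    from its projection, which is separated and on which accepted points are determined by their
    location.\<close>
  let ?Y = "{y \<in> accepted \<rho> V. fst y \<in> K}"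
  have "fst ` ?Y \<subseteq> fst ` accepted \<rho> V \<inter> K" by blast
  moreover have "finite (fst ` accepted \<rho> V \<inter> K)"
    by (rule finite_hard_core_Int_bounded[of "2 * \<rho>"])
      (use assms(1) accepted_hard_core[OF assms(1)] K in \<open>simp, blast, blast\<close>)
  ultimately have "finite (fst ` ?Y)" by (rule finite_subset)
  moreover have "inj_on fst ?Y"
    using inj_on_fst_accepted[OF assms(1)] by (rule inj_on_subset) blast
  ultimately have fin: "finite ?Y" by (rule finite_imageD)
  have "eventually (\<lambda>L. \<forall>y\<in>?Y. y \<notin> tainted \<rho> (core (2 * \<rho>) (A L)) (V \<inter> over (A L))) sequentially"
  proof (rule eventually_ball_finite[OF fin], rule ballI)
    fix y assume "y \<in> ?Y"
    then have "y \<in> V" using accepted_subset by blast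
    from untainted_eventually[OF assms(1,2) this A]
    show "eventually (\<lambda>L. y \<notin> tainted \<rho> (core (2 * \<rho>) (A L)) (V \<inter> over (A L))) sequentially" .
  qed
  moreover have "eventually (\<lambda>L. K \<subseteq> A L) sequentially" by (intro A K)
  ultimately show ?thesis
  proof eventually_elim
    case (elim L)
    have eq: "y \<in> accepted \<rho> (V \<inter> over (A L)) - tainted \<rho> (core (2 * \<rho>) (A L)) (V \<inter> over (A L))"
      if "y \<in> ?Y" for y
    proof -
      have "y \<in> V" using that accepted_subset by blast
      moreover have "fst y \<in> A L" using that elim by auto
      ultimately have "y \<in> V \<inter> over (A L)" using V by (auto simp: mem_Times_iff)
      then show ?thesis using accepted_untainted_iff[OF assms(1,2), of y "A L"] that elim by blast
    qed
    show ?case unfolding determined_def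
    proof (intro ballI impI)
      fix x assume x: "x \<in> V \<inter> over (A L)" "fst x \<in> c"
      show "x \<notin> tainted \<rho> (core (2 * \<rho>) (A L)) (V \<inter> over (A L)) \<or>
        (\<exists>y \<in> accepted \<rho> (V \<inter> over (A L)) - tainted \<rho> (core (2 * \<rho>) (A L)) (V \<inter> over (A L)).
           parking_edge \<rho> y x)"
      proof (cases "x \<in> accepted \<rho> V")
        case True then show ?thesis using eq[of x] x cK by blast
      next
        case False
        then obtain y where y: "y \<in> accepted \<rho> V" "parking_edge \<rho> y x"
          using accepted_iff[OF assms(1,2), of x] x by blast
        then have "dist (fst x) (fst y) < 2 * \<rho>"
          using parking_edge_iff[OF assms(1), of y x] by (simp add: dist_commute)
        then have "fst y \<in> K" using x(2) by (auto simp: K_def)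
        then show ?thesis using eq[of y] y by blast
      qed
    qed
  qed
qed

section \<open>Random locally finite sets\<close>

definition random_set :: "'w measure \<Rightarrow> ('w \<Rightarrow> 'b::euclidean_space set) \<Rightarrow> bool" where
  "random_set M W \<longleftrightarrow> (\<forall>\<omega>\<in>space M. locally_finite (W \<omega>)) \<and>
     (\<forall>B\<in>sets borel. bounded B \<longrightarrow> (\<lambda>\<omega>. card (W \<omega> \<inter> B)) \<in> measurable M (count_space UNIV))"

lemma random_setD:
  assumes "random_set M W"
  shows "\<omega> \<in> space M \<Longrightarrow> locally_finite (W \<omega>)"
    and "B \<in> sets borel \<Longrightarrow> bounded B \<Longrightarrow> (\<lambda>\<omega>. card (W \<omega> \<inter> B)) \<in> measurable M (count_space UNIV)"
  using assms by (auto simp: random_set_def)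

lemma measurable_congI:
  "f \<in> measurable M N \<Longrightarrow> (\<And>\<omega>. \<omega> \<in> space M \<Longrightarrow> g \<omega> = f \<omega>) \<Longrightarrow> g \<in> measurable M N"
  using measurable_cong[of M g f N] by blast

text \<open>Counts become values of counting measure in \<open>ennreal\<close>, where countable sums
  are at hand; the following Dynkin argument is carried out there.\<close>

lemma measurable_card_iff:
  assumes "\<And>\<omega>. \<omega> \<in> space M \<Longrightarrow> finite (X \<omega>)"
  shows "(\<lambda>\<omega>. card (X \<omega>)) \<in> measurable M (count_space UNIV) \<longleftrightarrow>
    (\<lambda>\<omega>. emeasure (count_space UNIV) (X \<omega>)) \<in> borel_measurable M"
proof -
  have eq: "emeasure (count_space UNIV) (X \<omega>) = of_nat (card (X \<omega>))" if "\<omega> \<in> space M" for \<omega>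
    using assms[OF that] by simp
  have "(\<lambda>\<omega>. card (X \<omega>)) \<in> measurable M (count_space UNIV) \<longleftrightarrow>
    (\<lambda>\<omega>. of_nat (card (X \<omega>)) :: ennreal) \<in> borel_measurable M"
  proof
    assume "(\<lambda>\<omega>. card (X \<omega>)) \<in> measurable M (count_space UNIV)"
    from measurable_compose[OF this, of of_nat borel]
    show "(\<lambda>\<omega>. of_nat (card (X \<omega>)) :: ennreal) \<in> borel_measurable M" by simp
  next
    assume m: "(\<lambda>\<omega>. of_nat (card (X \<omega>)) :: ennreal) \<in> borel_measurable M"
    show "(\<lambda>\<omega>. card (X \<omega>)) \<in> measurable M (count_space UNIV)"
      unfolding measurable_count_space_eq2_countable
    proof (intro conjI ballI)
      fix k :: nat
      have "(\<lambda>\<omega>. card (X \<omega>)) -` {k} \<inter> space M = (\<lambda>\<omega>. of_nat (card (X \<omega>)) :: ennreal) -` {of_nat k} \<inter> space M"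
        by auto
      then show "(\<lambda>\<omega>. card (X \<omega>)) -` {k} \<inter> space M \<in> sets M"
        using measurable_sets[OF m, of "{of_nat k}"] by simp
    qed simp
  qed
  also have "\<dots> \<longleftrightarrow> (\<lambda>\<omega>. emeasure (count_space UNIV) (X \<omega>)) \<in> borel_measurable M"
    using eq by (intro measurable_cong) simp
  finally show ?thesis .
qed

lemma finite_locally_finite_Int: "locally_finite V \<Longrightarrow> bounded B \<Longrightarrow> finite (V \<inter> B)"
  by (simp add: locally_finite_def)

text \<open>Dynkin argument in \<open>A\<close>. For a rectangle \<open>a \<times> b\<close> the
  quantity is the indicator of \<open>a\<close> times the count in \<open>B \<inter> b\<close>;
  complements are differences of finite counts, disjoint unions are sums. The property selecting the
  points may thus depend on the randomness.\<close>

lemma measurable_emeasure_section: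
  assumes W: "random_set M W" and B: "B \<in> sets borel" "bounded B"
    and A: "A \<in> sets (M \<Otimes>\<^sub>M borel)"
  shows "(\<lambda>\<omega>. emeasure (count_space UNIV) {y \<in> W \<omega> \<inter> B. (\<omega>, y) \<in> A}) \<in> borel_measurable M"
proof -
  have fin: "finite (W \<omega> \<inter> B)" if "\<omega> \<in> space M" for \<omega>
    using that W B by (intro finite_locally_finite_Int random_setD)
  have sub: "{a \<times> b | a b. a \<in> sets M \<and> b \<in> sets borel} \<subseteq> Pow (space M \<times> UNIV)"
    using sets.sets_into_space by fastforce
  have "A \<in> sigma_sets (space M \<times> UNIV) {a \<times> b | a b. a \<in> sets M \<and> b \<in> sets borel}"
    using A by (simp add: sets_pair_measure)
  then show ?thesis
  proof (induction A rule: sigma_sets_induct_disjoint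
      [OF Int_stable_pair_measure_generator sub, consumes 1, case_names basic empty compl union])
    case (basic A)
    then obtain a b where ab: "A = a \<times> b" "a \<in> sets M" "b \<in> sets borel" by auto
    have "(\<lambda>\<omega>. card (W \<omega> \<inter> (B \<inter> b))) \<in> measurable M (count_space UNIV)"
      using ab B by (intro random_setD(2)[OF W]) (auto intro: bounded_subset)
    then have "(\<lambda>\<omega>. emeasure (count_space UNIV) (W \<omega> \<inter> (B \<inter> b))) \<in> borel_measurable M"
      using fin by (subst measurable_card_iff[symmetric]) (auto intro: rev_finite_subset[OF fin])
    then have "(\<lambda>\<omega>. emeasure (count_space UNIV) (W \<omega> \<inter> (B \<inter> b)) * indicator a \<omega>) \<in> borel_measurable M"
      using ab by simp
    moreover have "emeasure (count_space UNIV) {y \<in> W \<omega> \<inter> B. (\<omega>, y) \<in> A} =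
        emeasure (count_space UNIV) (W \<omega> \<inter> (B \<inter> b)) * indicator a \<omega>" for \<omega>
    proof (cases "\<omega> \<in> a")
      case True
      then have "{y \<in> W \<omega> \<inter> B. (\<omega>, y) \<in> A} = W \<omega> \<inter> (B \<inter> b)" using ab by auto
      then show ?thesis using True by simp
    next
      case False
      then have "{y \<in> W \<omega> \<inter> B. (\<omega>, y) \<in> A} = {}" using ab by auto
      then show ?thesis using False by (simp only: emeasure_empty) simp
    qed
    ultimately show ?case by simp
  next
    case empty
    show ?case by simp
  next
    case (compl A)
    have "(\<lambda>\<omega>. emeasure (count_space UNIV) (W \<omega> \<inter> B)) \<in> borel_measurable M"
      using random_setD(2)[OF W B] fin by (subst measurable_card_iff[symmetric]) auto
    then have "(\<lambda>\<omega>. emeasure (count_space UNIV) (W \<omega> \<inter> B) -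
        emeasure (count_space UNIV) {y \<in> W \<omega> \<inter> B. (\<omega>, y) \<in> A}) \<in> borel_measurable M"
      using compl by (intro borel_measurable_minus_ennreal)
    moreover have "emeasure (count_space UNIV) {y \<in> W \<omega> \<inter> B. (\<omega>, y) \<in> space M \<times> UNIV - A} =
      emeasure (count_space UNIV) (W \<omega> \<inter> B) - emeasure (count_space UNIV) {y \<in> W \<omega> \<inter> B. (\<omega>, y) \<in> A}"
      if "\<omega> \<in> space M" for \<omega>
    proof -
      have f: "finite {y \<in> W \<omega> \<inter> B. (\<omega>, y) \<in> A}" using fin[OF that] by (rule rev_finite_subset) auto
      have "{y \<in> W \<omega> \<inter> B. (\<omega>, y) \<in> space M \<times> UNIV - A} = W \<omega> \<inter> B - {y \<in> W \<omega> \<inter> B. (\<omega>, y) \<in> A}"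
        using that by auto
      then show ?thesis using f by (simp only:) (rule emeasure_Diff, auto)
    qed
    ultimately show ?case by (rule measurable_congI)
  next
    case (union A)
    have "(\<lambda>\<omega>. \<Sum>i. emeasure (count_space UNIV) {y \<in> W \<omega> \<inter> B. (\<omega>, y) \<in> A i}) \<in> borel_measurable M"
      using union by (intro borel_measurable_suminf_order) auto
    moreover have "emeasure (count_space UNIV) {y \<in> W \<omega> \<inter> B. (\<omega>, y) \<in> \<Union> (range A)} =
      (\<Sum>i. emeasure (count_space UNIV) {y \<in> W \<omega> \<inter> B. (\<omega>, y) \<in> A i})" for \<omega>
    proof -
      have "{y \<in> W \<omega> \<inter> B. (\<omega>, y) \<in> \<Union> (range A)} = (\<Union>i. {y \<in> W \<omega> \<inter> B. (\<omega>, y) \<in> A i})" by auto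
      moreover have "disjoint_family (\<lambda>i. {y \<in> W \<omega> \<inter> B. (\<omega>, y) \<in> A i})"
        using union(1) unfolding disjoint_family_on_def by blast
      ultimately show ?thesis by (simp add: suminf_emeasure)
    qed
    ultimately show ?case by simp
  qed
qed

text \<open>Closes random sets under thinning by a predicate that may itself be random, which is the
  shape of every operation in the parking recursion.\<close>

lemma random_set_filter:
  assumes W: "random_set M W" and \<phi>: "Measurable.pred (M \<Otimes>\<^sub>M borel) (\<lambda>z. \<phi> (fst z) (snd z))"
  shows "random_set M (\<lambda>\<omega>. {y \<in> W \<omega>. \<phi> \<omega> y})"
  unfolding random_set_def
proof (intro conjI ballI impI)
  fix \<omega> assume "\<omega> \<in> space M"
  then show "locally_finite {y \<in> W \<omega>. \<phi> \<omega> y}"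
    using random_setD(1)[OF W] by (auto intro: locally_finite_subset)
next
  fix B :: "'b set" assume B: "B \<in> sets borel" "bounded B"
  define A where "A = {z \<in> space (M \<Otimes>\<^sub>M borel). \<phi> (fst z) (snd z)}"
  have A: "A \<in> sets (M \<Otimes>\<^sub>M borel)" using \<phi> by (simp add: A_def pred_def)
  have eq: "{y \<in> W \<omega>. \<phi> \<omega> y} \<inter> B = {y \<in> W \<omega> \<inter> B. (\<omega>, y) \<in> A}" if "\<omega> \<in> space M" for \<omega>
    using that by (auto simp: A_def space_pair_measure)
  have fin: "finite {y \<in> W \<omega> \<inter> B. (\<omega>, y) \<in> A}" if "\<omega> \<in> space M" for \<omega>
    using finite_locally_finite_Int[OF random_setD(1)[OF W that] B(2)] by (rule rev_finite_subset) auto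
  have "(\<lambda>\<omega>. card {y \<in> W \<omega> \<inter> B. (\<omega>, y) \<in> A}) \<in> measurable M (count_space UNIV)"
    using measurable_emeasure_section[OF W B A] fin by (subst measurable_card_iff)
  then show "(\<lambda>\<omega>. card ({y \<in> W \<omega>. \<phi> \<omega> y} \<inter> B)) \<in> measurable M (count_space UNIV)"
    by (rule measurable_congI) (simp only: eq)
qed

text \<open>A point exists iff the thinned set has a nonzero count in some ball of integer radius, a
  countable union of measurable events.\<close>

lemma pred_bex_random_set:
  assumes W: "random_set M W" and \<phi>: "Measurable.pred (M \<Otimes>\<^sub>M borel) (\<lambda>z. \<phi> (fst z) (snd z))"
  shows "Measurable.pred M (\<lambda>\<omega>. \<exists>y\<in>W \<omega>. \<phi> \<omega> y)"
proof -
  have W': "random_set M (\<lambda>\<omega>. {y \<in> W \<omega>. \<phi> \<omega> y})" by (rule random_set_filter[OF assms])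
  have [measurable]: "(\<lambda>\<omega>. card ({y \<in> W \<omega>. \<phi> \<omega> y} \<inter> cball 0 (real n))) \<in> measurable M (count_space UNIV)"
    for n by (rule random_setD(2)[OF W']) auto
  have "Measurable.pred M (\<lambda>\<omega>. \<exists>n::nat. card ({y \<in> W \<omega>. \<phi> \<omega> y} \<inter> cball 0 (real n)) \<noteq> 0)"
    by measurable
  moreover have "(\<exists>y\<in>W \<omega>. \<phi> \<omega> y) \<longleftrightarrow> (\<exists>n::nat. card ({y \<in> W \<omega>. \<phi> \<omega> y} \<inter> cball 0 (real n)) \<noteq> 0)"
    if "\<omega> \<in> space M" for \<omega>
  proof (rule iffI[rotated])
    assume "\<exists>n::nat. card ({y \<in> W \<omega>. \<phi> \<omega> y} \<inter> cball 0 (real n)) \<noteq> 0"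
    then obtain n where "card ({y \<in> W \<omega>. \<phi> \<omega> y} \<inter> cball 0 (real n)) \<noteq> 0" by blast
    then have "{y \<in> W \<omega>. \<phi> \<omega> y} \<inter> cball 0 (real n) \<noteq> {}" using card.empty by metis
    then show "\<exists>y\<in>W \<omega>. \<phi> \<omega> y" by blast
  next
    assume "\<exists>y\<in>W \<omega>. \<phi> \<omega> y"
    then obtain y where y: "y \<in> W \<omega>" "\<phi> \<omega> y" by blast
    obtain n :: nat where "norm y \<le> real n" using real_arch_simple by blast
    then have "y \<in> {y \<in> W \<omega>. \<phi> \<omega> y} \<inter> cball 0 (real n)" using y by simp
    moreover have "finite ({y \<in> W \<omega>. \<phi> \<omega> y} \<inter> cball 0 (real n))"
      using random_setD(1)[OF W' that] by (intro finite_locally_finite_Int) auto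
    ultimately have "card ({y \<in> W \<omega>. \<phi> \<omega> y} \<inter> cball 0 (real n)) \<noteq> 0" by (metis card_0_eq empty_iff)
    then show "\<exists>n::nat. card ({y \<in> W \<omega>. \<phi> \<omega> y} \<inter> cball 0 (real n)) \<noteq> 0" by blast
  qed
  ultimately show ?thesis by (rule measurable_congI)
qed

text \<open>Adds a free point to the sample space, so that a property of this point may quantify
  over the random set.\<close>

lemma random_set_fst:
  assumes "random_set M W" shows "random_set (M \<Otimes>\<^sub>M N) (\<lambda>z. W (fst z))"
  unfolding random_set_def
proof (intro conjI ballI impI)
  show "locally_finite (W (fst z))" if "z \<in> space (M \<Otimes>\<^sub>M N)" for z
    using that by (intro random_setD(1)[OF assms]) (auto simp: space_pair_measure)
  show "(\<lambda>z. card (W (fst z) \<inter> B)) \<in> measurable (M \<Otimes>\<^sub>M N) (count_space UNIV)"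
    if "B \<in> sets borel" "bounded B" for B
    by (rule measurable_compose[OF measurable_fst random_setD(2)[OF assms that]])
qed

lemma pred_mem_random_set:
  fixes W :: "'w \<Rightarrow> 'b::euclidean_space set"
  assumes "random_set M W"
  shows "Measurable.pred (M \<Otimes>\<^sub>M borel) (\<lambda>z. snd z \<in> W (fst z))"
proof -
  have "Measurable.pred (M \<Otimes>\<^sub>M borel) (\<lambda>z::'w \<times> 'b. \<exists>y\<in>W (fst z). y = snd z)"
    by (rule pred_bex_random_set[OF random_set_fst[OF assms]]) measurable
  then show ?thesis by simp
qed

lemma pred_bex2_random_set:
  fixes E :: "'b::euclidean_space \<Rightarrow> 'c::euclidean_space \<Rightarrow> bool"
  assumes W: "random_set M W" and E: "Measurable.pred (borel \<Otimes>\<^sub>M borel) (\<lambda>z. E (fst z) (snd z))"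
  shows "Measurable.pred (M \<Otimes>\<^sub>M borel) (\<lambda>z. \<exists>x\<in>W (fst z). E x (snd z))"
proof -
  have "(\<lambda>z. (snd z, snd (fst z))) \<in> measurable ((M \<Otimes>\<^sub>M borel) \<Otimes>\<^sub>M borel) (borel \<Otimes>\<^sub>M borel)"
    by measurable
  from measurable_compose[OF this E] show ?thesis
    by (intro pred_bex_random_set[OF random_set_fst[OF W]]) simp
qed

section \<open>Measurability of the parking process\<close>

lemma borel_measurable_fst_borel [measurable]:
  "(fst :: 'a::second_countable_topology \<times> 'b::second_countable_topology \<Rightarrow> 'a) \<in> borel_measurable borel"
  and borel_measurable_snd_borel [measurable]:
  "(snd :: 'a::second_countable_topology \<times> 'b::second_countable_topology \<Rightarrow> 'b) \<in> borel_measurable borel"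
  by (intro borel_measurable_continuous_onI continuous_on_fst continuous_on_snd continuous_on_id)+

lemma borel_measurable_vec_nth_borel [measurable]:
  "(\<lambda>x :: real ^ 'n. x $ i) \<in> borel_measurable borel"
  by (intro borel_measurable_continuous_onI continuous_intros)

lemma pred_parking_edge:
  assumes "\<rho> > 0"
  shows "Measurable.pred (borel \<Otimes>\<^sub>M borel)
    (\<lambda>z :: ((real ^ 'n::{finite,linorder}) \<times> real) \<times> ((real ^ 'n::{finite,linorder}) \<times> real). parking_edge \<rho> (fst z) (snd z))"
  unfolding parking_edge_iff[OF assms] lex_less_def by measurable

lemma random_set_diff:
  assumes "random_set M W" "random_set M W'"
  shows "random_set M (\<lambda>\<omega>. W \<omega> - W' \<omega>)"
  unfolding set_diff_eq
  using random_set_filter[OF assms(1), of "\<lambda>\<omega> y. y \<notin> W' \<omega>"] pred_mem_random_set[OF assms(2)] by simp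

lemma random_set_UN:
  assumes "random_set M W" "\<And>i::nat. random_set M (F i)" "\<And>\<omega> i. F i \<omega> \<subseteq> W \<omega>"
  shows "random_set M (\<lambda>\<omega>. \<Union>i. F i \<omega>)"
proof -
  have [measurable]: "Measurable.pred (M \<Otimes>\<^sub>M borel) (\<lambda>z. snd z \<in> F i (fst z))" for i
    by (rule pred_mem_random_set[OF assms(2)])
  have "random_set M (\<lambda>\<omega>. {y \<in> W \<omega>. \<exists>i. y \<in> F i \<omega>})"
    by (rule random_set_filter[OF assms(1)]) measurable
  moreover have "{y \<in> W \<omega>. \<exists>i. y \<in> F i \<omega>} = (\<Union>i. F i \<omega>)" for \<omega> using assms(3) by blast
  ultimately show ?thesis by simp
qed

lemma random_set_parking:
  fixes W :: "'w \<Rightarrow> ((real ^ 'n::{finite,linorder}) \<times> real) set"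
  assumes \<rho>: "\<rho> > 0" and W: "random_set M W"
  shows random_set_roots: "random_set M (\<lambda>\<omega>. graph_roots (parking_edge \<rho>) (W \<omega>))"
    and random_set_rest: "random_set M (\<lambda>\<omega>. parking_rest \<rho> (W \<omega>) i)"
    and random_set_accepted: "random_set M (\<lambda>\<omega>. accepted \<rho> (W \<omega>))"
proof -
  have roots: "random_set M (\<lambda>\<omega>. graph_roots (parking_edge \<rho>) (V \<omega>))" if V: "random_set M V" for V
  proof -
    have [measurable]: "Measurable.pred (M \<Otimes>\<^sub>M borel) (\<lambda>z. \<exists>x\<in>V (fst z). parking_edge \<rho> x (snd z))"
      by (rule pred_bex2_random_set[OF V pred_parking_edge[OF \<rho>]])
    show ?thesis unfolding graph_roots_def by (rule random_set_filter[OF V]) measurable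
  qed
  show "random_set M (\<lambda>\<omega>. graph_roots (parking_edge \<rho>) (W \<omega>))" by (rule roots[OF W])
  have rest: "random_set M (\<lambda>\<omega>. parking_rest \<rho> (W \<omega>) i)" for i
  proof (induction i)
    case 0 then show ?case using W by simp
  next
    case (Suc i)
    let ?V = "\<lambda>\<omega>. parking_rest \<rho> (W \<omega>) i" and ?F = "\<lambda>\<omega>. graph_roots (parking_edge \<rho>) (parking_rest \<rho> (W \<omega>) i)"
    have F: "random_set M ?F" by (rule roots[OF Suc])
    have [measurable]: "Measurable.pred (M \<Otimes>\<^sub>M borel) (\<lambda>z. snd z \<in> ?F (fst z))"
      by (rule pred_mem_random_set[OF F])
    have [measurable]: "Measurable.pred (M \<Otimes>\<^sub>M borel) (\<lambda>z. \<exists>x\<in>?F (fst z). parking_edge \<rho> x (snd z))"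
      by (rule pred_bex2_random_set[OF F pred_parking_edge[OF \<rho>]])
    have "random_set M (\<lambda>\<omega>. {y \<in> ?V \<omega>. y \<notin> ?F \<omega> \<and> \<not> (\<exists>x\<in>?F \<omega>. parking_edge \<rho> x y)})"
      by (rule random_set_filter[OF Suc]) measurable
    moreover have "parking_rest \<rho> (W \<omega>) (Suc i) =
        {y \<in> ?V \<omega>. y \<notin> ?F \<omega> \<and> \<not> (\<exists>x\<in>?F \<omega>. parking_edge \<rho> x y)}" for \<omega>
      by (auto simp: Let_def graph_offspring_def)
    ultimately show ?case by simp
  qed
  show "random_set M (\<lambda>\<omega>. parking_rest \<rho> (W \<omega>) i)" by (rule rest)
  show "random_set M (\<lambda>\<omega>. accepted \<rho> (W \<omega>))"
    unfolding accepted_def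
  proof (rule random_set_UN[OF W])
    show "random_set M (\<lambda>\<omega>. parking_accepted \<rho> (W \<omega>) i)" for i
      unfolding parking_accepted_def by (rule roots[OF rest])
    show "parking_accepted \<rho> (W \<omega>) i \<subseteq> W \<omega>" for \<omega> i
      using accepted_subset[of \<rho> "W \<omega>"] by (auto simp: accepted_def)
  qed
qed

lemma random_set_tainted:
  fixes W :: "'w \<Rightarrow> ((real ^ 'n::{finite,linorder}) \<times> real) set"
  assumes \<rho>: "\<rho> > 0" and W: "random_set M W" and C [measurable]: "C \<in> sets borel"
  shows "random_set M (\<lambda>\<omega>. tainted \<rho> C (W \<omega>))"
  unfolding tainted_def
proof (rule random_set_UN[OF W])
  show "random_set M (\<lambda>\<omega>. tainted_upto \<rho> C (W \<omega>) i)" for i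
  proof (induction i)
    case 0
    show ?case unfolding tainted_upto.simps by (rule random_set_filter[OF W]) measurable
  next
    case (Suc i)
    show ?case unfolding tainted_upto.simps
      by (rule random_set_filter[OF W], rule pred_bex2_random_set[OF Suc pred_parking_edge[OF \<rho>]])
  qed
  show "tainted_upto \<rho> C (W \<omega>) i \<subseteq> W \<omega>" for \<omega> i by (rule tainted_upto_subset)
qed

text \<open>In this form the core is visibly closed, whatever \<open>A\<close> is.\<close>

lemma core_eq: "core r A = (\<Inter>w\<in>-A. {z. r \<le> dist z w})"
proof (rule set_eqI)
  fix z
  have "z \<in> core r A \<longleftrightarrow> (\<forall>w. dist z w < r \<longrightarrow> w \<in> A)"
    by (auto simp add: core_def)
  also have "\<dots> \<longleftrightarrow> (\<forall>w. w \<notin> A \<longrightarrow> r \<le> dist z w)"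
    by (meson not_le)
  finally show "z \<in> core r A \<longleftrightarrow> z \<in> (\<Inter>w\<in>-A. {z. r \<le> dist z w})" by (auto simp: Ball_def)
qed

lemma borel_core: "core r A \<in> sets borel"
proof -
  have "closed (core r A)"
    unfolding core_eq by (intro closed_INT ballI closed_Collect_le continuous_intros)
  then show ?thesis by (rule borel_closed)
qed

text \<open>Being determined is the absence of a bad point, a single existential over a random set;
  only points over \<open>A\<close> enter.\<close>

lemma pred_determined:
  fixes W :: "'w \<Rightarrow> ((real ^ 'n::{finite,linorder}) \<times> real) set"
  assumes \<rho>: "\<rho> > 0" and W: "random_set M (\<lambda>\<omega>. W \<omega> \<inter> over A)" and c [measurable]: "c \<in> sets borel"
  shows "Measurable.pred M (\<lambda>\<omega>. determined \<rho> c A (W \<omega>))"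
proof -
  let ?T = "\<lambda>\<omega>. tainted \<rho> (core (2 * \<rho>) A) (W \<omega> \<inter> over A)"
  let ?Y = "\<lambda>\<omega>. accepted \<rho> (W \<omega> \<inter> over A) - ?T \<omega>"
  have T: "random_set M ?T" by (rule random_set_tainted[OF \<rho> W borel_core])
  have Y: "random_set M ?Y" by (intro random_set_diff random_set_accepted T W \<rho>)
  have [measurable]: "Measurable.pred (M \<Otimes>\<^sub>M borel) (\<lambda>z. snd z \<in> ?T (fst z))"
    by (rule pred_mem_random_set[OF T])
  have [measurable]: "Measurable.pred (M \<Otimes>\<^sub>M borel) (\<lambda>z. \<exists>y\<in>?Y (fst z). parking_edge \<rho> y (snd z))"
    by (rule pred_bex2_random_set[OF Y pred_parking_edge[OF \<rho>]])
  have "Measurable.pred M (\<lambda>\<omega>. \<exists>x\<in>W \<omega> \<inter> over A. fst x \<in> c \<and> x \<in> ?T \<omega> \<and>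
      \<not> (\<exists>y\<in>?Y \<omega>. parking_edge \<rho> y x))"
    by (rule pred_bex_random_set[OF W]) measurable
  then have "Measurable.pred M (\<lambda>\<omega>. \<not> (\<exists>x\<in>W \<omega> \<inter> over A. fst x \<in> c \<and> x \<in> ?T \<omega> \<and>
      \<not> (\<exists>y\<in>?Y \<omega>. parking_edge \<rho> y x)))" by (rule pred_intros_logic)
  moreover have "determined \<rho> c A (W \<omega>) \<longleftrightarrow> \<not> (\<exists>x\<in>W \<omega> \<inter> over A. fst x \<in> c \<and> x \<in> ?T \<omega> \<and>
      \<not> (\<exists>y\<in>?Y \<omega>. parking_edge \<rho> y x))" for \<omega>
    unfolding determined_def by blast
  ultimately show ?thesis by (rule measurable_congI)
qed

text \<open>The preimage of a bounded \<open>B\<close> under the projection is unbounded in time.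
  The count is therefore a limit over growing time windows, eventually constant because only
  finitely many accepted points project into \<open>B\<close>.\<close>

lemma random_set_fst_accepted:
  fixes W :: "'w \<Rightarrow> ((real ^ 'n::{finite,linorder}) \<times> real) set"
  assumes \<rho>: "\<rho> > 0" and W: "random_set M W"
  shows "random_set M (\<lambda>\<omega>. fst ` accepted \<rho> (W \<omega>))"
  unfolding random_set_def
proof (intro conjI ballI impI)
  have lf: "finite (fst ` accepted \<rho> V \<inter> K)" if "bounded K"
    for K and V :: "((real, 'n) vec \<times> real) set"
    by (rule finite_hard_core_Int_bounded[of "2 * \<rho>"])
      (use \<rho> accepted_hard_core[OF \<rho>] that in \<open>simp, blast, blast\<close>)
  then show "locally_finite (fst ` accepted \<rho> (W \<omega>))" for \<omega> by (simp add: locally_finite_def)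
  fix B :: "(real, 'n) vec set" assume B: "B \<in> sets borel" "bounded B"
  let ?N = "\<lambda>k \<omega>. card (accepted \<rho> (W \<omega>) \<inter> B \<times> {- real k..real k})"
  have [measurable]: "?N k \<in> measurable M (count_space UNIV)" for k
  proof (rule random_setD(2)[OF random_set_accepted[OF \<rho> W]])
    show "B \<times> {- real k..real k} \<in> sets borel" using B by (simp add: borel_Times)
    show "bounded (B \<times> {- real k..real k})" using B by (intro bounded_Times) auto
  qed
  have lim: "(\<lambda>k. real (?N k \<omega>)) \<longlonglongrightarrow> real (card (fst ` accepted \<rho> (W \<omega>) \<inter> B))" for \<omega>
  proof -
    let ?X = "{y \<in> accepted \<rho> (W \<omega>). fst y \<in> B}"
    have eq: "fst ` accepted \<rho> (W \<omega>) \<inter> B = fst ` ?X" by blast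
    have inj: "inj_on fst ?X" using inj_on_fst_accepted[OF \<rho>] by (rule inj_on_subset) blast
    have "finite (fst ` ?X)" using lf[OF B(2)] unfolding eq[symmetric] .
    then have fin: "finite ?X" using inj by (rule finite_imageD)
    obtain m :: nat where m: "Max (insert 0 ((\<lambda>y. \<bar>snd y\<bar>) ` ?X)) \<le> real m" using real_arch_simple by blast
    have "?N k \<omega> = card (fst ` accepted \<rho> (W \<omega>) \<inter> B)" if "k \<ge> m" for k
    proof -
      have "\<bar>snd y\<bar> \<le> real k" if "y \<in> ?X" for y
      proof -
        have "\<bar>snd y\<bar> \<le> Max (insert 0 ((\<lambda>y. \<bar>snd y\<bar>) ` ?X))" using fin that by (intro Max_ge) auto
        then show ?thesis using m \<open>k \<ge> m\<close> by linarith
      qed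
      then have "accepted \<rho> (W \<omega>) \<inter> B \<times> {- real k..real k} = ?X"
        by (auto simp: mem_Times_iff abs_le_iff) (smt (verit))+
      then show ?thesis unfolding eq card_image[OF inj] by simp
    qed
    then have "eventually (\<lambda>k. real (?N k \<omega>) = real (card (fst ` accepted \<rho> (W \<omega>) \<inter> B))) sequentially"
      unfolding eventually_sequentially by metis
    then show ?thesis by (rule tendsto_eventually)
  qed
  have "(\<lambda>\<omega>. real (card (fst ` accepted \<rho> (W \<omega>) \<inter> B))) \<in> borel_measurable M"
    by (rule borel_measurable_LIMSEQ_real[OF lim]) measurable
  then have "(\<lambda>\<omega>. ennreal (real (card (fst ` accepted \<rho> (W \<omega>) \<inter> B)))) \<in> borel_measurable M" by measurable
  then show "(\<lambda>\<omega>. card (fst ` accepted \<rho> (W \<omega>) \<inter> B)) \<in> measurable M (count_space UNIV)"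
    using lf[OF B(2)] by (subst measurable_card_iff) (auto simp: ennreal_of_nat_eq_real_of_nat)
qed

lemma measurable_lf_space:
  fixes W :: "'w \<Rightarrow> (real ^ 'n) set"
  assumes "random_set M W"
  shows "W \<in> measurable M lf_space"
  unfolding lf_space_def
proof (rule measurable_measure_of)
  show "W \<in> space M \<rightarrow> {\<zeta>. locally_finite \<zeta>}" using random_setD(1)[OF assms] by auto
  fix y :: "(real ^ 'n) set set"
  assume "y \<in> {{\<zeta>. locally_finite \<zeta> \<and> card (\<zeta> \<inter> B) = k} | B k. B \<in> sets borel \<and> bounded B}"
  then obtain B k where y: "y = {\<zeta>. locally_finite \<zeta> \<and> card (\<zeta> \<inter> B) = k}" "B \<in> sets borel" "bounded B" by blast
  have "W -` y \<inter> space M = (\<lambda>\<omega>. card (W \<omega> \<inter> B)) -` {k} \<inter> space M"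
    using random_setD(1)[OF assms] by (auto simp: y)
  then show "W -` y \<inter> space M \<in> sets M"
    using measurable_sets[OF random_setD(2)[OF assms y(2,3)], of "{k}"] by simp
qed blast

text \<open>The events observable inside \<open>A\<close>; the space is that of all locally finite sets for every \<open>A\<close>.\<close>

definition configurations :: "'b::euclidean_space set \<Rightarrow> 'b set measure" where
  "configurations A = sigma {V. locally_finite V}
     {{V. locally_finite V \<and> card (V \<inter> B) = k} | B k. B \<in> sets borel \<and> bounded B \<and> B \<subseteq> A}"

lemma space_configurations [simp]: "space (configurations A) = {V. locally_finite V}"
  unfolding configurations_def by (rule space_measure_of) blast

lemma sets_configurations:
  "sets (configurations A) = sigma_sets {V. locally_finite V}
     {{V. locally_finite V \<and> card (V \<inter> B) = k} | B k. B \<in> sets borel \<and> bounded B \<and> B \<subseteq> A}"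
  unfolding configurations_def by (rule sets_measure_of) blast

lemma random_set_configurations:
  assumes "A \<in> sets borel"
  shows "random_set (configurations A) (\<lambda>V. V \<inter> A)"
  unfolding random_set_def
proof (intro conjI ballI impI)
  fix V assume "V \<in> space (configurations A)"
  then show "locally_finite (V \<inter> A)" by (auto intro: locally_finite_subset)
next
  fix B :: "'a set" assume B: "B \<in> sets borel" "bounded B"
  show "(\<lambda>V. card (V \<inter> A \<inter> B)) \<in> measurable (configurations A) (count_space UNIV)"
    unfolding measurable_count_space_eq2_countable
  proof (intro conjI ballI)
    fix k :: nat
    have "(\<lambda>V. card (V \<inter> A \<inter> B)) -` {k} \<inter> space (configurations A) =
        {V. locally_finite V \<and> card (V \<inter> (A \<inter> B)) = k}" by (auto simp: Int_assoc)
    moreover have "{V. locally_finite V \<and> card (V \<inter> (A \<inter> B)) = k} \<in> sets (configurations A)"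
      unfolding sets_configurations using B assms by (intro sigma_sets.Basic) (blast intro: bounded_subset)
    ultimately show "(\<lambda>V. card (V \<inter> A \<inter> B)) -` {k} \<inter> space (configurations A) \<in> sets (configurations A)"
      by simp
  qed simp
qed

text \<open>Measurability refers to the events over \<open>A\<close> alone; this is what later turns
  disjointness of cells into independence.\<close>

lemma random_set_random_parking:
  fixes A :: "(real ^ 'n::{finite,linorder}) set"
  assumes "\<rho> > 0" "A \<in> sets borel"
  shows "random_set (configurations (over A)) (random_parking \<rho> A)"
proof -
  have "over A \<in> sets borel" using assms(2) by (simp add: borel_Times)
  from random_set_fst_accepted[OF assms(1) random_set_configurations[OF this]]
  show ?thesis unfolding random_parking_eq[abs_def] .
qed

section \<open>Poisson processes\<close>

text \<open>Finite intersections of the generators of \<open>configurations A\<close>, which makes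
  the generating family stable under intersection.\<close>

definition cylinders :: "'b::euclidean_space set \<Rightarrow> 'b set set set" where
  "cylinders A = {{V. locally_finite V \<and> (\<forall>z\<in>K. card (V \<inter> fst z) = snd z)} | K.
     finite K \<and> (\<forall>z\<in>K. fst z \<in> sets borel \<and> bounded (fst z) \<and> fst z \<subseteq> A)}"

lemma cylindersD:
  assumes "X \<in> cylinders A"
  shows "\<exists>K. finite K \<and> (\<forall>z\<in>K. fst z \<in> sets borel \<and> bounded (fst z) \<and> fst z \<subseteq> A) \<and>
    X = {V. locally_finite V \<and> (\<forall>z\<in>K. card (V \<inter> fst z) = snd z)}"
  using assms unfolding cylinders_def by blast

lemma Int_stable_cylinders: "Int_stable (cylinders A)"
proof (rule Int_stableI)
  fix X Y assume "X \<in> cylinders A" "Y \<in> cylinders A"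
  then obtain K L where K: "X = {V. locally_finite V \<and> (\<forall>z\<in>K. card (V \<inter> fst z) = snd z)}"
    "finite K" "\<forall>z\<in>K. fst z \<in> sets borel \<and> bounded (fst z) \<and> fst z \<subseteq> A"
    and L: "Y = {V. locally_finite V \<and> (\<forall>z\<in>L. card (V \<inter> fst z) = snd z)}"
    "finite L" "\<forall>z\<in>L. fst z \<in> sets borel \<and> bounded (fst z) \<and> fst z \<subseteq> A"
    unfolding cylinders_def by blast
  have "X \<inter> Y = {V. locally_finite V \<and> (\<forall>z\<in>K \<union> L. card (V \<inter> fst z) = snd z)}"
    unfolding K L by auto
  moreover have "finite (K \<union> L)" "\<forall>z\<in>K \<union> L. fst z \<in> sets borel \<and> bounded (fst z) \<and> fst z \<subseteq> A"
    using K L by auto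
  ultimately show "X \<inter> Y \<in> cylinders A" unfolding cylinders_def by blast
qed

lemma sets_configurations_cylinders:
  "sets (configurations A) = sigma_sets {V. locally_finite V} (cylinders A)"
  unfolding sets_configurations
proof (rule sigma_sets_eqI)
  fix X assume "X \<in> {{V. locally_finite V \<and> card (V \<inter> B) = k} | B k. B \<in> sets borel \<and> bounded B \<and> B \<subseteq> A}"
  then obtain B k where B: "X = {V. locally_finite V \<and> card (V \<inter> B) = k}" "B \<in> sets borel" "bounded B" "B \<subseteq> A"
    by blast
  have "X \<in> cylinders A"
    unfolding cylinders_def by (rule CollectI, rule exI[of _ "{(B, k)}"]) (use B in simp)
  then show "X \<in> sigma_sets {V. locally_finite V} (cylinders A)" by (rule sigma_sets.Basic)
next
  let ?S = "sigma_sets {V. locally_finite V}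
     {{V. locally_finite V \<and> card (V \<inter> B) = k} | B k. B \<in> sets borel \<and> bounded B \<and> B \<subseteq> A}"
  fix X assume "X \<in> cylinders A"
  then obtain K where K: "X = {V. locally_finite V \<and> (\<forall>z\<in>K. card (V \<inter> fst z) = snd z)}"
    "finite K" "\<forall>z\<in>K. fst z \<in> sets borel \<and> bounded (fst z) \<and> fst z \<subseteq> A"
    unfolding cylinders_def by blast
  have "X \<in> sets (configurations A)" unfolding K(1) using K(2,3)
  proof (induction K)
    case empty
    show ?case using sets.top[of "configurations A"] by simp
  next
    case (insert z K)
    have "{V. locally_finite V \<and> (\<forall>z\<in>insert z K. card (V \<inter> fst z) = snd z)} =
      {V. locally_finite V \<and> card (V \<inter> fst z) = snd z} \<inter>
      {V. locally_finite V \<and> (\<forall>z\<in>K. card (V \<inter> fst z) = snd z)}" by auto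
    moreover have "{V. locally_finite V \<and> card (V \<inter> fst z) = snd z} \<in> sets (configurations A)"
      unfolding sets_configurations using insert by (intro sigma_sets.Basic) blast
    moreover have "{V. locally_finite V \<and> (\<forall>z\<in>K. card (V \<inter> fst z) = snd z)} \<in> sets (configurations A)"
      using insert by simp
    ultimately show ?case by (simp only: sets.Int)
  qed
  then show "X \<in> ?S" unfolding sets_configurations .
qed

section \<open>Law and independence of the Poisson process\<close>

lemma unit_poisson_processD:
  fixes I :: "nat set"
  assumes "unit_poisson_process M E P"
  shows "prob_space M"
    and "\<omega> \<in> space M \<Longrightarrow> P \<omega> \<subseteq> E" and "\<omega> \<in> space M \<Longrightarrow> locally_finite (P \<omega>)"
    and "B \<in> sets borel \<Longrightarrow> bounded B \<Longrightarrow> B \<subseteq> E \<Longrightarrow>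
        (\<lambda>\<omega>. card (P \<omega> \<inter> B)) \<in> measurable M (count_space UNIV)"
    and "B \<in> sets borel \<Longrightarrow> bounded B \<Longrightarrow> B \<subseteq> E \<Longrightarrow>
        measure M {\<omega> \<in> space M. card (P \<omega> \<inter> B) = k}
               = exp (- measure lborel B) * measure lborel B ^ k / fact k"
    and "finite I \<Longrightarrow> disjoint_family_on C I \<Longrightarrow>
        (\<And>i. i \<in> I \<Longrightarrow> C i \<in> sets borel \<and> bounded (C i) \<and> C i \<subseteq> E) \<Longrightarrow>
        prob_space.indep_vars M (\<lambda>_. count_space UNIV) (\<lambda>i \<omega>. card (P \<omega> \<inter> C i)) I"
proof -
  note U = assms[unfolded unit_poisson_process_def]
  show "prob_space M" using U by (rule conjunct1)
  show "\<omega> \<in> space M \<Longrightarrow> P \<omega> \<subseteq> E" "\<omega> \<in> space M \<Longrightarrow> locally_finite (P \<omega>)"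
    using U[THEN conjunct2, THEN conjunct1] by simp_all
  show "B \<in> sets borel \<Longrightarrow> bounded B \<Longrightarrow> B \<subseteq> E \<Longrightarrow>
        (\<lambda>\<omega>. card (P \<omega> \<inter> B)) \<in> measurable M (count_space UNIV)"
    "B \<in> sets borel \<Longrightarrow> bounded B \<Longrightarrow> B \<subseteq> E \<Longrightarrow>
        measure M {\<omega> \<in> space M. card (P \<omega> \<inter> B) = k}
               = exp (- measure lborel B) * measure lborel B ^ k / fact k"
    using U[THEN conjunct2, THEN conjunct2, THEN conjunct1] by simp_all
  show "finite I \<Longrightarrow> disjoint_family_on C I \<Longrightarrow>
        (\<And>i. i \<in> I \<Longrightarrow> C i \<in> sets borel \<and> bounded (C i) \<and> C i \<subseteq> E) \<Longrightarrow>
        prob_space.indep_vars M (\<lambda>_. count_space UNIV) (\<lambda>i \<omega>. card (P \<omega> \<inter> C i)) I"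
    using U[THEN conjunct2, THEN conjunct2, THEN conjunct2] by simp
qed

lemma measurable_configurations:
  assumes "unit_poisson_process M E P" "A \<subseteq> E"
  shows "P \<in> measurable M (configurations A)"
  unfolding configurations_def
proof (rule measurable_measure_of)
  show "P \<in> space M \<rightarrow> {V. locally_finite V}" using unit_poisson_processD(3)[OF assms(1)] by auto
  fix y :: "'b set set"
  assume "y \<in> {{V. locally_finite V \<and> card (V \<inter> B) = k} | B k. B \<in> sets borel \<and> bounded B \<and> B \<subseteq> A}"
  then obtain B k where y: "y = {V. locally_finite V \<and> card (V \<inter> B) = k}"
    and B: "B \<in> sets borel" "bounded B" "B \<subseteq> E"
    using assms(2) by blast
  have "P -` y \<inter> space M = (\<lambda>\<omega>. card (P \<omega> \<inter> B)) -` {k} \<inter> space M"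
    using unit_poisson_processD(3)[OF assms(1)] by (auto simp: y)
  then show "P -` y \<inter> space M \<in> sets M"
    using measurable_sets[OF unit_poisson_processD(4)[OF assms(1) B], of "{k}"] by simp
qed blast

text \<open>Independence is available for disjoint sets only, so arbitrary sets are cut into the
  atoms they generate. The atoms are numbered because the Poisson axioms index by
  \<open>nat\<close>; \<open>n > 0\<close> keeps the index set of the product measures
  nonempty.\<close>

lemma finite_disjoint_refinement:
  fixes \<B> :: "'b::euclidean_space set set"
  assumes fin: "finite \<B>" and \<B>: "\<And>B. B \<in> \<B> \<Longrightarrow> B \<in> sets borel \<and> bounded B \<and> B \<subseteq> A"
  obtains n C f where "n > 0" "disjoint_family_on C {..<n::nat}"
    "\<And>i. i < n \<Longrightarrow> C i \<in> sets borel \<and> bounded (C i) \<and> C i \<subseteq> A"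
    "\<And>B. B \<in> \<B> \<Longrightarrow> f B \<subseteq> {..<n} \<and> B = (\<Union>i\<in>f B. C i)"
proof -
  \<comment> \<open>Points lying in exactly the members of \<open>J\<close>. The class of
    \<open>J = {}\<close> is the unbounded remainder and is replaced by the empty set.\<close>
  define atom where "atom J = (if J = {} then {} else \<Inter>J - \<Union>(\<B> - J))" for J :: "'b set set"
  obtain h where h: "bij_betw h {..<card (Pow \<B>)} (Pow \<B>)"
    using ex_bij_betw_nat_finite[of "Pow \<B>"] fin by (auto simp: atLeast0LessThan)
  let ?n = "card (Pow \<B>)"
  have hJ: "h i \<subseteq> \<B>" if "i < ?n" for i using h that by (auto simp: bij_betw_def)
  have atom_disj: "atom I \<inter> atom J = {}" if "I \<subseteq> \<B>" "J \<subseteq> \<B>" "I \<noteq> J" for I J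
    using that unfolding atom_def by auto
  show ?thesis
  proof (rule that[of ?n "\<lambda>i. atom (h i)" "\<lambda>B. {i. i < ?n \<and> B \<in> h i}"])
    show "?n > 0" using fin by (auto simp: card_gt_0_iff)
    show "disjoint_family_on (\<lambda>i. atom (h i)) {..<?n}"
      unfolding disjoint_family_on_def
    proof (intro ballI impI)
      fix i j assume ij: "i \<in> {..<?n}" "j \<in> {..<?n}" "i \<noteq> j"
      then have "h i \<noteq> h j" using h unfolding bij_betw_def inj_on_def by blast
      then show "atom (h i) \<inter> atom (h j) = {}" using ij by (intro atom_disj hJ) auto
    qed
    show "atom (h i) \<in> sets borel \<and> bounded (atom (h i)) \<and> atom (h i) \<subseteq> A" if "i < ?n" for i
    proof (cases "h i = {}")
      case False
      then obtain B where B: "B \<in> h i" by blast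
      have sub: "h i \<subseteq> \<B>" by (rule hJ[OF that])
      have "atom (h i) \<subseteq> B" using B by (auto simp: atom_def)
      moreover have "B \<in> \<B>" using B sub by blast
      moreover have "\<Inter>(h i) \<in> sets borel"
      proof -
        have "finite (h i)" using sub fin finite_subset by blast
        then show ?thesis using False sub \<B> sets.finite_INT[of "h i" "\<lambda>B. B" borel] by auto
      qed
      moreover have "\<Union>(\<B> - h i) \<in> sets borel"
        using fin \<B> by (intro sets.finite_Union) auto
      ultimately show ?thesis using \<B>[of B] False bounded_subset[of B "atom (h i)"]
        by (auto simp: atom_def)
    qed (simp add: atom_def)
    show "{i. i < ?n \<and> B \<in> h i} \<subseteq> {..<?n} \<and> B = (\<Union>i\<in>{i. i < ?n \<and> B \<in> h i}. atom (h i))"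
      if B: "B \<in> \<B>" for B
    proof (intro conjI subset_antisym subsetI)
      fix x assume x: "x \<in> B"
      have "{B' \<in> \<B>. x \<in> B'} \<in> Pow \<B>" by blast
      then obtain i where i: "i < ?n" "h i = {B' \<in> \<B>. x \<in> B'}"
        using h unfolding bij_betw_def by (metis (no_types, lifting) imageE lessThan_iff)
      then have "x \<in> atom (h i)" "B \<in> h i" using x B by (auto simp: atom_def)
      then show "x \<in> (\<Union>i\<in>{i. i < ?n \<and> B \<in> h i}. atom (h i))" using i by blast
    next
      fix x assume "x \<in> (\<Union>i\<in>{i. i < ?n \<and> B \<in> h i}. atom (h i))"
      then show "x \<in> B" by (auto simp: atom_def split: if_splits)
    qed auto
  qed
qed

lemma card_Int_UN_eq_sum:
  assumes "locally_finite V" "finite I" "disjoint_family_on C I" "\<And>i. i \<in> I \<Longrightarrow> bounded (C i)"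
  shows "card (V \<inter> (\<Union>i\<in>I. C i)) = (\<Sum>i\<in>I. card (V \<inter> C i))"
proof -
  have "card (\<Union>i\<in>I. V \<inter> C i) = (\<Sum>i\<in>I. card (V \<inter> C i))"
  proof (rule card_UN_disjoint[OF assms(2)])
    show "\<forall>i\<in>I. finite (V \<inter> C i)" using assms by (auto intro: finite_locally_finite_Int)
    show "\<forall>i\<in>I. \<forall>j\<in>I. i \<noteq> j \<longrightarrow> (V \<inter> C i) \<inter> (V \<inter> C j) = {}"
      using assms(3) unfolding disjoint_family_on_def by blast
  qed
  then show ?thesis by (simp only: Int_UN_distrib)
qed

text \<open>Counts of the original sets are sums of counts of atoms, so membership in
  \<open>X\<close> is a condition \<open>Q\<close> on the vector of atom counts. Leaving
  \<open>x\<close> arbitrary beyond \<open>n\<close> allows restricted as well as reindexed vectors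
  to be inserted.\<close>

lemma cylinder_disjoint_counts:
  assumes "X \<in> cylinders A"
  shows "\<exists>n C Q. n > 0 \<and> disjoint_family_on C {..<n::nat} \<and>
    (\<forall>i<n. C i \<in> sets borel \<and> bounded (C i) \<and> C i \<subseteq> A) \<and>
    (\<forall>V x. locally_finite V \<longrightarrow> (\<forall>i<n. x i = card (V \<inter> C i)) \<longrightarrow> (V \<in> X \<longleftrightarrow> Q x))"
proof -
  obtain K where K: "finite K" "\<forall>z\<in>K. fst z \<in> sets borel \<and> bounded (fst z) \<and> fst z \<subseteq> A"
    "X = {V. locally_finite V \<and> (\<forall>z\<in>K. card (V \<inter> fst z) = snd z)}"
    using cylindersD[OF assms] by (elim exE conjE) (rule that)
  have f: "finite (fst ` K)" using K(1) by (rule finite_imageI)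
  have b: "B \<in> sets borel \<and> bounded B \<and> B \<subseteq> A" if "B \<in> fst ` K" for B
    using K(2) that by blast
  obtain n C f where C: "n > 0" "disjoint_family_on C {..<n::nat}"
    "\<And>i. i < n \<Longrightarrow> C i \<in> sets borel \<and> bounded (C i) \<and> C i \<subseteq> A"
    "\<And>B. B \<in> fst ` K \<Longrightarrow> f B \<subseteq> {..<n} \<and> B = (\<Union>i\<in>f B. C i)"
    by (rule finite_disjoint_refinement[OF f b]) (assumption | rule that)+
  have "V \<in> X \<longleftrightarrow> (\<forall>z\<in>K. (\<Sum>i\<in>f (fst z). x i) = snd z)"
    if V: "locally_finite V" and x: "\<forall>i<n. x i = card (V \<inter> C i)" for V and x :: "nat \<Rightarrow> nat"
  proof -
    have "card (V \<inter> fst z) = (\<Sum>i\<in>f (fst z). x i)" if "z \<in> K" for z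
    proof -
      have B: "f (fst z) \<subseteq> {..<n}" "fst z = (\<Union>i\<in>f (fst z). C i)" using C(4)[of "fst z"] that by blast+
      have "card (V \<inter> (\<Union>i\<in>f (fst z). C i)) = (\<Sum>i\<in>f (fst z). card (V \<inter> C i))"
      proof (rule card_Int_UN_eq_sum[OF V])
        show "finite (f (fst z))" using B(1) finite_subset by blast
        show "disjoint_family_on C (f (fst z))" by (rule disjoint_family_on_mono[OF B(1) C(2)])
        show "bounded (C i)" if "i \<in> f (fst z)" for i using C(3) that B(1) by auto
      qed
      moreover have "(\<Sum>i\<in>f (fst z). card (V \<inter> C i)) = (\<Sum>i\<in>f (fst z). x i)"
        using B(1) x by (intro sum.cong refl) auto
      ultimately show ?thesis unfolding B(2)[symmetric] by simp
    qed
    then show ?thesis using V unfolding K(3) by simp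
  qed
  then show ?thesis using C(1-3)
    by (intro exI[of _ n] exI[of _ C] exI[of _ "\<lambda>x. \<forall>z\<in>K. (\<Sum>i\<in>f (fst z). x i) = snd z"]) simp
qed

lemma sets_PiM_count_space_nat:
  assumes "finite I"
  shows "sets (PiM I (\<lambda>_. count_space (UNIV :: nat set))) = Pow (PiE I (\<lambda>_. UNIV))"
proof -
  have "PiM I (\<lambda>_. count_space (UNIV :: nat set)) = count_space (PiE I (\<lambda>_. UNIV))"
    by (rule count_space_PiM_finite[OF assms]) simp
  then show ?thesis by simp
qed

text \<open>Both joint laws are products of the same Poisson marginals.\<close>

lemma poisson_counts_distr_eq:
  assumes U: "unit_poisson_process M E P" and U': "unit_poisson_process M' E P'"
    and C: "n > 0" "disjoint_family_on C {..<n::nat}"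
    "\<And>i. i < n \<Longrightarrow> C i \<in> sets borel \<and> bounded (C i) \<and> C i \<subseteq> E"
  shows "distr M (PiM {..<n} (\<lambda>_. count_space UNIV)) (\<lambda>\<omega>. \<lambda>i\<in>{..<n}. card (P \<omega> \<inter> C i)) =
    distr M' (PiM {..<n} (\<lambda>_. count_space UNIV)) (\<lambda>\<omega>. \<lambda>i\<in>{..<n}. card (P' \<omega> \<inter> C i))"
proof -
  have one: "distr M (PiM {..<n} (\<lambda>_. count_space UNIV)) (\<lambda>\<omega>. \<lambda>i\<in>{..<n}. card (P \<omega> \<inter> C i)) =
      PiM {..<n} (\<lambda>i. distr M (count_space UNIV) (\<lambda>\<omega>. card (P \<omega> \<inter> C i)))"
    if U: "unit_poisson_process M E P" for M :: "'z measure" and P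
  proof -
    interpret prob_space M by (rule unit_poisson_processD(1)[OF U])
    have "indep_vars (\<lambda>_. count_space UNIV) (\<lambda>i \<omega>. card (P \<omega> \<inter> C i)) {..<n}"
      using C by (intro unit_poisson_processD(6)[OF U]) auto
    then show ?thesis
      using C by (subst indep_vars_iff_distr_eq_PiM'[symmetric]) (auto intro: unit_poisson_processD(4)[OF U])
  qed
  have "distr M (count_space UNIV) (\<lambda>\<omega>. card (P \<omega> \<inter> C i)) =
      distr M' (count_space UNIV) (\<lambda>\<omega>. card (P' \<omega> \<inter> C i))" if "i < n" for i
  proof -
    have *: "emeasure (distr M (count_space UNIV) (\<lambda>\<omega>. card (P \<omega> \<inter> C i))) {k} =
        ennreal (exp (- measure lborel (C i)) * measure lborel (C i) ^ k / fact k)"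
      if U: "unit_poisson_process M E P" for M :: "'z measure" and P k
    proof -
      interpret prob_space M by (rule unit_poisson_processD(1)[OF U])
      have m: "(\<lambda>\<omega>. card (P \<omega> \<inter> C i)) \<in> measurable M (count_space UNIV)"
        using C(3)[rule_format, OF \<open>i < n\<close>] by (intro unit_poisson_processD(4)[OF U]) auto
      have "(\<lambda>\<omega>. card (P \<omega> \<inter> C i)) -` {k} \<inter> space M = {\<omega> \<in> space M. card (P \<omega> \<inter> C i) = k}" by auto
      then show ?thesis
        using m C(3)[rule_format, OF \<open>i < n\<close>]
        by (simp add: emeasure_distr emeasure_eq_measure unit_poisson_processD(5)[OF U])
    qed
    show ?thesis
      by (rule measure_eqI_countable[of _ UNIV]) (simp_all add: *[OF U] *[OF U'])
  qed
  then show ?thesis unfolding one[OF U] one[OF U'] by (intro PiM_cong) auto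
qed

text \<open>The axioms fix the probabilities of all cylinders, hence the law. It will be applied to
  a process and its translate on the same sample space.\<close>

lemma distr_poisson_eq:
  assumes U: "unit_poisson_process M E P" and U': "unit_poisson_process M' E P'" and A: "A \<subseteq> E"
  shows "distr M (configurations A) P = distr M' (configurations A) P'"
proof (rule measure_eqI_generator_eq[OF Int_stable_cylinders])
  show "cylinders A \<subseteq> Pow {V. locally_finite V}" unfolding cylinders_def by blast
  show "sets (distr M (configurations A) P) = sigma_sets {V. locally_finite V} (cylinders A)"
    "sets (distr M' (configurations A) P') = sigma_sets {V. locally_finite V} (cylinders A)"
    by (simp_all add: sets_configurations_cylinders)
  have "{V. locally_finite V} \<in> cylinders A"
    unfolding cylinders_def by (rule CollectI, rule exI[of _ "{}"]) simp
  then show "range (\<lambda>_::nat. {V. locally_finite V}) \<subseteq> cylinders A" by blast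
  show "(\<Union>i::nat. {V. locally_finite V}) = {V. locally_finite V}" by simp
  interpret D: prob_space "distr M (configurations A) P"
    by (rule prob_space.prob_space_distr[OF unit_poisson_processD(1)[OF U] measurable_configurations[OF U A]])
  show "emeasure (distr M (configurations A) P) {V. locally_finite V} \<noteq> \<infinity>" by simp
next
  fix X assume X: "X \<in> cylinders A"
  obtain n C Q where C: "n > 0" "disjoint_family_on C {..<n::nat}"
    "\<forall>i<n. C i \<in> sets borel \<and> bounded (C i) \<and> C i \<subseteq> A"
    and Q: "\<forall>V x. locally_finite V \<longrightarrow> (\<forall>i<n. x i = card (V \<inter> C i)) \<longrightarrow> (V \<in> X \<longleftrightarrow> Q x)"
    using cylinder_disjoint_counts[OF X] by (elim exE conjE) (rule that)
  have CE: "C i \<in> sets borel \<and> bounded (C i) \<and> C i \<subseteq> E" if "i < n" for i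
    using C(3)[rule_format, OF that] A by blast
  let ?N = "PiM {..<n} (\<lambda>_. count_space (UNIV :: nat set))"
  let ?Y = "{x \<in> PiE {..<n} (\<lambda>_. UNIV). Q x}"
  have Y: "?Y \<in> sets ?N" by (subst sets_PiM_count_space_nat) auto
  have Xs: "X \<in> sets (configurations A)" unfolding sets_configurations_cylinders by (rule sigma_sets.Basic[OF X])
  have *: "emeasure (distr M (configurations A) P) X =
      emeasure (distr M ?N (\<lambda>\<omega>. \<lambda>i\<in>{..<n}. card (P \<omega> \<inter> C i))) ?Y"
    if U: "unit_poisson_process M E P" for M :: "'z measure" and P
  proof -
    have m: "(\<lambda>\<omega>. \<lambda>i\<in>{..<n}. card (P \<omega> \<inter> C i)) \<in> measurable M ?N"
      using CE by (intro measurable_restrict unit_poisson_processD(4)[OF U]) auto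
    have "P -` X \<inter> space M = (\<lambda>\<omega>. \<lambda>i\<in>{..<n}. card (P \<omega> \<inter> C i)) -` ?Y \<inter> space M"
    proof -
      have "P \<omega> \<in> X \<longleftrightarrow> Q (\<lambda>i\<in>{..<n}. card (P \<omega> \<inter> C i))" if "\<omega> \<in> space M" for \<omega>
        by (rule Q[rule_format, OF unit_poisson_processD(3)[OF U that]]) simp
      then show ?thesis by auto
    qed
    then show ?thesis
      by (simp add: emeasure_distr[OF m Y] emeasure_distr[OF measurable_configurations[OF U A] Xs])
  qed
  show "emeasure (distr M (configurations A) P) X = emeasure (distr M' (configurations A) P') X"
    unfolding *[OF U] *[OF U']
    by (rule arg_cong[OF poisson_counts_distr_eq[OF U U' C(1,2) CE], of "\<lambda>D. emeasure D ?Y"])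
qed

text \<open>The atoms of a cylinder over \<open>A\<close> and those of a cylinder over
  \<open>A'\<close> form one disjoint family, so the two cylinders are functions of disjoint blocks
  of independent counts.\<close>

lemma indep_var_poisson:
  assumes U: "unit_poisson_process M E P" and A: "A \<subseteq> E" "A' \<subseteq> E" "A \<inter> A' = {}"
  shows "prob_space.indep_var M (configurations A) P (configurations A') P"
proof -
  interpret prob_space M by (rule unit_poisson_processD(1)[OF U])
  let ?G = "\<lambda>A. {P -` X \<inter> space M | X. X \<in> cylinders A}"
  have cyl: "X \<in> sets (configurations A)" if "X \<in> cylinders A" for X A
    unfolding sets_configurations_cylinders by (rule sigma_sets.Basic[OF that])
  have stable: "Int_stable (?G A)" for A
  proof (rule Int_stableI)
    fix a b assume "a \<in> ?G A" "b \<in> ?G A"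
    then obtain X Y where XY: "a = P -` X \<inter> space M" "X \<in> cylinders A" "b = P -` Y \<inter> space M" "Y \<in> cylinders A" by blast
    then have "a \<inter> b = P -` (X \<inter> Y) \<inter> space M" by blast
    moreover have "X \<inter> Y \<in> cylinders A" using Int_stable_cylinders XY unfolding Int_stable_def by blast
    ultimately show "a \<inter> b \<in> ?G A" by blast
  qed
  have ev: "?G A \<subseteq> events" if "A \<subseteq> E" for A
    using measurable_sets[OF measurable_configurations[OF U that] cyl] by blast
  have "indep_set (?G A) (?G A')"
  proof (rule indep_setI[OF ev[OF A(1)] ev[OF A(2)]])
    fix a b assume "a \<in> ?G A" "b \<in> ?G A'"
    then obtain X Y where a: "a = P -` X \<inter> space M" and X: "X \<in> cylinders A"
      and b: "b = P -` Y \<inter> space M" and Y: "Y \<in> cylinders A'" by blast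
    obtain n C Q where C: "n > 0" "disjoint_family_on C {..<n::nat}"
      "\<forall>i<n. C i \<in> sets borel \<and> bounded (C i) \<and> C i \<subseteq> A"
      and Q: "\<forall>V x. locally_finite V \<longrightarrow> (\<forall>i<n. x i = card (V \<inter> C i)) \<longrightarrow> (V \<in> X \<longleftrightarrow> Q x)"
      using cylinder_disjoint_counts[OF X] by (elim exE conjE) (rule that)
    obtain n' C' Q' where C': "n' > 0" "disjoint_family_on C' {..<n'::nat}"
      "\<forall>i<n'. C' i \<in> sets borel \<and> bounded (C' i) \<and> C' i \<subseteq> A'"
      and Q': "\<forall>V x. locally_finite V \<longrightarrow> (\<forall>i<n'. x i = card (V \<inter> C' i)) \<longrightarrow> (V \<in> Y \<longleftrightarrow> Q' x)"
      using cylinder_disjoint_counts[OF Y] by (elim exE conjE) (rule that)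
    \<comment> \<open>Both families of atoms in one sequence, the second shifted by
      \<open>n\<close>, so that the independence axiom applies to all of them at once.\<close>
    define D where "D i = (if i < n then C i else C' (i - n))" for i
    have D: "D i \<in> sets borel \<and> bounded (D i) \<and> D i \<subseteq> E" if "i < n + n'" for i
    proof (cases "i < n")
      case True
      then show ?thesis using C(3)[rule_format, of i] A(1) unfolding D_def by auto
    next
      case False
      then have "i - n < n'" using that by simp
      from C'(3)[rule_format, OF this] show ?thesis using False A(2) unfolding D_def by auto
    qed
    have disj: "disjoint_family_on D {..<n + n'}"
      unfolding disjoint_family_on_def
    proof (intro ballI impI)
      fix i j assume ij: "i \<in> {..<n + n'}" "j \<in> {..<n + n'}" "i \<noteq> j"
      have 1: "C i \<inter> C j = {}" if "i < n" "j < n" using C(2) ij that by (auto simp: disjoint_family_on_def)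
      have 2: "C i \<inter> C' (j - n) = {}" if "i < n" "\<not> j < n"
      proof -
        have "j - n < n'" using ij that by simp
        from C'(3)[rule_format, OF this] C(3)[rule_format, OF that(1)] A(3) show ?thesis by blast
      qed
      have 3: "C' (i - n) \<inter> C j = {}" if "\<not> i < n" "j < n"
      proof -
        have "i - n < n'" using ij that by simp
        from C'(3)[rule_format, OF this] C(3)[rule_format, OF that(2)] A(3) show ?thesis by blast
      qed
      have 4: "C' (i - n) \<inter> C' (j - n) = {}" if "\<not> i < n" "\<not> j < n"
        using C'(2) ij that by (auto simp: disjoint_family_on_def)
      show "D i \<inter> D j = {}" unfolding D_def using 1 2 3 4 by simp
    qed
    have iv: "indep_vars (\<lambda>_. count_space UNIV) (\<lambda>i \<omega>. card (P \<omega> \<inter> D i)) {..<n + n'}"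
      using D disj by (intro unit_poisson_processD(6)[OF U]) auto
    have ind: "indep_var (PiM {..<n} (\<lambda>_. count_space UNIV)) (\<lambda>\<omega>. \<lambda>i\<in>{..<n}. card (P \<omega> \<inter> D i))
        (PiM {n..<n + n'} (\<lambda>_. count_space UNIV)) (\<lambda>\<omega>. \<lambda>i\<in>{n..<n + n'}. card (P \<omega> \<inter> D i))"
      by (rule indep_var_restrict[OF iv]) auto
    let ?x = "\<lambda>\<omega>. \<lambda>i\<in>{..<n}. card (P \<omega> \<inter> D i)" and ?y = "\<lambda>\<omega>. \<lambda>i\<in>{n..<n + n'}. card (P \<omega> \<inter> D i)"
    let ?X = "{x \<in> PiE {..<n} (\<lambda>_. UNIV). Q x}"
    let ?Y = "{y \<in> PiE {n..<n + n'} (\<lambda>_. UNIV). Q' (\<lambda>i. y (n + i))}"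
    have s: "?X \<in> sets (PiM {..<n} (\<lambda>_. count_space UNIV))"
      "?Y \<in> sets (PiM {n..<n + n'} (\<lambda>_. count_space UNIV))"
      by (subst sets_PiM_count_space_nat; auto)+
    have "P \<omega> \<in> X \<longleftrightarrow> Q (?x \<omega>)" if "\<omega> \<in> space M" for \<omega>
      by (rule Q[rule_format, OF unit_poisson_processD(3)[OF U that]]) (simp add: D_def)
    then have a': "a = ?x -` ?X \<inter> space M" unfolding a by auto
    have "P \<omega> \<in> Y \<longleftrightarrow> Q' (\<lambda>i. ?y \<omega> (n + i))" if "\<omega> \<in> space M" for \<omega>
      by (rule Q'[rule_format, OF unit_poisson_processD(3)[OF U that]]) (simp add: D_def)
    then have b': "b = ?y -` ?Y \<inter> space M" unfolding b by auto
    have "a \<inter> b = (\<lambda>\<omega>. (?x \<omega>, ?y \<omega>)) -` (?X \<times> ?Y) \<inter> space M" unfolding a' b' by auto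
    then show "prob (a \<inter> b) = prob a * prob b"
      using indep_varD[OF ind s] unfolding a' b' by simp
  qed
  from indep_set_sigma_sets[OF this stable stable]
  have "indep_set (sigma_sets (space M) (?G A)) (sigma_sets (space M) (?G A'))" .
  moreover have "sigma_sets (space M) {P -` X \<inter> space M | X. X \<in> sets (configurations A)} =
      sigma_sets (space M) (?G A)" if "A \<subseteq> E" for A
  proof -
    have "P \<in> space M \<rightarrow> {V. locally_finite V}" using unit_poisson_processD(3)[OF U] by auto
    from sigma_sets_vimage_commute[OF this, of "cylinders A"]
    have "{P -` X \<inter> space M | X. X \<in> sets (configurations A)} = sigma_sets (space M) (?G A)"
      unfolding sets_configurations_cylinders .
    moreover have "?G A \<subseteq> Pow (space M)" by blast
    ultimately show ?thesis using sigma_sets_sigma_sets_eq by simp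
  qed
  ultimately show ?thesis
    unfolding indep_var_eq using A measurable_configurations[OF U] by simp
qed

section \<open>Translates of Poisson processes\<close>

lemma plus_vimage_eq: "(+) w -` B = (+) (- w) ` B" for w :: "'b::real_vector"
  by (force simp: image_iff)

lemma unit_poisson_process_translate:
  fixes w :: "'b::euclidean_space"
  assumes U: "unit_poisson_process M E P" and E: "(+) w ` E = E"
  shows "unit_poisson_process M E (\<lambda>\<omega>. (+) w ` P \<omega>)"
proof -
  have borel: "(+) w -` B \<in> sets borel" if "B \<in> sets borel" for B
    using measurable_sets[of "(+) w" borel borel B] that by simp
  have bdd: "bounded ((+) w -` B)" if "bounded B" for B
    unfolding plus_vimage_eq using that by (rule bounded_translation)
  have sub: "(+) w -` B \<subseteq> E" if "B \<subseteq> E" for B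
  proof
    fix x assume "x \<in> (+) w -` B"
    then have "w + x \<in> (+) w ` E" using that E by auto
    then show "x \<in> E" by auto
  qed
  have meas: "measure lborel ((+) w -` B) = measure lborel B" if "B \<in> sets borel" for B
  proof -
    have "measure lborel B = measure (distr lborel borel ((+) w)) B" by (simp add: lborel_distr_plus)
    also have "\<dots> = measure lborel ((+) w -` B)" using that by (subst measure_distr) auto
    finally show ?thesis ..
  qed
  have card: "card ((+) w ` V \<inter> B) = card (V \<inter> (+) w -` B)" for V B
  proof -
    have "(+) w ` V \<inter> B = (+) w ` (V \<inter> (+) w -` B)" by blast
    then show ?thesis by (simp add: card_image)
  qed
  have lf: "locally_finite ((+) w ` V)" if "locally_finite V" for V
    unfolding locally_finite_def
  proof (intro allI impI)
    fix K :: "'b set" assume "bounded K"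
    then have "finite (V \<inter> (+) w -` K)" using that bdd by (intro finite_locally_finite_Int)
    moreover have "(+) w ` V \<inter> K = (+) w ` (V \<inter> (+) w -` K)" by blast
    ultimately show "finite ((+) w ` V \<inter> K)" by simp
  qed
  show ?thesis
    unfolding unit_poisson_process_def card
  proof (intro conjI ballI allI impI)
    show "prob_space M" by (rule unit_poisson_processD(1)[OF U])
    show "(+) w ` P \<omega> \<subseteq> E" if "\<omega> \<in> space M" for \<omega>
      using image_mono[OF unit_poisson_processD(2)[OF U that], of "(+) w"] E by simp
    show "locally_finite ((+) w ` P \<omega>)" if "\<omega> \<in> space M" for \<omega>
      by (rule lf[OF unit_poisson_processD(3)[OF U that]])
  next
    fix B :: "'b set" assume B: "B \<in> sets borel" "bounded B" "B \<subseteq> E"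
    show "(\<lambda>\<omega>. card (P \<omega> \<inter> (+) w -` B)) \<in> measurable M (count_space UNIV)"
      by (intro unit_poisson_processD(4)[OF U] borel bdd sub B)
    show "measure M {\<omega> \<in> space M. card (P \<omega> \<inter> (+) w -` B) = k} =
        exp (- measure lborel B) * measure lborel B ^ k / fact k" for k
      using unit_poisson_processD(5)[OF U borel[OF B(1)] bdd[OF B(2)] sub[OF B(3)]] meas[OF B(1)] by simp
  next
    fix I :: "nat set" and B assume I: "finite I" "disjoint_family_on B I"
      "\<forall>i\<in>I. B i \<in> sets borel \<and> bounded (B i) \<and> B i \<subseteq> E"
    show "prob_space.indep_vars M (\<lambda>_. count_space UNIV) (\<lambda>i \<omega>. card (P \<omega> \<inter> (+) w -` B i)) I"
    proof (rule unit_poisson_processD(6)[OF U I(1)])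
      show "disjoint_family_on (\<lambda>i. (+) w -` B i) I"
        using I(2) unfolding disjoint_family_on_def by blast
    qed (use I(3) borel bdd sub in blast)
  qed
qed

section \<open>Absence of percolation in thin time slabs\<close>

text \<open>Half-open, so that lattice translates tile the space and are admissible in the
  superadditivity of \<open>T\<close>.\<close>

definition cube :: "real ^ 'n \<Rightarrow> real \<Rightarrow> (real ^ 'n) set" where
  "cube a s = {x. \<forall>i. a $ i \<le> x $ i \<and> x $ i < a $ i + s}"

definition lattice_point :: "real \<Rightarrow> ('n \<Rightarrow> int) \<Rightarrow> real ^ 'n" where
  "lattice_point r z = (\<chi> i. r * of_int (z i))"

definition cell :: "real \<Rightarrow> ('n \<Rightarrow> int) \<Rightarrow> (real ^ 'n) set" where
  "cell r z = cube (lattice_point r z) r"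

definition cell_index :: "real \<Rightarrow> real ^ 'n \<Rightarrow> 'n \<Rightarrow> int" where
  "cell_index r x = (\<lambda>i. \<lfloor>x $ i / r\<rfloor>)"

lemma cube_subset_cbox: "cube a s \<subseteq> cbox a (a + (\<chi> i. s))"
  by (auto simp: cube_def mem_box_cart less_imp_le)

lemma box_subset_cube: "box a (a + (\<chi> i. s)) \<subseteq> cube a s"
  by (auto simp: cube_def mem_box_cart less_imp_le)

lemma cube_borel [measurable, simp]: "cube a s \<in> sets borel"
proof -
  have "Measurable.pred borel (\<lambda>x. \<forall>i. a $ i \<le> x $ i \<and> x $ i < a $ i + s)" by measurable
  then show ?thesis by (simp add: cube_def pred_def)
qed

lemma bounded_cube [simp]: "bounded (cube a s)"
  using cube_subset_cbox bounded_cbox bounded_subset by blast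

lemma measure_cube:
  fixes a :: "real ^ 'n"
  assumes "s \<ge> 0" shows "measure lborel (cube a s) = s ^ CARD('n)"
proof -
  let ?b = "a + (\<chi> i. s)"
  have ne: "cbox a ?b \<noteq> {}" using assms by (auto simp: interval_ne_empty_cart)
  then have cb: "measure lborel (cbox a ?b) = s ^ CARD('n)"
    by (subst content_cbox_cart) auto
  have "emeasure lborel (box a ?b) = emeasure lborel (cbox a ?b)"
    by (simp add: emeasure_lborel_box_eq emeasure_lborel_cbox_eq)
  then have bx: "measure lborel (box a ?b) = s ^ CARD('n)" using cb by (simp add: measure_def)
  have "measure lborel (cube a s) \<le> measure lborel (cbox a ?b)"
    by (intro measure_mono_fmeasurable cube_subset_cbox) auto
  moreover have "measure lborel (box a ?b) \<le> measure lborel (cube a s)"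
  proof (intro measure_mono_fmeasurable box_subset_cube)
    show "cube a s \<in> fmeasurable lborel"
      by (rule fmeasurableI2[OF fmeasurable_cbox cube_subset_cbox]) simp
  qed auto
  ultimately show ?thesis using cb bx by simp
qed

lemma mem_cell_iff:
  assumes "r > 0" shows "x \<in> cell r z \<longleftrightarrow> z = cell_index r x"
proof -
  have "x \<in> cell r z \<longleftrightarrow> (\<forall>i. r * of_int (z i) \<le> x $ i \<and> x $ i < r * of_int (z i) + r)"
    by (simp add: cell_def cube_def lattice_point_def)
  also have "\<dots> \<longleftrightarrow> (\<forall>i. \<lfloor>x $ i / r\<rfloor> = z i)"
    using assms by (simp add: floor_eq_iff field_simps)
  finally show ?thesis by (auto simp: cell_index_def fun_eq_iff)
qed

lemma cell_borel [measurable, simp]: "cell r z \<in> sets borel"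
  and bounded_cell [simp]: "bounded (cell r z)"
  by (simp_all add: cell_def)

text \<open>Since \<open>fact (k + m) \<ge> fact k\<close>, the tail is at most \<open>v ^ m\<close>
  times a full Poisson series, which sums to one.\<close>

lemma poisson_tail:
  assumes U: "unit_poisson_process M E P" and B: "B \<in> sets borel" "bounded B" "B \<subseteq> E"
  shows "measure M {\<omega> \<in> space M. m \<le> card (P \<omega> \<inter> B)} \<le> measure lborel B ^ m"
proof -
  interpret prob_space M by (rule unit_poisson_processD(1)[OF U])
  have [measurable]: "(\<lambda>\<omega>. card (P \<omega> \<inter> B)) \<in> measurable M (count_space UNIV)"
    by (rule unit_poisson_processD(4)[OF U B])
  let ?v = "measure lborel B"
  let ?A = "\<lambda>k. {\<omega> \<in> space M. card (P \<omega> \<inter> B) = k + m}"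
  have "{\<omega> \<in> space M. m \<le> card (P \<omega> \<inter> B)} = (\<Union>k. ?A k)"
    by (auto simp: le_iff_add add.commute)
  moreover have "(\<lambda>k. prob (?A k)) sums prob (\<Union>k. ?A k)"
    by (intro finite_measure_UNION) (auto simp: disjoint_family_on_def)
  ultimately have s: "(\<lambda>k. prob (?A k)) sums prob {\<omega> \<in> space M. m \<le> card (P \<omega> \<inter> B)}" by simp
  have "(\<lambda>k. ?v ^ k / fact k) sums exp ?v"
    using exp_converges[of ?v] by (simp add: field_simps scaleR_conv_of_real)
  from sums_mult[OF this, of "exp (- ?v) * ?v ^ m"]
  have e: "(\<lambda>k. exp (- ?v) * ?v ^ m * (?v ^ k / fact k)) sums (?v ^ m)"
    by (simp add: exp_minus field_simps)
  have "prob (?A k) \<le> exp (- ?v) * ?v ^ m * (?v ^ k / fact k)" for k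
  proof -
    have f: "(fact k :: real) \<le> fact (k + m)" by (simp add: fact_mono)
    have "prob (?A k) = exp (- ?v) * ?v ^ m * (?v ^ k / fact (k + m))"
      by (simp add: unit_poisson_processD(5)[OF U B] power_add field_simps)
    also have "\<dots> \<le> exp (- ?v) * ?v ^ m * (?v ^ k / fact k)"
      using f by (intro mult_left_mono divide_left_mono) (auto simp: measure_nonneg)
    finally show ?thesis .
  qed
  from sums_le[OF this s e] show ?thesis .
qed

text \<open>Distinct boxes are independent, each with multiplicity \<open>j\<close> costs at most
  \<open>v ^ j\<close>, and the multiplicities add up to the length of the list.\<close>

lemma poisson_multiplicities:
  fixes box :: "'z \<Rightarrow> 'b::euclidean_space set"
  assumes U: "unit_poisson_process M E P"
    and B: "\<And>z. box z \<in> sets borel" "\<And>z. bounded (box z)" "\<And>z. box z \<subseteq> E"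
    and disj: "\<And>z z'. z \<noteq> z' \<Longrightarrow> box z \<inter> box z' = {}"
    and v: "\<And>z. measure lborel (box z) = v"
  shows "{\<omega> \<in> space M. \<forall>z\<in>set zs. count_list zs z \<le> card (P \<omega> \<inter> box z)} \<in> sets M"
    and "measure M {\<omega> \<in> space M. \<forall>z\<in>set zs. count_list zs z \<le> card (P \<omega> \<inter> box z)} \<le> v ^ length zs"
proof -
  interpret prob_space M by (rule unit_poisson_processD(1)[OF U])
  have [measurable]: "(\<lambda>\<omega>. card (P \<omega> \<inter> box z)) \<in> measurable M (count_space UNIV)" for z
    by (intro unit_poisson_processD(4)[OF U] B)
  show "{\<omega> \<in> space M. \<forall>z\<in>set zs. count_list zs z \<le> card (P \<omega> \<inter> box z)} \<in> sets M"
    by measurable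
  have v0: "v \<ge> 0" using v[of undefined] measure_nonneg[of lborel "box undefined"] by simp
  define ys where "ys = remdups zs"
  let ?I = "{..<length ys}"
  let ?N = "\<lambda>i \<omega>. card (P \<omega> \<inter> box (ys ! i))"
  let ?C = "\<lambda>i. {count_list zs (ys ! i)..}"
  show "measure M {\<omega> \<in> space M. \<forall>z\<in>set zs. count_list zs z \<le> card (P \<omega> \<inter> box z)} \<le> v ^ length zs"
  proof (cases "zs = []")
    case False
    then have ne: "?I \<noteq> {}" by (simp add: ys_def lessThan_empty_iff)
    have ys: "set ys = set zs" "distinct ys" by (auto simp: ys_def)
    have "indep_vars (\<lambda>_. count_space UNIV) ?N ?I"
    proof (rule unit_poisson_processD(6)[OF U])
      show "disjoint_family_on (\<lambda>i. box (ys ! i)) ?I"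
        unfolding disjoint_family_on_def using ys by (auto intro!: disj simp: nth_eq_iff_index_eq)
    qed (use B in auto)
    from indep_varsD_finite[OF this ne, of ?C]
    have "prob (\<Inter>i\<in>?I. ?N i -` ?C i \<inter> space M) = (\<Prod>i\<in>?I. prob (?N i -` ?C i \<inter> space M))"
      by simp
    moreover have "(\<Inter>i\<in>?I. ?N i -` ?C i \<inter> space M) =
        {\<omega> \<in> space M. \<forall>z\<in>set zs. count_list zs z \<le> card (P \<omega> \<inter> box z)}"
      using ne unfolding ys(1)[symmetric] by (auto simp: in_set_conv_nth) fastforce+
    moreover have "?N i -` ?C i \<inter> space M =
        {\<omega> \<in> space M. count_list zs (ys ! i) \<le> card (P \<omega> \<inter> box (ys ! i))}" for i by auto
    ultimately have "prob {\<omega> \<in> space M. \<forall>z\<in>set zs. count_list zs z \<le> card (P \<omega> \<inter> box z)} =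
        (\<Prod>i\<in>?I. prob {\<omega> \<in> space M. count_list zs (ys ! i) \<le> card (P \<omega> \<inter> box (ys ! i))})"
      by simp
    also have "\<dots> \<le> (\<Prod>i\<in>?I. v ^ count_list zs (ys ! i))"
      using poisson_tail[OF U B(1) B(2) B(3)] v by (intro prod_mono) auto
    also have "\<dots> = (\<Prod>z\<in>set zs. v ^ count_list zs z)"
    proof -
      have "bij_betw ((!) ys) ?I (set ys)" by (rule bij_betw_nth[OF ys(2)]) auto
      from prod.reindex_bij_betw[OF this] show ?thesis unfolding ys(1) .
    qed
    also have "\<dots> = v ^ (\<Sum>z\<in>set zs. count_list zs z)" by (simp add: power_sum)
    also have "(\<Sum>z\<in>set zs. count_list zs z) = length zs" by (simp add: sum_count_set)
    finally show ?thesis .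
  qed (simp add: prob_space)
qed

section \<open>Lattice paths and chains in a time slab\<close>

primrec paths :: "('n \<Rightarrow> int) set \<Rightarrow> nat \<Rightarrow> ('n \<Rightarrow> int) \<Rightarrow> ('n \<Rightarrow> int) list set" where
  "paths D 0 z = {[z]}"
| "paths D (Suc n) z = (\<Union>e\<in>D. (#) z ` paths D n (\<lambda>i. z i + e i))"

lemma finite_card_paths:
  assumes "finite D"
  shows "finite (paths D n z) \<and> card (paths D n z) \<le> card D ^ n"
proof (induction n arbitrary: z)
  case (Suc n)
  have "card (paths D (Suc n) z) \<le> (\<Sum>e\<in>D. card ((#) z ` paths D n (\<lambda>i. z i + e i)))"
    unfolding paths.simps using assms by (rule card_UN_le)
  also have "\<dots> \<le> (\<Sum>e\<in>D. card D ^ n)"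
    using Suc card_image_le order_trans by (intro sum_mono) blast
  finally show ?case using Suc assms by simp
qed simp

lemma length_paths: "zs \<in> paths D n z \<Longrightarrow> length zs = Suc n"
  by (induction n arbitrary: z zs) auto

lemma map_in_paths:
  assumes "\<And>i. i < n \<Longrightarrow> (\<lambda>j. f (Suc i) j - f i j) \<in> D"
  shows "map f [0..<Suc n] \<in> paths D n (f 0)"
  using assms
proof (induction n arbitrary: f)
  case (Suc n)
  have "map (\<lambda>i. f (Suc i)) [0..<Suc n] \<in> paths D n (f (Suc 0))"
    using Suc.prems by (intro Suc.IH) auto
  then have "f 0 # map (\<lambda>i. f (Suc i)) [0..<Suc n] \<in> (#) (f 0) ` paths D n (f (Suc 0))"
    by (rule imageI)
  moreover have "map f [0..<Suc (Suc n)] = f 0 # map (\<lambda>i. f (Suc i)) [0..<Suc n]"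
    by (simp add: map_upt_Suc del: upt_Suc)
  moreover have "f (Suc 0) = (\<lambda>j. f 0 j + (f (Suc 0) j - f 0 j))" by simp
  ultimately have "map f [0..<Suc (Suc n)] \<in> (#) (f 0) ` paths D n (\<lambda>j. f 0 j + (f (Suc 0) j - f 0 j))"
    by (simp del: upt_Suc)
  moreover have "(\<lambda>j. f (Suc 0) j - f 0 j) \<in> D" using Suc.prems[of 0] by simp
  ultimately show ?case unfolding paths.simps by (intro UN_I)
qed simp

definition slab_box :: "real \<Rightarrow> real \<Rightarrow> nat \<Rightarrow> ('n \<Rightarrow> int) \<Rightarrow> ((real ^ 'n) \<times> real) set" where
  "slab_box r \<delta> k z = cell r z \<times> {real k * \<delta>..<real (Suc k) * \<delta>}"

lemma measure_slab_box:
  fixes z :: "'n::finite \<Rightarrow> int"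
  assumes "r > 0" "\<delta> > 0"
  shows "measure lborel (slab_box r \<delta> k z) = r ^ CARD('n) * \<delta>"
proof -
  have e: "emeasure lborel (cell r z) = ennreal (r ^ CARD('n))"
  proof -
    have "emeasure lborel (cell r z) \<noteq> \<infinity>"
      using emeasure_bounded_finite[OF bounded_cell[of r z]] by simp
    then show ?thesis using measure_cube[of r "lattice_point r z"] assms
      by (simp add: cell_def emeasure_eq_ennreal_measure)
  qed
  have "real k * \<delta> \<le> real (Suc k) * \<delta>" using assms by (intro mult_right_mono) auto
  then have i: "emeasure lborel {real k * \<delta>..<real (Suc k) * \<delta>} = ennreal \<delta>"
    using assms by (simp add: algebra_simps)
  have "emeasure lborel (slab_box r \<delta> k z) =
      emeasure (lborel \<Otimes>\<^sub>M lborel) (cell r z \<times> {real k * \<delta>..<real (Suc k) * \<delta>})"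
    by (simp add: slab_box_def lborel_prod)
  also have "\<dots> = emeasure lborel (cell r z) * emeasure lborel {real k * \<delta>..<real (Suc k) * \<delta>}"
    by (rule lborel.emeasure_pair_measure_Times) auto
  also have "\<dots> = ennreal (r ^ CARD('n) * \<delta>)"
    unfolding e i using assms by (simp add: ennreal_mult)
  finally show ?thesis using assms by (simp add: measure_def)
qed

text \<open>An infinite chain of ancestors confined to one time slab, weakened to distinct points
  with consecutive distances below \<open>r\<close>; their order in time is forgotten.\<close>

definition slab_chain :: "real \<Rightarrow> real \<Rightarrow> nat \<Rightarrow> ((real ^ 'n) \<times> real) set \<Rightarrow> (nat \<Rightarrow> (real ^ 'n) \<times> real) \<Rightarrow> bool" where
  "slab_chain r \<delta> k V x \<longleftrightarrow> inj x \<and> (\<forall>i. x i \<in> V \<and> snd (x i) \<in> {real k * \<delta>..<real (Suc k) * \<delta>} \<and>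
     dist (fst (x i)) (fst (x (Suc i))) < r)"

lemma floor_diff_bound:
  assumes "\<bar>a - b\<bar> < (1::real)" shows "\<lfloor>a\<rfloor> - \<lfloor>b\<rfloor> \<in> {-1..1}"
  using assms by (auto simp: abs_less_iff) linarith+

text \<open>First moment bound: a chain follows one of at most \<open>3 ^ (d * n)\<close> lattice paths of boxes, each of which
  carries its points with probability at most the \<open>n\<close>-th power of the volume of a box. Repeated
  boxes need several points, whence the multiplicities.\<close>

lemma AE_no_slab_chain_from:
  fixes P :: "'w \<Rightarrow> ((real ^ 'n::finite) \<times> real) set"
  assumes U: "unit_poisson_process M (UNIV \<times> {0..}) P" and r: "r > 0" and \<delta>: "\<delta> > 0"
    and small: "3 ^ CARD('n) * (r ^ CARD('n) * \<delta>) \<le> 1 / 2"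
  shows "AE \<omega> in M. \<forall>x. slab_chain r \<delta> k (P \<omega>) x \<longrightarrow> cell_index r (fst (x 0)) \<noteq> z"
proof -
  interpret prob_space M by (rule unit_poisson_processD(1)[OF U])
  let ?box = "slab_box r \<delta> k"
  let ?v = "r ^ CARD('n) * \<delta>"
  \<comment> \<open>Consecutive points are closer than the cell side, so the cell index changes by
    at most one in each coordinate.\<close>
  define D where "D = PiE (UNIV :: 'n set) (\<lambda>_. {-1..1::int})"
  have D: "finite D" "card D = 3 ^ CARD('n)" by (auto simp: D_def card_PiE intro: finite_PiE)
  have v0: "?v > 0" using r \<delta> by simp
  have B: "?box z \<in> sets borel" "bounded (?box z)" "?box z \<subseteq> UNIV \<times> {0..}" for z
  proof -
    show "?box z \<in> sets borel" unfolding slab_box_def by (intro borel_Times) auto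
    show "bounded (?box z)" unfolding slab_box_def by (intro bounded_Times) auto
    show "?box z \<subseteq> UNIV \<times> {0..}" using \<delta> by (auto simp: slab_box_def intro: order_trans[rotated])
  qed
  have disj: "?box z \<inter> ?box z' = {}" if "z \<noteq> z'" for z z'
  proof (rule ccontr)
    assume "?box z \<inter> ?box z' \<noteq> {}"
    then obtain u where "fst u \<in> cell r z" "fst u \<in> cell r z'" unfolding slab_box_def by auto
    then show False using that mem_cell_iff[OF r] by metis
  qed
  have vol: "measure lborel (?box z) = ?v" for z :: "'n \<Rightarrow> int" by (rule measure_slab_box[OF r \<delta>])
  define A where "A zs = {\<omega> \<in> space M. \<forall>z\<in>set zs. count_list zs z \<le> card (P \<omega> \<inter> ?box z)}" for zs
  have A: "A zs \<in> sets M" "prob (A zs) \<le> ?v ^ length zs" for zs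
    unfolding A_def by (rule poisson_multiplicities[OF U B disj vol]; assumption)+
  define E where "E n = (\<Union>zs\<in>paths D n z. A zs)" for n
  have fin: "finite (paths D n z)" and cp: "card (paths D n z) \<le> card D ^ n" for n
    using finite_card_paths[OF D(1), of n z] by simp_all
  have Em: "E n \<in> sets M" for n unfolding E_def using fin A by (intro sets.finite_UN) auto
  \<comment> \<open>Union bound: a factor \<open>3 ^ d\<close> for the choice of each step against a
    factor \<open>?v\<close> for the visited box; by \<open>small\<close> each step costs at most
    one half.\<close>
  have Ep: "prob (E n) \<le> ?v * (1 / 2) ^ n" for n
  proof -
    have "prob (E n) \<le> (\<Sum>zs\<in>paths D n z. prob (A zs))"
      unfolding E_def by (rule finite_measure_subadditive_finite[OF fin]) (use A in auto)
    also have "\<dots> \<le> (\<Sum>zs\<in>paths D n z. ?v ^ Suc n)"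
    proof (rule sum_mono)
      fix zs assume "zs \<in> paths D n z"
      then have "length zs = Suc n" by (rule length_paths)
      then show "prob (A zs) \<le> ?v ^ Suc n" using A(2)[of zs] by simp
    qed
    also have "\<dots> \<le> real (card D ^ n) * ?v ^ Suc n"
      using cp[of n] v0 by (simp add: mult_right_mono del: power_Suc)
    also have "\<dots> = ?v * (3 ^ CARD('n) * ?v) ^ n" by (simp add: D power_mult_distrib)
    also have "\<dots> \<le> ?v * (1 / 2) ^ n"
      using small v0 by (intro mult_left_mono power_mono) auto
    finally show ?thesis .
  qed
  have "(\<lambda>n. ?v * (1 / 2) ^ n) \<longlonglongrightarrow> ?v * 0" by (intro tendsto_intros) auto
  moreover have "prob (\<Inter>n. E n) \<le> ?v * (1 / 2) ^ n" for n
    using Ep[of n] finite_measure_mono[of "\<Inter>n. E n" "E n"] Em by (intro order_trans[OF _ Ep]) auto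
  ultimately have "prob (\<Inter>n. E n) \<le> 0" by (intro LIMSEQ_le_const) auto
  then have "prob (\<Inter>n. E n) = 0" using measure_nonneg[of M] by (intro antisym) auto
  moreover have "(\<Inter>n. E n) \<in> sets M" using Em by auto
  ultimately have "(\<Inter>n. E n) \<in> null_sets M"
    by (intro null_setsI) (simp_all add: emeasure_eq_measure)
  \<comment> \<open>The event that a chain exists is not shown to be measurable; it suffices that it
    lies in the null set common to all \<open>E n\<close>.\<close>
  moreover have "{\<omega> \<in> space M. \<not> (\<forall>x. slab_chain r \<delta> k (P \<omega>) x \<longrightarrow> cell_index r (fst (x 0)) \<noteq> z)} \<subseteq> (\<Inter>n. E n)"
  proof
    fix \<omega> assume "\<omega> \<in> {\<omega> \<in> space M. \<not> (\<forall>x. slab_chain r \<delta> k (P \<omega>) x \<longrightarrow> cell_index r (fst (x 0)) \<noteq> z)}"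
    then obtain x where \<omega>: "\<omega> \<in> space M" and x: "slab_chain r \<delta> k (P \<omega>) x" "cell_index r (fst (x 0)) = z" by blast
    define f where "f i = cell_index r (fst (x i))" for i
    have "\<omega> \<in> E n" for n
    proof -
      let ?zs = "map f [0..<Suc n]"
      have "(\<lambda>j. f (Suc i) j - f i j) \<in> D" for i
      proof -
        have "f (Suc i) j - f i j \<in> {-1..1}" for j
        proof -
          have "\<bar>fst (x (Suc i)) $ j - fst (x i) $ j\<bar> \<le> dist (fst (x (Suc i))) (fst (x i))"
            using component_le_norm_cart[of "fst (x (Suc i)) - fst (x i)" j] by (simp add: dist_norm)
          also have "\<dots> < r" using x(1) by (simp add: slab_chain_def dist_commute)
          finally have "\<bar>fst (x (Suc i)) $ j / r - fst (x i) $ j / r\<bar> < 1"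
            using r by (simp add: diff_divide_distrib[symmetric])
          then show ?thesis unfolding f_def cell_index_def by (rule floor_diff_bound)
        qed
        then show ?thesis by (auto simp: D_def)
      qed
      then have path: "?zs \<in> paths D n z" using map_in_paths[of n f D] x(2) by (simp add: f_def)
      \<comment> \<open>Injectivity of the chain: repeated visits to a box are made by different
        points, so the box holds at least as many points as visits.\<close>
      have "count_list ?zs c \<le> card (P \<omega> \<inter> ?box c)" for c
      proof -
        let ?J = "{i. i < Suc n \<and> f i = c}"
        have "count_list ?zs c = card ?J"
        proof -
          have "count_list ?zs c = card {i. i < length ?zs \<and> c = ?zs ! i}"
            unfolding count_list_eq_length_filter length_filter_conv_card by simp
          also have "{i. i < length ?zs \<and> c = ?zs ! i} = ?J" by (auto simp del: upt_Suc)
          finally show ?thesis .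
        qed
        also have "\<dots> = card (x ` ?J)"
          using x(1) by (intro card_image[symmetric]) (auto simp: slab_chain_def intro: inj_on_subset)
        also have "\<dots> \<le> card (P \<omega> \<inter> ?box c)"
        proof (rule card_mono)
          show "finite (P \<omega> \<inter> ?box c)"
            by (rule finite_locally_finite_Int[OF unit_poisson_processD(3)[OF U \<omega>] B(2)])
          show "x ` ?J \<subseteq> P \<omega> \<inter> ?box c"
          proof (rule image_subsetI)
            fix i assume "i \<in> ?J"
            then have "fst (x i) \<in> cell r c" using mem_cell_iff[OF r, of "fst (x i)" c] by (simp add: f_def)
            then show "x i \<in> P \<omega> \<inter> ?box c"
              using x(1) by (auto simp: slab_chain_def slab_box_def mem_Times_iff)
          qed
        qed
        finally show ?thesis .
      qed
      then have "\<omega> \<in> A ?zs" using \<omega> by (simp add: A_def del: upt_Suc)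
      then show ?thesis using path unfolding E_def by blast
    qed
    then show "\<omega> \<in> (\<Inter>n. E n)" by blast
  qed
  ultimately show ?thesis by (rule AE_I')
qed

section \<open>Well-foundedness of ancestry\<close>

lemma eventually_constant_nat:
  fixes f :: "nat \<Rightarrow> nat"
  assumes "\<And>i. f (Suc i) \<le> f i"
  shows "\<exists>m. \<forall>i. f (m + i) = f m"
proof -
  have "decseq f" using assms by (simp add: decseq_Suc_iff)
  obtain m where m: "f m = (LEAST k. k \<in> range f)"
    using LeastI[of "\<lambda>k. k \<in> range f" "f 0"] by (metis rangeE rangeI)
  have "f (m + i) = f m" for i
  proof (rule antisym)
    show "f (m + i) \<le> f m" using \<open>decseq f\<close> by (simp add: decseqD)
    show "f m \<le> f (m + i)" unfolding m by (rule Least_le) simp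
  qed
  then show ?thesis by blast
qed

text \<open>Along an infinite chain of ancestors times are nonincreasing and nonnegative, so the
  slab number stabilises; the remaining tail is a chain inside one slab. Its points are distinct
  because the order of arrival is strict.\<close>

lemma wf_edges_on_parking:
  fixes V :: "((real ^ 'n::{finite,linorder}) \<times> real) set"
  assumes \<rho>: "\<rho> > 0" and V: "V \<subseteq> UNIV \<times> {0..}" and \<delta>: "\<delta> > 0"
    and no: "\<And>k x. \<not> slab_chain (2 * \<rho>) \<delta> k V x"
  shows "wf (edges_on (parking_edge \<rho>) V)"
  unfolding wf_iff_no_infinite_down_chain
proof
  assume "\<exists>f. \<forall>i. (f (Suc i), f i) \<in> edges_on (parking_edge \<rho>) V"
  then obtain f where "\<forall>i. (f (Suc i), f i) \<in> edges_on (parking_edge \<rho>) V" by blast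
  then have f: "f i \<in> V" "parking_edge \<rho> (f (Suc i)) (f i)" for i by (auto simp: edges_on_def)
  let ?R = "\<lambda>u v. snd u < snd v \<or> (snd u = snd v \<and> lex_less (fst u) (fst v))"
  have R: "?R (f (Suc i)) (f i)" and d: "dist (fst (f (Suc i))) (fst (f i)) < 2 * \<rho>" for i
    using f(2)[of i] unfolding parking_edge_iff[OF \<rho>] by blast+
  have lt: "?R (f (i + Suc k)) (f i)" for i k
  proof (induction k)
    case 0 then show ?case using R[of i] by simp
  next
    case (Suc k)
    then show ?case using R[of "i + Suc k"] lex_less_trans by auto
  qed
  have "f i \<noteq> f j" if "i < j" for i j
  proof -
    obtain k where "j = i + Suc k" using \<open>i < j\<close> less_iff_Suc_add by auto
    with lt[of i k] show ?thesis using lex_less_irrefl[of "fst (f i)"] by auto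
  qed
  then have inj: "inj f" by (metis injI linorder_neqE_nat)
  have pos: "snd (f i) \<ge> 0" for i using f(1)[of i] V by (auto simp: mem_Times_iff)
  \<comment> \<open>Number of the time slab containing the \<open>i\<close>-th point; the conversion
    to \<open>nat\<close> is harmless as times are nonnegative.\<close>
  define k where "k i = nat \<lfloor>snd (f i) / \<delta>\<rfloor>" for i
  have "k (Suc i) \<le> k i" for i
    unfolding k_def using R[of i] \<delta> by (intro nat_mono floor_mono divide_right_mono) auto
  then obtain m where m: "\<And>i. k (m + i) = k m" using eventually_constant_nat by blast
  have "snd (f (m + i)) \<in> {real (k m) * \<delta>..<real (Suc (k m)) * \<delta>}" for i
  proof -
    have "real (k (m + i)) = of_int \<lfloor>snd (f (m + i)) / \<delta>\<rfloor>"
      unfolding k_def using pos \<delta> by simp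
    then have "real (k m) \<le> snd (f (m + i)) / \<delta>" "snd (f (m + i)) / \<delta> < real (k m) + 1"
      unfolding m by linarith+
    then show ?thesis using \<delta> by (simp add: field_simps)
  qed
  moreover have "inj (\<lambda>i. f (m + i))" using inj by (auto intro!: injI dest: injD)
  ultimately have "slab_chain (2 * \<rho>) \<delta> (k m) V (\<lambda>i. f (m + i))"
    using f(1) d unfolding slab_chain_def by (simp add: dist_commute)
  then show False using no by blast
qed

lemma AE_parking_wf:
  fixes P :: "'w \<Rightarrow> ((real ^ 'n::{finite,linorder}) \<times> real) set"
  assumes U: "unit_poisson_process M (UNIV \<times> {0..}) P" and \<rho>: "\<rho> > 0"
  shows "AE \<omega> in M. parking_wf \<rho> (P \<omega>)"
proof -
  \<comment> \<open>Chosen so that the smallness condition of the path counting holds with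
    equality.\<close>
  define \<delta> where "\<delta> = 1 / (2 * (3 ^ CARD('n) * (2 * \<rho>) ^ CARD('n)))"
  have \<delta>: "\<delta> > 0" using \<rho> by (simp add: \<delta>_def)
  have small: "3 ^ CARD('n) * ((2 * \<rho>) ^ CARD('n) * \<delta>) \<le> 1 / 2" using \<rho> by (simp add: \<delta>_def)
  have "AE \<omega> in M. \<forall>k. \<forall>z :: 'n \<Rightarrow> int. \<forall>x. slab_chain (2 * \<rho>) \<delta> k (P \<omega>) x \<longrightarrow> cell_index (2 * \<rho>) (fst (x 0)) \<noteq> z"
    unfolding AE_all_countable using AE_no_slab_chain_from[OF U _ \<delta> small] \<rho> by simp
  then show ?thesis
  proof (rule AE_mp, intro AE_I2 impI)
    fix \<omega> assume \<omega>: "\<omega> \<in> space M"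
      and no: "\<forall>k. \<forall>z :: 'n \<Rightarrow> int. \<forall>x. slab_chain (2 * \<rho>) \<delta> k (P \<omega>) x \<longrightarrow> cell_index (2 * \<rho>) (fst (x 0)) \<noteq> z"
    have "wf (edges_on (parking_edge \<rho>) (P \<omega>))"
      by (rule wf_edges_on_parking[OF \<rho> unit_poisson_processD(2)[OF U \<omega>] \<delta>]) (use no in blast)
    then show "parking_wf \<rho> (P \<omega>)"
      using unit_poisson_processD(2,3)[OF U \<omega>] by (simp add: parking_wf_def)
  qed
qed

section \<open>Lipschitz sets\<close>

text \<open>The graph is the image of a hyperplane, a null set, under a map with Lipschitz constant
  \<open>1 + L\<close>.\<close>

lemma negligible_lipschitz_graph:
  fixes e :: "real ^ 'n"
  assumes e: "norm e = 1" and \<phi>: "L-lipschitz_on {v. v \<bullet> e = 0} \<phi>"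
  shows "negligible (lipschitz_graph e \<phi>)"
proof -
  let ?H = "{v. v \<bullet> e = 0}"
  have "lipschitz_graph e \<phi> = (\<lambda>v. v + \<phi> v *\<^sub>R e) ` ?H"
    unfolding lipschitz_graph_def by blast
  moreover have "negligible ((\<lambda>v. v + \<phi> v *\<^sub>R e) ` ?H)"
  proof (rule negligible_locally_Lipschitz_image)
    have "e \<noteq> 0" using e by auto
    then have "negligible {v. e \<bullet> v = 0}" by (intro negligible_hyperplane) simp
    then show "negligible ?H" by (simp add: inner_commute)
    fix v assume v: "v \<in> ?H"
    have "norm ((w + \<phi> w *\<^sub>R e) - (v + \<phi> v *\<^sub>R e)) \<le> (1 + L) * norm (w - v)" if "w \<in> ?H" for w
    proof -
      have "(w + \<phi> w *\<^sub>R e) - (v + \<phi> v *\<^sub>R e) = (w - v) + (\<phi> w - \<phi> v) *\<^sub>R e" by (simp add: algebra_simps)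
      moreover have "norm ((w - v) + (\<phi> w - \<phi> v) *\<^sub>R e) \<le> norm (w - v) + \<bar>\<phi> w - \<phi> v\<bar>"
        using norm_triangle_ineq[of "w - v" "(\<phi> w - \<phi> v) *\<^sub>R e"] e by simp
      ultimately have "norm ((w + \<phi> w *\<^sub>R e) - (v + \<phi> v *\<^sub>R e)) \<le> norm (w - v) + \<bar>\<phi> w - \<phi> v\<bar>"
        by (simp only:)
      moreover have "\<bar>\<phi> w - \<phi> v\<bar> \<le> L * norm (w - v)"
        using lipschitz_onD[OF \<phi> that v] by (simp add: dist_norm)
      ultimately show ?thesis by (simp add: algebra_simps)
    qed
    then show "\<exists>T B. open T \<and> v \<in> T \<and> (\<forall>w\<in>?H \<inter> T. norm ((w + \<phi> w *\<^sub>R e) - (v + \<phi> v *\<^sub>R e)) \<le> B * norm (w - v))"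
      by (intro exI[of _ UNIV] exI[of _ "1 + L"]) simp
  qed simp
  ultimately show ?thesis by simp
qed

lemma lipschitz_setsD:
  assumes "D \<in> lipschitz_sets"
  shows "D \<noteq> {}" "bounded D" "D \<in> sets borel"
    and "\<exists>\<U>. finite \<U> \<and> frontier D = \<Union>\<U> \<and> (\<forall>U\<in>\<U>. lipschitz_piece D U)"
  using assms unfolding lipschitz_sets_def by simp_all

lemma negligible_frontier_lipschitz:
  assumes "D \<in> lipschitz_sets" shows "negligible (frontier D)"
proof -
  obtain \<U> where U: "finite \<U>" "frontier D = \<Union>\<U>" "\<forall>U\<in>\<U>. lipschitz_piece D U"
    using lipschitz_setsD(4)[OF assms] by (elim exE conjE) (rule that)
  show ?thesis unfolding U(2)
  proof (rule negligible_Union[OF U(1)])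
    fix U assume "U \<in> \<U>"
    then have "lipschitz_piece D U" using U(3) by simp
    then obtain e \<phi> L where "norm e = 1" "L-lipschitz_on {v. v \<bullet> e = 0} \<phi>" "U \<subseteq> lipschitz_graph e \<phi>"
      unfolding lipschitz_piece_def by (elim exE conjE) (rule that)
    then show "negligible U" using negligible_lipschitz_graph negligible_subset by blast
  qed
qed

lemma frontier_borel: "frontier D \<in> sets borel"
  by (intro borel_closed) (simp add: frontier_closed)

lemma measure_frontier_lipschitz:
  assumes "D \<in> lipschitz_sets" shows "measure lborel (frontier D) = 0"
proof -
  have "measure lebesgue (frontier D) = 0"
    using negligible_frontier_lipschitz[OF assms] by (simp add: negligible_iff_measure)
  then show ?thesis using frontier_borel[of D] by simp
qed

lemma fmeasurable_lborel_bounded: "bounded B \<Longrightarrow> B \<in> sets borel \<Longrightarrow> B \<in> fmeasurable lborel"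
  using emeasure_bounded_finite[of B] by (intro fmeasurableI) auto

text \<open>A bounded nonempty set has a frontier point. Slightly above it in direction
  \<open>e\<close> a small ball lies above the graph, hence inside \<open>D\<close> up to the
  frontier, which is null. Positivity is needed for dividing by the volume.\<close>

lemma measure_lipschitz_pos:
  fixes D :: "(real ^ 'n) set"
  assumes "D \<in> lipschitz_sets" shows "measure lborel D > 0"
proof -
  note D = lipschitz_setsD[OF assms]
  have "D \<noteq> UNIV" using D(2) by (metis not_bounded_UNIV)
  then obtain x where x: "x \<in> frontier D" using D(1) frontier_not_empty[of D] by blast
  obtain \<U> where U: "finite \<U>" "frontier D = \<Union>\<U>" "\<forall>U\<in>\<U>. lipschitz_piece D U"
    using D(4) by (elim exE conjE) (rule that)
  then obtain U where "x \<in> U" and "lipschitz_piece D U" using x by blast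
  then obtain e \<phi> L where e: "norm e = 1" and \<phi>: "L-lipschitz_on {v. v \<bullet> e = 0} \<phi>"
    and g: "U \<subseteq> lipschitz_graph e \<phi>"
    and loc: "\<forall>x\<in>U. \<exists>\<epsilon>>0. \<forall>y\<in>ball x \<epsilon> - frontier D. y \<in> D \<longleftrightarrow> y \<in> above_graph e \<phi>"
    unfolding lipschitz_piece_def by (elim exE conjE) (rule that)
  obtain v where v: "v \<bullet> e = 0" "x = v + \<phi> v *\<^sub>R e" using g \<open>x \<in> U\<close> unfolding lipschitz_graph_def by blast
  obtain \<epsilon> where \<epsilon>: "\<epsilon> > 0" "\<forall>y\<in>ball x \<epsilon> - frontier D. y \<in> D \<longleftrightarrow> y \<in> above_graph e \<phi>"
    using loc \<open>x \<in> U\<close> by blast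
  have L: "L \<ge> 0" using \<phi> by (rule lipschitz_on_nonneg)
  have ee: "e \<bullet> e = 1" using e by (simp add: norm_eq_1)
  define w where "w = x + (\<epsilon> / 2) *\<^sub>R e"
  define \<eta> where "\<eta> = \<epsilon> / (4 * (2 * L + 1))"
  have \<eta>: "\<eta> > 0" "\<eta> \<le> \<epsilon> / 4" "(2 * L + 1) * \<eta> = \<epsilon> / 4"
  proof -
    have p: "2 * L + 1 \<ge> 1" using L by simp
    show "\<eta> > 0" using L \<epsilon> by (simp add: \<eta>_def)
    show "(2 * L + 1) * \<eta> = \<epsilon> / 4" using p by (simp add: \<eta>_def field_simps)
    moreover have "1 * \<eta> \<le> (2 * L + 1) * \<eta>" using p \<open>\<eta> > 0\<close> by (intro mult_right_mono) auto
    ultimately show "\<eta> \<le> \<epsilon> / 4" by simp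
  qed
  have we: "w \<bullet> e = \<phi> v + \<epsilon> / 2" by (simp add: w_def v(2) inner_add_left v(1) ee)
  have "ball w \<eta> \<subseteq> D \<union> frontier D"
  proof
    fix y assume y: "y \<in> ball w \<eta>"
    define u where "u = y - w"
    have u: "norm u < \<eta>" using y by (simp add: u_def dist_norm norm_minus_commute)
    have ue: "\<bar>u \<bullet> e\<bar> \<le> norm u" using Cauchy_Schwarz_ineq2[of u e] e by simp
    have "dist x y < \<epsilon>"
    proof -
      have "y - x = u + (\<epsilon> / 2) *\<^sub>R e" by (simp add: u_def w_def)
      then have "norm (y - x) \<le> norm u + \<epsilon> / 2" using norm_triangle_ineq[of u "(\<epsilon> / 2) *\<^sub>R e"] e \<epsilon>(1) by simp
      then show ?thesis using u \<eta>(2) \<epsilon>(1) by (simp add: dist_norm norm_minus_commute)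
    qed
    moreover have "y \<in> above_graph e \<phi>"
    proof -
      have ye: "y \<bullet> e = \<phi> v + \<epsilon> / 2 + u \<bullet> e" using we by (simp add: u_def inner_diff_left)
      have py: "y - (y \<bullet> e) *\<^sub>R e = v + (u - (u \<bullet> e) *\<^sub>R e)"
        unfolding ye by (simp add: u_def w_def v(2) algebra_simps)
      have m: "y - (y \<bullet> e) *\<^sub>R e \<in> {v. v \<bullet> e = 0}" by (simp add: inner_diff_left ee)
      have "\<bar>\<phi> (y - (y \<bullet> e) *\<^sub>R e) - \<phi> v\<bar> \<le> L * norm (u - (u \<bullet> e) *\<^sub>R e)"
        using lipschitz_onD[OF \<phi> m, of v] v(1) py by (simp add: dist_norm)
      also have "\<dots> \<le> L * (2 * \<eta>)"
        using norm_triangle_ineq4[of u "(u \<bullet> e) *\<^sub>R e"] ue u e L by (intro mult_left_mono) auto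
      finally have "\<phi> (y - (y \<bullet> e) *\<^sub>R e) \<le> \<phi> v + 2 * L * \<eta>" by (simp add: abs_le_iff)
      also have "\<dots> < \<phi> v + \<epsilon> / 2 - \<eta>" using \<eta>(3) \<epsilon>(1) by (simp add: algebra_simps)
      also have "\<dots> \<le> y \<bullet> e" unfolding ye using ue u by linarith
      finally show ?thesis by (simp add: above_graph_def)
    qed
    ultimately show "y \<in> D \<union> frontier D" using \<epsilon>(2) by auto
  qed
  moreover have "bounded (frontier D)" by (rule compact_imp_bounded[OF compact_frontier_bounded[OF D(2)]])
  ultimately have "measure lborel (ball w \<eta>) \<le> measure lborel (D \<union> frontier D)"
    using D(2,3) by (intro measure_mono_fmeasurable fmeasurable_lborel_bounded) (auto simp: frontier_borel)
  also have "\<dots> \<le> measure lborel D + measure lborel (frontier D)"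
    using D(3) frontier_borel[of D] by (intro measure_Un_le) auto
  finally have "measure lborel (ball w \<eta>) \<le> measure lborel D"
    using measure_frontier_lipschitz[OF assms] by simp
  moreover have "measure lborel (ball w \<eta>) > 0" using content_ball_pos[OF \<eta>(1), of w] by simp
  ultimately show ?thesis by linarith
qed

section \<open>Scaling of Lipschitz sets\<close>

lemma lipschitz_piece_scale:
  fixes D :: "(real ^ 'n) set"
  assumes R: "R > 0" and p: "lipschitz_piece D U" and F: "frontier ((*\<^sub>R) R ` D) = (*\<^sub>R) R ` frontier D"
  shows "lipschitz_piece ((*\<^sub>R) R ` D) ((*\<^sub>R) R ` U)"
proof -
  obtain e \<phi> L where o: "openin (top_of_set (frontier D)) U"
    and e: "norm e = 1" and \<phi>: "L-lipschitz_on {v. v \<bullet> e = 0} \<phi>"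
    and g: "U \<subseteq> lipschitz_graph e \<phi>"
    and loc: "\<forall>x\<in>U. \<exists>\<epsilon>>0. \<forall>y\<in>ball x \<epsilon> - frontier D. y \<in> D \<longleftrightarrow> y \<in> above_graph e \<phi>"
    using p unfolding lipschitz_piece_def by (elim exE conjE) (rule that)
  \<comment> \<open>The graph function of the scaled graph, with the same Lipschitz
    constant.\<close>
  let ?\<phi> = "\<lambda>v. R * \<phi> ((1 / R) *\<^sub>R v)"
  have mem: "y \<in> (*\<^sub>R) R ` X \<longleftrightarrow> (1 / R) *\<^sub>R y \<in> X" for y and X :: "(real ^ 'n) set"
    using R by (force simp: image_iff)
  have "openin (top_of_set ((*\<^sub>R) R ` frontier D)) ((*\<^sub>R) R ` U)"
  proof -
    obtain T where T: "open T" "U = frontier D \<inter> T" using o unfolding openin_open by blast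
    have "(*\<^sub>R) R ` U = (*\<^sub>R) R ` frontier D \<inter> (*\<^sub>R) R ` T" unfolding set_eq_iff mem Int_iff T(2) by blast
    moreover have "open ((*\<^sub>R) R ` T)" using R T(1) by (intro open_scaling) auto
    ultimately show ?thesis unfolding openin_open by blast
  qed
  moreover have "L-lipschitz_on {v. v \<bullet> e = 0} ?\<phi>"
  proof (rule lipschitz_onI)
    show "L \<ge> 0" using \<phi> by (rule lipschitz_on_nonneg)
    fix v w :: "real ^ 'n" assume "v \<in> {v. v \<bullet> e = 0}" "w \<in> {v. v \<bullet> e = 0}"
    then have "dist (\<phi> ((1 / R) *\<^sub>R v)) (\<phi> ((1 / R) *\<^sub>R w)) \<le> L * dist ((1 / R) *\<^sub>R v) ((1 / R) *\<^sub>R w)"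
      by (intro lipschitz_onD[OF \<phi>]) auto
    also have "dist ((1 / R) *\<^sub>R v) ((1 / R) *\<^sub>R w) = dist v w / R"
      using R by (simp add: dist_norm flip: scaleR_diff_right)
    finally have "R * dist (\<phi> ((1 / R) *\<^sub>R v)) (\<phi> ((1 / R) *\<^sub>R w)) \<le> L * dist v w"
      using R by (simp add: field_simps)
    then show "dist (?\<phi> v) (?\<phi> w) \<le> L * dist v w"
      using R by (simp add: dist_real_def abs_mult flip: right_diff_distrib)
  qed
  moreover have "(*\<^sub>R) R ` U \<subseteq> lipschitz_graph e ?\<phi>"
  proof
    fix y assume "y \<in> (*\<^sub>R) R ` U"
    then obtain v where "y = R *\<^sub>R (v + \<phi> v *\<^sub>R e)" "v \<bullet> e = 0" using g unfolding lipschitz_graph_def by blast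
    then have "y = R *\<^sub>R v + ?\<phi> (R *\<^sub>R v) *\<^sub>R e" "(R *\<^sub>R v) \<bullet> e = 0" using R by (auto simp: scaleR_add_right)
    then show "y \<in> lipschitz_graph e ?\<phi>" unfolding lipschitz_graph_def by blast
  qed
  moreover have "\<forall>x\<in>(*\<^sub>R) R ` U. \<exists>\<epsilon>>0. \<forall>y\<in>ball x \<epsilon> - (*\<^sub>R) R ` frontier D. y \<in> (*\<^sub>R) R ` D \<longleftrightarrow> y \<in> above_graph e ?\<phi>"
  proof
    fix x assume "x \<in> (*\<^sub>R) R ` U"
    then have "(1 / R) *\<^sub>R x \<in> U" by (simp add: mem)
    then obtain \<epsilon> where \<epsilon>: "\<epsilon> > 0" "\<forall>y\<in>ball ((1 / R) *\<^sub>R x) \<epsilon> - frontier D. y \<in> D \<longleftrightarrow> y \<in> above_graph e \<phi>"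
      using loc by blast
    have "y \<in> (*\<^sub>R) R ` D \<longleftrightarrow> y \<in> above_graph e ?\<phi>" if y: "y \<in> ball x (R * \<epsilon>) - (*\<^sub>R) R ` frontier D" for y
    proof -
      have "dist ((1 / R) *\<^sub>R x) ((1 / R) *\<^sub>R y) = dist x y / R"
        using R by (simp add: dist_norm flip: scaleR_diff_right)
      also have "\<dots> < \<epsilon>" using y R by (simp add: field_simps)
      finally have "(1 / R) *\<^sub>R y \<in> ball ((1 / R) *\<^sub>R x) \<epsilon> - frontier D" using y by (simp add: mem)
      then have "y \<in> (*\<^sub>R) R ` D \<longleftrightarrow> (1 / R) *\<^sub>R y \<in> above_graph e \<phi>" using \<epsilon>(2) by (simp add: mem)
      also have "\<dots> \<longleftrightarrow> y \<in> above_graph e ?\<phi>"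
        using R by (simp add: above_graph_def scaleR_diff_right field_simps)
      finally show ?thesis .
    qed
    then show "\<exists>\<epsilon>>0. \<forall>y\<in>ball x \<epsilon> - (*\<^sub>R) R ` frontier D. y \<in> (*\<^sub>R) R ` D \<longleftrightarrow> y \<in> above_graph e ?\<phi>"
      using R \<epsilon>(1) by (intro exI[of _ "R * \<epsilon>"]) simp
  qed
  ultimately show ?thesis
    unfolding lipschitz_piece_def F using e by (intro conjI exI[of _ e] exI[of _ ?\<phi>] exI[of _ L])
qed

lemma borel_scale:
  fixes D :: "'a::euclidean_space set"
  assumes "R > 0" "D \<in> sets borel" shows "(*\<^sub>R) R ` D \<in> sets borel"
proof -
  have "(*\<^sub>R) R ` D = (\<lambda>x. (1 / R) *\<^sub>R x) -` D"
    using assms(1) by (force simp: image_iff)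
  moreover have "(\<lambda>x::'a. (1 / R) *\<^sub>R x) -` D \<in> sets borel"
    using measurable_sets[of "\<lambda>x::'a. (1 / R) *\<^sub>R x" borel borel D] assms(2) by simp
  ultimately show ?thesis by simp
qed

lemma lipschitz_sets_scale:
  fixes D :: "(real ^ 'n) set"
  assumes D: "D \<in> lipschitz_sets" and R: "R > 0"
  shows "(*\<^sub>R) R ` D \<in> lipschitz_sets"
proof -
  have lin: "linear ((*\<^sub>R) R :: real ^ 'n \<Rightarrow> real ^ 'n)" by (rule linear_scaleR)
  have inj: "inj ((*\<^sub>R) R :: real ^ 'n \<Rightarrow> real ^ 'n)" using R by (auto intro: injI)
  have F: "frontier ((*\<^sub>R) R ` D) = (*\<^sub>R) R ` frontier D"
    unfolding frontier_def interior_injective_linear_image[OF lin inj]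
      closure_injective_linear_image[OF lin inj] image_set_diff[OF inj] ..
  obtain \<U> where U: "finite \<U>" "frontier D = \<Union>\<U>" "\<forall>U\<in>\<U>. lipschitz_piece D U"
    using lipschitz_setsD(4)[OF D] by (elim exE conjE) (rule that)
  have "finite ((`) ((*\<^sub>R) R) ` \<U>)" using U by simp
  moreover have "frontier ((*\<^sub>R) R ` D) = \<Union>((`) ((*\<^sub>R) R) ` \<U>)" unfolding F U(2) by blast
  moreover have "\<forall>U\<in>(`) ((*\<^sub>R) R) ` \<U>. lipschitz_piece ((*\<^sub>R) R ` D) U"
    using U(3) lipschitz_piece_scale[OF R _ F] by blast
  moreover have "bounded ((*\<^sub>R) R ` D)" using lipschitz_setsD(2)[OF D] by (rule bounded_scaling)
  ultimately show ?thesis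
    using lipschitz_setsD(1)[OF D] borel_scale[OF R lipschitz_setsD(3)[OF D]]
    unfolding lipschitz_sets_def mem_Collect_eq by blast
qed

lemma measure_scale:
  fixes D :: "(real ^ 'n) set"
  assumes "R > 0" "D \<in> sets borel"
  shows "measure lborel ((*\<^sub>R) R ` D) = R ^ CARD('n) * measure lborel D"
proof -
  have "measure lebesgue ((\<lambda>x. R *\<^sub>R x + 0) ` D) = \<bar>R\<bar> ^ DIM(real ^ 'n) * measure lebesgue D"
    by (rule measure_lebesgue_affine)
  then show ?thesis using assms borel_scale[OF assms] by simp
qed

text \<open>Treats the \<open>d\<close> faces of a box that meet in the corner \<open>c\<close> as a
  single graph, in the diagonal direction pointing from that corner into the box. Each face is given
  by an affine function; the maximum selects the face that is hit.\<close>

definition box_graph :: "('n \<Rightarrow> real) \<Rightarrow> ('n \<Rightarrow> real) \<Rightarrow> real ^ 'n \<Rightarrow> real" where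
  "box_graph s c v = (MAX i. sqrt (CARD('n)) * (s i * v $ i - s i * c i))"

lemma box_graph_less_iff:
  "box_graph s c v < t \<longleftrightarrow> (\<forall>i. sqrt (CARD('n)) * (s i * v $ i - s i * c i) < t)" for v :: "real ^ 'n"
  unfolding box_graph_def by (subst Max_less_iff) auto

text \<open>A maximum of functions with a common Lipschitz constant inherits it.\<close>

lemma lipschitz_on_box_graph:
  fixes s c :: "'n::finite \<Rightarrow> real"
  assumes s: "\<And>i. \<bar>s i\<bar> = 1"
  shows "(sqrt (CARD('n)))-lipschitz_on X (box_graph s c)"
proof (rule lipschitz_onI)
  have "box_graph s c v \<le> box_graph s c w + sqrt (CARD('n)) * dist v w" for v w
    unfolding box_graph_def
  proof (intro Max.boundedI; clarsimp)
    fix i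
    have "s i * v $ i - s i * w $ i \<le> \<bar>(v - w) $ i\<bar>"
    proof -
      have "s i * v $ i - s i * w $ i = s i * (v - w) $ i" by (simp add: algebra_simps)
      also have "\<dots> \<le> \<bar>s i * (v - w) $ i\<bar>" by simp
      also have "\<dots> = \<bar>(v - w) $ i\<bar>" using s[of i] unfolding abs_mult by simp
      finally show ?thesis .
    qed
    also have "\<dots> \<le> dist v w" unfolding dist_norm by (rule component_le_norm_cart)
    finally have "sqrt (CARD('n)) * (s i * v $ i - s i * c i) \<le>
        sqrt (CARD('n)) * ((s i * w $ i - s i * c i) + dist v w)"
      by (intro mult_left_mono) auto
    also have "\<dots> \<le> (MAX i. sqrt (CARD('n)) * (s i * w $ i - s i * c i)) + sqrt (CARD('n)) * dist v w"
      by (simp add: distrib_left)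
    finally show "sqrt (CARD('n)) * (s i * v $ i - s i * c i) \<le>
        (MAX i. sqrt (CARD('n)) * (s i * w $ i - s i * c i)) + sqrt (CARD('n)) * dist v w" .
  qed
  then have *: "box_graph s c v \<le> box_graph s c w + sqrt (CARD('n)) * dist v w" for v w .
  show "dist (box_graph s c v) (box_graph s c w) \<le> sqrt (CARD('n)) * dist v w" for v w
    using *[of v w] *[of w v] unfolding dist_commute[of w v] dist_real_def abs_le_iff by linarith
qed simp

text \<open>One piece per corner: away from the faces through the opposite corner only the
  \<open>d\<close> faces at the corner itself bound the box, and these form a graph in the diagonal
  direction. Faces may belong to \<open>D\<close> or not, since the definition ignores frontier
  points.\<close>

lemma lipschitz_sets_box:
  fixes a b :: "real ^ 'n"
  assumes ab: "\<And>i. a $ i < b $ i" and D: "box a b \<subseteq> D" "D \<subseteq> cbox a b" "D \<in> sets borel"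
  shows "D \<in> lipschitz_sets"
proof -
  have ne: "box a b \<noteq> {}" using ab by (simp add: interval_ne_empty_cart)
  have cl: "closure D = cbox a b"
  proof (rule antisym)
    show "closure D \<subseteq> cbox a b" using D(2) closed_cbox by (rule closure_minimal)
    show "cbox a b \<subseteq> closure D" using closure_mono[OF D(1)] closure_box[OF ne] by simp
  qed
  have int: "interior D = box a b"
  proof (rule antisym)
    show "interior D \<subseteq> box a b" using interior_mono[OF D(2)] by (simp add: interior_cbox)
    show "box a b \<subseteq> interior D" using D(1) open_box by (rule interior_maximal)
  qed
  have F: "frontier D = cbox a b - box a b" by (simp add: frontier_def cl int)
  \<comment> \<open>A sign vector \<open>s\<close> encodes a corner; \<open>near s\<close> and
    \<open>far s\<close> are the coordinates of this corner and of the opposite one, and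
    \<open>T s\<close> keeps strictly away from the faces through the latter.\<close>
  define near where "near s i = (if s i = (1::real) then b $ i else a $ i)" for s i
  define far where "far s i = (if s i = (1::real) then a $ i else b $ i)" for s i
  define T where "T s = {x :: real ^ 'n. \<forall>i. s i * x $ i > s i * far s i}" for s
  define \<S> where "\<S> = PiE (UNIV :: 'n set) (\<lambda>_. {1, -1 :: real})"
  have s1: "s i = 1 \<or> s i = -1" if "s \<in> \<S>" for s i using that by (auto simp: \<S>_def)
  have finS: "finite \<S>" unfolding \<S>_def by (intro finite_PiE) auto
  have opT: "open (T s)" for s
  proof -
    have "T s = (\<Inter>i. {x. s i * far s i < s i * x $ i})" unfolding T_def by blast
    moreover have "open \<dots>"
      by (intro open_INT ballI open_Collect_less continuous_intros) auto
    ultimately show ?thesis by simp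
  qed
  have side: "x \<in> box a b \<longleftrightarrow> (\<forall>i. s i * x $ i < s i * near s i)" if "s \<in> \<S>" "x \<in> T s" for s x
  proof -
    have "a $ i < x $ i \<and> x $ i < b $ i \<longleftrightarrow> s i * x $ i < s i * near s i" for i
      using s1[OF that(1), of i] that(2) unfolding T_def near_def far_def
      by (auto dest!: spec[of _ i])
    then show ?thesis by (simp add: mem_box_cart)
  qed
  have piece: "lipschitz_piece D (frontier D \<inter> T s)" if s: "s \<in> \<S>" for s
  proof -
    let ?d = "sqrt (CARD('n))"
    define e where "e = (\<chi> i. - s i / ?d)"
    have d: "?d > 0" by simp
    have "norm e = 1"
    proof -
      have "(e $ i)\<^sup>2 = 1 / CARD('n)" for i using s1[OF s, of i] by (auto simp: e_def power_divide)
      then have "(norm e)\<^sup>2 = 1" by (simp add: norm_vec_def L2_set_def sum_nonneg)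
      then have "norm e = 1 \<or> norm e = -1" by (simp add: power2_eq_1_iff)
      then show ?thesis using norm_ge_zero[of e] by linarith
    qed
    have ss: "s i * s i = 1" for i using s1[OF s, of i] by auto
    \<comment> \<open>Moving along the diagonal \<open>e\<close> shifts all
      \<open>s i * y $ i\<close> equally, and the factor \<open>?d\<close> normalises this shift to
      the height \<open>y \<bullet> e\<close>.\<close>
    have eq: "?d * (s i * (y - (y \<bullet> e) *\<^sub>R e) $ i - s i * near s i) = ?d * (s i * y $ i - s i * near s i) + y \<bullet> e" for y i
    proof -
      have k: "?d * (s i * e $ i) = -1" using d by (simp add: e_def ss)
      have "?d * (s i * (y - (y \<bullet> e) *\<^sub>R e) $ i - s i * near s i) =
          ?d * (s i * y $ i - s i * near s i) - (?d * (s i * e $ i)) * (y \<bullet> e)"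
        by (simp add: algebra_simps)
      then show ?thesis unfolding k by simp
    qed
    have above: "y \<in> above_graph e (box_graph s (near s)) \<longleftrightarrow> (\<forall>i. s i * y $ i < s i * near s i)" for y
      unfolding above_graph_def mem_Collect_eq box_graph_less_iff eq
      using d by (simp add: mult_less_0_iff)
    have "frontier D \<inter> T s \<subseteq> lipschitz_graph e (box_graph s (near s))"
    proof
      fix x assume x: "x \<in> frontier D \<inter> T s"
      define v where "v = x - (x \<bullet> e) *\<^sub>R e"
      have "v \<bullet> e = 0" using \<open>norm e = 1\<close> by (simp add: v_def inner_diff_left norm_eq_1)
      moreover have "box_graph s (near s) v = x \<bullet> e"
      proof -
        have le: "s i * x $ i - s i * near s i \<le> 0" for i
          using x s1[OF s, of i] unfolding F near_def by (auto simp: mem_box_cart)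
        have "x \<notin> box a b" using x F by blast
        then obtain i where i: "\<not> s i * x $ i < s i * near s i" using side[OF s, of x] x by blast
        with le[of i] have "s i * x $ i - s i * near s i = 0" by linarith
        then have ge: "?d * (s i * v $ i - s i * near s i) = x \<bullet> e" unfolding v_def eq by simp
        show ?thesis unfolding box_graph_def
        proof (rule Max_eqI)
          show "x \<bullet> e \<in> range (\<lambda>i. ?d * (s i * v $ i - s i * near s i))" by (rule range_eqI) (rule ge[symmetric])
          fix t assume "t \<in> range (\<lambda>i. ?d * (s i * v $ i - s i * near s i))"
          then obtain j where "t = ?d * (s j * v $ j - s j * near s j)" by (rule rangeE)
          then show "t \<le> x \<bullet> e" unfolding v_def eq using le[of j] d by (simp add: mult_nonneg_nonpos)
        qed simp
      qed
      moreover have "x = v + (x \<bullet> e) *\<^sub>R e" by (simp add: v_def)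
      ultimately have "x = v + box_graph s (near s) v *\<^sub>R e \<and> v \<bullet> e = 0" by metis
      then show "x \<in> lipschitz_graph e (box_graph s (near s))" unfolding lipschitz_graph_def by blast
    qed
    moreover have "\<forall>x\<in>frontier D \<inter> T s. \<exists>\<epsilon>>0. \<forall>y\<in>ball x \<epsilon> - frontier D.
        y \<in> D \<longleftrightarrow> y \<in> above_graph e (box_graph s (near s))"
    proof
      fix x assume "x \<in> frontier D \<inter> T s"
      then obtain \<epsilon> where \<epsilon>: "\<epsilon> > 0" "ball x \<epsilon> \<subseteq> T s" using opT[of s] unfolding open_contains_ball by blast
      have "y \<in> D \<longleftrightarrow> y \<in> above_graph e (box_graph s (near s))" if y: "y \<in> ball x \<epsilon> - frontier D" for y
      proof -
        have "y \<in> D \<longleftrightarrow> y \<in> box a b" using y D(1,2) unfolding F by blast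
        then show ?thesis using side[OF s, of y] y \<epsilon>(2) above by blast
      qed
      then show "\<exists>\<epsilon>>0. \<forall>y\<in>ball x \<epsilon> - frontier D. y \<in> D \<longleftrightarrow> y \<in> above_graph e (box_graph s (near s))"
        using \<epsilon>(1) by blast
    qed
    moreover have "openin (top_of_set (frontier D)) (frontier D \<inter> T s)"
      using opT by (rule openin_open_Int)
    moreover have "?d-lipschitz_on {v. v \<bullet> e = 0} (box_graph s (near s))"
      using s1[OF s] by (intro lipschitz_on_box_graph) (metis abs_minus_cancel abs_one)
    ultimately show ?thesis
      unfolding lipschitz_piece_def using \<open>norm e = 1\<close>
      by (intro conjI exI[of _ e] exI[of _ "box_graph s (near s)"] exI[of _ ?d])
  qed
  have cover: "frontier D = \<Union>((\<lambda>s. frontier D \<inter> T s) ` \<S>)"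
  proof (intro antisym subsetI)
    fix x assume x: "x \<in> frontier D"
    \<comment> \<open>Coordinates above \<open>a\<close> avoid the face at \<open>a\<close>; the
      others equal \<open>a\<close> and avoid the face at \<open>b\<close>. So \<open>x\<close>
      stays off all faces through the far corner of this choice.\<close>
    let ?s = "\<lambda>i. if x $ i > a $ i then 1 else -1 :: real"
    have "?s \<in> \<S>" by (auto simp: \<S>_def)
    moreover have "x \<in> T ?s"
      unfolding T_def far_def
    proof (rule CollectI, rule allI)
      fix i
      have "a $ i \<le> x $ i" using x unfolding F by (simp add: mem_box_cart)
      then show "?s i * (if ?s i = 1 then a $ i else b $ i) < ?s i * x $ i" using ab[of i] by auto
    qed
    ultimately show "x \<in> \<Union>((\<lambda>s. frontier D \<inter> T s) ` \<S>)" using x by blast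
  qed blast
  have "\<exists>\<U>. finite \<U> \<and> frontier D = \<Union>\<U> \<and> (\<forall>U\<in>\<U>. lipschitz_piece D U)"
    using finS cover piece by (intro exI[of _ "(\<lambda>s. frontier D \<inter> T s) ` \<S>"]) blast
  moreover have "bounded D" using D(2) bounded_cbox bounded_subset by blast
  moreover have "D \<noteq> {}" using ne D(1) by blast
  ultimately show ?thesis using D(3) unfolding lipschitz_sets_def by blast
qed

section \<open>Half-open cubes as test domains\<close>

lemma cube_lipschitz: "s > 0 \<Longrightarrow> cube a s \<in> lipschitz_sets"
  by (rule lipschitz_sets_box[OF _ box_subset_cube cube_subset_cbox cube_borel]) simp

lemma cube_semi_open: "s > 0 \<Longrightarrow> semi_open_rectangle (cube a s)"
  unfolding semi_open_rectangle_def cube_def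
  by (intro exI[of _ a] exI[of _ "a + (\<chi> i. s)"]) simp

lemma cube_rectilinear: "s > 0 \<Longrightarrow> rectilinear_cube (cube a s)"
proof -
  assume "s > 0"
  moreover have "is_interval (cube a s)"
    unfolding is_interval_def cube_def
    by (auto simp: Basis_vec_def inner_axis) (smt (verit))+
  ultimately show ?thesis
    unfolding rectilinear_cube_def using box_subset_cube[of a s] cube_subset_cbox[of a s] by blast
qed

lemma diameter_cube:
  fixes a :: "real ^ 'n" and s :: real
  assumes "s > 0"
  shows "diameter (cube a s) \<le> CARD('n) * s"
proof -
  have "norm (x - y) \<le> CARD('n) * s" if xy: "x \<in> cube a s" "y \<in> cube a s" for x y
  proof -
    have "norm (x - y) \<le> (\<Sum>i\<in>UNIV. \<bar>(x - y) $ i\<bar>)" by (rule norm_le_l1_cart)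
    also have "\<dots> \<le> (\<Sum>i\<in>(UNIV :: 'n set). s)"
    proof (rule sum_mono)
      fix i show "\<bar>(x - y) $ i\<bar> \<le> s"
        using xy[unfolded cube_def mem_Collect_eq, THEN spec, of i]
        unfolding vector_minus_component abs_le_iff by linarith
    qed
    finally show ?thesis by simp
  qed
  then show ?thesis using assms by (intro diameter_le) auto
qed

section \<open>Near additivity over cells\<close>

definition grid :: "nat \<Rightarrow> ('n \<Rightarrow> int) set" where
  "grid m = PiE UNIV (\<lambda>_. {0..<int m})"

definition subcube :: "real ^ 'n \<Rightarrow> real \<Rightarrow> ('n \<Rightarrow> int) \<Rightarrow> (real ^ 'n) set" where
  "subcube a s z = cube (a + lattice_point s z) s"

lemma mem_grid: "z \<in> grid m \<longleftrightarrow> (\<forall>i. 0 \<le> z i \<and> z i < int m)"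
  by (auto simp: grid_def)

lemma finite_grid [simp]: "finite (grid m :: ('n::finite \<Rightarrow> int) set)"
  unfolding grid_def by (intro finite_PiE) auto

lemma card_grid: "card (grid m :: ('n::finite \<Rightarrow> int) set) = m ^ CARD('n)"
  unfolding grid_def by (subst card_PiE) auto

lemma mem_subcube_iff:
  assumes "s > 0" shows "x \<in> subcube a s z \<longleftrightarrow> z = cell_index s (x - a)"
proof -
  have "x \<in> subcube a s z \<longleftrightarrow> x - a \<in> cell s z"
    by (simp add: subcube_def cell_def cube_def algebra_simps)
  then show ?thesis using mem_cell_iff[OF assms] by simp
qed

lemma cube_eq_UN_subcubes:
  assumes "s > 0" shows "cube a (real m * s) = (\<Union>z\<in>grid m. subcube a s z)"
proof (rule set_eqI)
  fix x
  have "x \<in> cube a (real m * s) \<longleftrightarrow> (\<forall>i. 0 \<le> (x - a) $ i / s \<and> (x - a) $ i / s < real m)"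
    using assms by (auto simp: cube_def field_simps)
  also have "\<dots> \<longleftrightarrow> cell_index s (x - a) \<in> grid m"
    by (simp add: mem_grid cell_index_def floor_less_iff)
  also have "\<dots> \<longleftrightarrow> x \<in> (\<Union>z\<in>grid m. subcube a s z)"
    by (simp add: mem_subcube_iff[OF assms])
  finally show "x \<in> cube a (real m * s) \<longleftrightarrow> x \<in> (\<Union>z\<in>grid m. subcube a s z)" .
qed

lemma disjoint_subcubes: "s > 0 \<Longrightarrow> z \<noteq> z' \<Longrightarrow> subcube a s z \<inter> subcube a s z' = {}"
  by (auto simp: mem_subcube_iff)

lemma corner_mem_cube: "s > 0 \<Longrightarrow> a \<in> cube a s"
  by (simp add: cube_def)

lemma inj_subcube: "s > 0 \<Longrightarrow> inj (subcube a s)"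
  using disjoint_subcubes corner_mem_cube unfolding subcube_def by (intro injI) blast

lemma subcube_subcube:
  "subcube (a + lattice_point (real N * s) b) s z = subcube a s (\<lambda>i. int N * b i + z i)"
proof -
  have "lattice_point (real N * s) b + lattice_point s z = lattice_point s (\<lambda>i. int N * b i + z i)"
    by (simp add: lattice_point_def vec_eq_iff algebra_simps)
  then show ?thesis unfolding subcube_def add.assoc by (rule arg_cong)
qed

text \<open>Division with remainder by \<open>N\<close> in every coordinate: number of the block and
  position in the block.\<close>

lemma sum_grid_mult:
  fixes f :: "('n::finite \<Rightarrow> int) \<Rightarrow> real"
  assumes "N > 0"
  shows "(\<Sum>u\<in>grid (m * N). f u) = (\<Sum>b\<in>grid m. \<Sum>z\<in>grid N. f (\<lambda>i. int N * b i + z i))"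
proof -
  have "(\<Sum>b\<in>grid m. \<Sum>z\<in>grid N. f (\<lambda>i. int N * b i + z i)) =
      (\<Sum>(b, z)\<in>grid m \<times> grid N. f (\<lambda>i. int N * b i + z i))"
    by (rule sum.cartesian_product)
  also have "\<dots> = (\<Sum>u\<in>grid (m * N). f u)"
  proof (rule sum.reindex_bij_witness[where i = "\<lambda>u. (\<lambda>i. u i div int N, \<lambda>i. u i mod int N)"
        and j = "\<lambda>(b, z) i. int N * b i + z i"])
    fix u :: "'n \<Rightarrow> int"
    assume u: "u \<in> grid (m * N)"
    have "u i div int N < int m" for i
    proof -
      have "u i div int N * int N \<le> u i"
        using div_mult_mod_eq[of "u i" "int N"] assms pos_mod_sign[of "int N" "u i"] by linarith
      also have "\<dots> < int m * int N" using u by (simp add: mem_grid)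
      finally show ?thesis using assms by (simp add: mult_less_cancel_right)
    qed
    then show "(\<lambda>i. u i div int N, \<lambda>i. u i mod int N) \<in> grid m \<times> grid N"
      using u assms by (auto simp: mem_grid pos_imp_zdiv_nonneg_iff)
  next
    fix u :: "('n \<Rightarrow> int) \<times> ('n \<Rightarrow> int)"
    assume "u \<in> grid m \<times> grid N"
    then obtain b z where u: "u = (b, z)" "b \<in> grid m" "z \<in> grid N" by blast
    have bz: "0 \<le> b i" "b i < int m" "0 \<le> z i" "z i < int N" for i using u by (auto simp: mem_grid)
    have "int N * b i + z i < int (m * N)" for i
    proof -
      have "int N * b i + z i < int N * (b i + 1)" using bz(4)[of i] by (simp add: algebra_simps)
      also have "\<dots> \<le> int N * int m" using bz(2)[of i] by (intro mult_left_mono) auto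
      finally show ?thesis by (simp add: mult.commute)
    qed
    then show "(case u of (b, z) \<Rightarrow> \<lambda>i. int N * b i + z i) \<in> grid (m * N)"
      using bz by (simp add: u(1) mem_grid)
    show "(\<lambda>i. (case u of (b, z) \<Rightarrow> \<lambda>i. int N * b i + z i) i div int N,
          \<lambda>i. (case u of (b, z) \<Rightarrow> \<lambda>i. int N * b i + z i) i mod int N) = u"
      using bz assms by (simp add: u(1) fun_eq_iff)
  qed (auto simp: fun_eq_iff)
  finally show ?thesis ..
qed

text \<open>Restricted to \<open>s \<ge> 1\<close>, since a tiny cube around a point violates every
  bound proportional to the volume.\<close>

definition bounded_density :: "real \<Rightarrow> (real ^ 'n) set \<Rightarrow> bool" where
  "bounded_density K \<zeta> \<longleftrightarrow> locally_finite \<zeta> \<and>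
     (\<forall>a s. s \<ge> 1 \<longrightarrow> real (card (\<zeta> \<inter> cube a s)) \<le> K * s ^ CARD('n))"

lemma bounded_density_subset:
  assumes "bounded_density K \<zeta>" "\<zeta>' \<subseteq> \<zeta>" shows "bounded_density K \<zeta>'"
  unfolding bounded_density_def
proof (intro conjI allI impI)
  have lf: "locally_finite \<zeta>" using assms(1) by (simp add: bounded_density_def)
  show "locally_finite \<zeta>'" by (rule locally_finite_subset[OF lf assms(2)])
  fix a :: "(real, 'a) vec" and s :: real assume "s \<ge> 1"
  have "card (\<zeta>' \<inter> cube a s) \<le> card (\<zeta> \<inter> cube a s)"
    using assms(2) by (intro card_mono finite_locally_finite_Int[OF lf]) auto
  moreover have "real (card (\<zeta> \<inter> cube a s)) \<le> K * s ^ CARD('a)"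
    using assms(1) \<open>s \<ge> 1\<close> by (simp add: bounded_density_def)
  ultimately show "real (card (\<zeta>' \<inter> cube a s)) \<le> K * s ^ CARD('a)" by linarith
qed

lemma locally_finite_Un: "locally_finite V \<Longrightarrow> locally_finite W \<Longrightarrow> locally_finite (V \<union> W)"
  unfolding locally_finite_def Int_Un_distrib2 by blast

lemma locally_finite_empty [simp]: "locally_finite {}"
  by (simp add: locally_finite_def)

locale functionals =
  fixes d :: nat and p :: real and S T :: "'n::{finite,linorder} functional"
  assumes d_def: "d = CARD('n)"
    and p: "1 \<le> p" "p < real d"
    and measS: "measurable_functional S" and tiS: "translation_invariant S"
    and smoothS: "smooth_of_order p S"
    and locS: "localized S" and subS: "almost_subadditive p S"
    and superT: "superadditive_on_rectangles T"
    and close: "pointwise_close p S T"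
begin

abbreviation "\<theta> \<equiv> (real d - p) / real d"

lemma bounded_densityD:
  fixes \<zeta> :: "(real, 'n) vec set"
  assumes "bounded_density K \<zeta>"
  shows "locally_finite \<zeta>" and "s \<ge> 1 \<Longrightarrow> real (card (\<zeta> \<inter> cube a s)) \<le> K * s ^ d"
  using assms by (auto simp: bounded_density_def d_def)

lemma card_grid_d: "card (grid m :: ('n \<Rightarrow> int) set) = m ^ d"
  by (simp add: card_grid d_def)

lemma d_pos [simp]: "d > 0"
  by (simp add: d_def)

text \<open>Localization lets \<open>S\<close> see only the trace, not the domain. An irregular
  domain may therefore be exchanged for a cube around it, and a cube for a subcube carrying all the
  points.\<close>

lemma S_cong:
  assumes "D \<in> lipschitz_sets" "D' \<in> lipschitz_sets" "locally_finite \<zeta>" "locally_finite \<zeta>'"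
    "\<zeta> \<inter> D = \<zeta>' \<inter> D'"
  shows "S D \<zeta> = S D' \<zeta>'"
proof -
  obtain S' where S': "\<forall>D\<in>lipschitz_sets. \<forall>\<zeta>. locally_finite \<zeta> \<longrightarrow> S D \<zeta> = S' (\<zeta> \<inter> D)"
    using locS unfolding localized_def by blast
  then have "S D \<zeta> = S' (\<zeta> \<inter> D)" "S D' \<zeta>' = S' (\<zeta>' \<inter> D')" using assms(1-4) by blast+
  then show ?thesis using assms(5) by simp
qed

text \<open>The value at the empty trace, the same for all domains. It is not normalised but carried
  along; per volume it contributes \<open>c\<^sub>0 / r ^ d\<close>, which is small for large
  cells.\<close>

definition "c\<^sub>0 = S (cube 0 1) {}"

lemma S_empty: "D \<in> lipschitz_sets \<Longrightarrow> locally_finite \<zeta> \<Longrightarrow> \<zeta> \<inter> D = {} \<Longrightarrow> S D \<zeta> = c\<^sub>0"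
  unfolding c\<^sub>0_def by (rule S_cong) (auto intro: cube_lipschitz)

lemma diameter_powr:
  assumes "s > 0" shows "diameter (cube a s :: (real, 'n) vec set) powr p \<le> real d powr p * s powr p"
proof -
  have "diameter (cube a s) powr p \<le> (real d * s) powr p"
    using diameter_cube[OF assms, of a, folded d_def] p diameter_ge_0[OF bounded_cube[of a s]] by (intro powr_mono2) auto
  then show ?thesis using assms by (simp add: powr_mult)
qed

text \<open>The exponents are balanced, \<open>p + d * \<theta> = d\<close>: at bounded density the
  smoothness error on a cube is exactly of the order of its volume.\<close>

lemma powr_combine:
  assumes "s > 0" "K \<ge> 0" shows "s powr p * (K * s ^ d) powr \<theta> = K powr \<theta> * s ^ d"
proof -
  have "(K * s ^ d) powr \<theta> = K powr \<theta> * (s powr real d) powr \<theta>"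
    using assms by (simp add: powr_mult powr_realpow)
  also have "(s powr real d) powr \<theta> = s powr (real d - p)" by (simp add: powr_powr)
  finally have "s powr p * (K * s ^ d) powr \<theta> = K powr \<theta> * (s powr p * s powr (real d - p))" by simp
  also have "s powr p * s powr (real d - p) = s ^ d" using assms by (simp flip: powr_add add: powr_realpow)
  finally show ?thesis .
qed

section \<open>Uniform estimates on cubes\<close>

lemma smooth_cube:
  obtains C where "C > 0" "\<And>a s \<zeta> \<zeta>'. s > 0 \<Longrightarrow> locally_finite \<zeta> \<Longrightarrow> locally_finite \<zeta>' \<Longrightarrow>
    \<bar>S (cube a s) (\<zeta> \<union> \<zeta>') - S (cube a s) \<zeta>\<bar> \<le> C * s powr p * real (card (\<zeta>' \<inter> cube a s)) powr \<theta>"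
proof -
  obtain C where C: "C > 0" "\<forall>D \<zeta>\<^sub>1 \<zeta>\<^sub>2. rectilinear_cube D \<longrightarrow> locally_finite \<zeta>\<^sub>1 \<longrightarrow> locally_finite \<zeta>\<^sub>2 \<longrightarrow>
        \<bar>S D (\<zeta>\<^sub>1 \<union> \<zeta>\<^sub>2) - S D \<zeta>\<^sub>1\<bar> \<le> C * diameter D powr p * real (card (\<zeta>\<^sub>2 \<inter> D)) powr \<theta>"
    using smoothS unfolding smooth_of_order_def d_def[symmetric] by (elim exE conjE) (rule that)
  show ?thesis
  proof (rule that[of "C * real d powr p"])
    show "C * real d powr p > 0" using C(1) by simp
    fix a :: "(real, 'n) vec" and s :: real and \<zeta> \<zeta>' :: "(real, 'n) vec set"
    assume s: "s > 0" and lf: "locally_finite \<zeta>" "locally_finite \<zeta>'"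
    have "\<bar>S (cube a s) (\<zeta> \<union> \<zeta>') - S (cube a s) \<zeta>\<bar> \<le>
        C * diameter (cube a s) powr p * real (card (\<zeta>' \<inter> cube a s)) powr \<theta>"
      using C(2) cube_rectilinear[OF s] lf by blast
    also have "\<dots> \<le> C * (real d powr p * s powr p) * real (card (\<zeta>' \<inter> cube a s)) powr \<theta>"
      using C(1) diameter_powr[OF s] by (intro mult_right_mono mult_left_mono) auto
    finally show "\<bar>S (cube a s) (\<zeta> \<union> \<zeta>') - S (cube a s) \<zeta>\<bar> \<le>
        C * real d powr p * s powr p * real (card (\<zeta>' \<inter> cube a s)) powr \<theta>" by (simp add: mult.assoc)
  qed
qed

lemma subadditive_cube:
  obtains C where "C > 0" "\<And>a s I (\<zeta> :: 'i \<Rightarrow> _). s > 0 \<Longrightarrow> finite I \<Longrightarrow> I \<noteq> {} \<Longrightarrow>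
    (\<And>i. i \<in> I \<Longrightarrow> locally_finite (\<zeta> i)) \<Longrightarrow>
    S (cube a s) (\<Union>i\<in>I. \<zeta> i) \<le> (\<Sum>i\<in>I. S (cube a s) (\<zeta> i)) + real (card I) * (C * s powr p)"
proof -
  obtain C where C: "C > 0" "\<forall>\<zeta>\<^sub>1 \<zeta>\<^sub>2. \<forall>D\<in>lipschitz_sets. locally_finite \<zeta>\<^sub>1 \<longrightarrow> locally_finite \<zeta>\<^sub>2 \<longrightarrow>
        S D (\<zeta>\<^sub>1 \<union> \<zeta>\<^sub>2) \<le> S D \<zeta>\<^sub>1 + S D \<zeta>\<^sub>2 + C * diameter D powr p"
    using subS unfolding almost_subadditive_def by (elim exE conjE) (rule that)
  let ?C = "C * real d powr p"
  show ?thesis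
  proof (rule that[of ?C])
    show "?C > 0" using C(1) by simp
    fix a :: "(real, 'n) vec" and s :: real and I and \<zeta> :: "'i \<Rightarrow> (real, 'n) vec set"
    assume s: "s > 0" and I: "finite I" "I \<noteq> {}" and lf: "\<And>i. i \<in> I \<Longrightarrow> locally_finite (\<zeta> i)"
    have "locally_finite (\<Union>i\<in>I. \<zeta> i) \<and>
      S (cube a s) (\<Union>i\<in>I. \<zeta> i) \<le> (\<Sum>i\<in>I. S (cube a s) (\<zeta> i)) + real (card I) * (?C * s powr p)"
      using I lf
    proof (induction I rule: finite_ne_induct)
      case (singleton x)
      then show ?case using C(1) by simp
    next
      case (insert x I)
      have l: "locally_finite (\<zeta> x)" "locally_finite (\<Union>i\<in>I. \<zeta> i)" using insert by auto
      have "S (cube a s) (\<zeta> x \<union> (\<Union>i\<in>I. \<zeta> i)) \<le>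
          S (cube a s) (\<zeta> x) + S (cube a s) (\<Union>i\<in>I. \<zeta> i) + C * diameter (cube a s) powr p"
        using C(2) cube_lipschitz[OF s] l by blast
      also have "C * diameter (cube a s) powr p \<le> ?C * s powr p"
        using diameter_powr[OF s, of a] C(1) by (simp add: mult.assoc)
      finally have "S (cube a s) (\<zeta> x \<union> (\<Union>i\<in>I. \<zeta> i)) \<le>
          S (cube a s) (\<zeta> x) + S (cube a s) (\<Union>i\<in>I. \<zeta> i) + ?C * s powr p" by simp
      moreover have "S (cube a s) (\<Union>i\<in>I. \<zeta> i) \<le> (\<Sum>i\<in>I. S (cube a s) (\<zeta> i)) + real (card I) * (?C * s powr p)"
        using insert by simp
      moreover have "real (card (insert x I)) * (?C * s powr p) = ?C * s powr p + real (card I) * (?C * s powr p)"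
        using insert by (simp add: distrib_right)
      moreover have "(\<Sum>i\<in>insert x I. S (cube a s) (\<zeta> i)) = S (cube a s) (\<zeta> x) + (\<Sum>i\<in>I. S (cube a s) (\<zeta> i))"
        using insert by simp
      ultimately show ?case using locally_finite_Un[OF l] by (simp only: UN_insert simp_thms)
    qed
    then show "S (cube a s) (\<Union>i\<in>I. \<zeta> i) \<le> (\<Sum>i\<in>I. S (cube a s) (\<zeta> i)) + real (card I) * (?C * s powr p)" by blast
  qed
qed

text \<open>Smoothness with empty first point set compares \<open>S\<close> with its value at the
  empty trace.\<close>

lemma S_bounded:
  assumes "K \<ge> 0"
  obtains C where "C > 0" "\<And>a s \<zeta>. s \<ge> 1 \<Longrightarrow> bounded_density K \<zeta> \<Longrightarrow> \<bar>S (cube a s) \<zeta> - c\<^sub>0\<bar> \<le> C * s ^ d"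
proof -
  obtain C where C: "C > 0" "\<And>a s \<zeta> \<zeta>'. s > 0 \<Longrightarrow> locally_finite \<zeta> \<Longrightarrow> locally_finite \<zeta>' \<Longrightarrow>
    \<bar>S (cube a s) (\<zeta> \<union> \<zeta>') - S (cube a s) \<zeta>\<bar> \<le> C * s powr p * real (card (\<zeta>' \<inter> cube a s)) powr \<theta>"
    by (fact smooth_cube)
  show ?thesis
  proof (rule that[of "C * K powr \<theta> + 1"])
    show "C * K powr \<theta> + 1 > 0" using C(1) by (intro add_nonneg_pos) auto
    fix a :: "(real, 'n) vec" and s :: real and \<zeta> :: "(real, 'n) vec set"
    assume s: "s \<ge> 1" and \<zeta>: "bounded_density K \<zeta>"
    have lf: "locally_finite \<zeta>" and card: "real (card (\<zeta> \<inter> cube a s)) \<le> K * s ^ d"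
      using bounded_densityD[OF \<zeta>] s by auto
    have "S (cube a s) {} = c\<^sub>0" using s by (intro S_empty cube_lipschitz) auto
    then have "\<bar>S (cube a s) \<zeta> - c\<^sub>0\<bar> \<le> C * s powr p * real (card (\<zeta> \<inter> cube a s)) powr \<theta>"
      using C(2)[of s "{}" \<zeta> a] s lf by simp
    also have "\<dots> \<le> C * s powr p * (K * s ^ d) powr \<theta>"
      using C(1) card p by (intro mult_left_mono powr_mono2) auto
    also have "\<dots> = C * K powr \<theta> * s ^ d"
      using powr_combine[of s K] s assms by (simp add: mult.assoc)
    also have "\<dots> \<le> (C * K powr \<theta> + 1) * s ^ d" using s by (simp add: distrib_right)
    finally show "\<bar>S (cube a s) \<zeta> - c\<^sub>0\<bar> \<le> (C * K powr \<theta> + 1) * s ^ d" .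
  qed
qed

text \<open>For large \<open>k\<close>, \<open>g k\<close> is a small multiple of
  \<open>k powr \<theta>\<close>; for the finitely many others it is bounded by \<open>G\<close>. At
  bounded density the first part yields a small multiple of the volume, the second one only the
  order \<open>s powr p\<close>.\<close>

lemma close_cube:
  assumes K: "K \<ge> 0" and \<epsilon>: "\<epsilon> > 0"
  shows "\<exists>s\<^sub>0\<ge>1. \<forall>s\<ge>s\<^sub>0. \<forall>a \<zeta>. bounded_density K \<zeta> \<longrightarrow> \<bar>S (cube a s) \<zeta> - T (cube a s) \<zeta>\<bar> \<le> \<epsilon> * s ^ d"
proof -
  obtain g :: "nat \<Rightarrow> real" where g: "\<forall>k. g k \<ge> 0"
    and lim: "(\<lambda>k. real k powr ((p - real d) / real d) * g k) \<longlonglongrightarrow> 0"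
    and cl: "\<forall>D \<zeta>. rectilinear_cube D \<longrightarrow> locally_finite \<zeta> \<longrightarrow>
           \<bar>S D \<zeta> - T D \<zeta>\<bar> \<le> diameter D powr p * g (card (\<zeta> \<inter> D))"
    using close unfolding pointwise_close_def d_def[symmetric] by (elim exE conjE) (rule that)
  define A where "A = real d powr p"
  have A: "A > 0" by (simp add: A_def)
  \<comment> \<open>Makes the leading part at most half of the allowed error; adding 1 to
    \<open>K powr \<theta>\<close> keeps the denominator positive when \<open>K = 0\<close>.\<close>
  define \<epsilon>' where "\<epsilon>' = \<epsilon> / (2 * A * (K powr \<theta> + 1))"
  have "2 * A * (K powr \<theta> + 1) > 0" using A by (intro mult_pos_pos add_nonneg_pos) auto
  then have \<epsilon>': "\<epsilon>' > 0" "A * (\<epsilon>' * (K powr \<theta> + 1)) = \<epsilon> / 2"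
    using \<epsilon> A by (auto simp: \<epsilon>'_def field_simps)
  obtain k0 where k0: "\<And>k. k \<ge> k0 \<Longrightarrow> real k powr ((p - real d) / real d) * g k < \<epsilon>'"
    using order_tendstoD(2)[OF lim \<epsilon>'(1)] unfolding eventually_sequentially by blast
  define G where "G = Max (insert 0 (g ` {..k0}))"
  have G: "G \<ge> 0" "k \<le> k0 \<Longrightarrow> g k \<le> G" for k
    unfolding G_def by (rule Max_ge; simp)+
  \<comment> \<open>One bound for all \<open>k\<close>, so that empty or sparsely filled large cubes
    need no separate treatment.\<close>
  have gb: "g k \<le> \<epsilon>' * real k powr \<theta> + G" for k
  proof (cases "k \<le> k0")
    case True then show ?thesis using G(2)[of k] \<epsilon>' by (simp add: add_increasing)
  next
    case False
    then have k: "real k > 0" by simp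
    have e: "(p - real d) / real d = - \<theta>" by (simp add: field_simps)
    have "g k = real k powr \<theta> * (real k powr ((p - real d) / real d) * g k)"
      unfolding e using k by (simp add: powr_minus)
    also have "\<dots> \<le> real k powr \<theta> * \<epsilon>'" using k0[of k] False by (intro mult_left_mono) auto
    finally show ?thesis using G(1) by (simp add: mult.commute)
  qed
  have "((\<lambda>s. A * G * s powr (p - real d)) \<longlongrightarrow> A * G * 0) at_top"
    using p by (intro tendsto_intros tendsto_neg_powr filterlim_ident) auto
  then have "eventually (\<lambda>s. A * G * s powr (p - real d) < \<epsilon> / 2) at_top"
    using \<epsilon> by (intro order_tendstoD(2)) auto
  then obtain s1 where s1: "\<And>s. s \<ge> s1 \<Longrightarrow> A * G * s powr (p - real d) < \<epsilon> / 2"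
    unfolding eventually_at_top_linorder by blast
  have "\<bar>S (cube a s) \<zeta> - T (cube a s) \<zeta>\<bar> \<le> \<epsilon> * s ^ d"
    if s: "s \<ge> max 1 s1" and \<zeta>: "bounded_density K \<zeta>" for s a \<zeta>
  proof -
    have s0: "s > 0" "s \<ge> 1" using s by auto
    have lf: "locally_finite \<zeta>" and card: "real (card (\<zeta> \<inter> cube a s)) \<le> K * s ^ d"
      using bounded_densityD[OF \<zeta>] s by auto
    have "\<bar>S (cube a s) \<zeta> - T (cube a s) \<zeta>\<bar> \<le> diameter (cube a s) powr p * g (card (\<zeta> \<inter> cube a s))"
      using cl cube_rectilinear[OF s0(1)] lf by blast
    also have "\<dots> \<le> (A * s powr p) * (\<epsilon>' * (K * s ^ d) powr \<theta> + G)"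
    proof (rule mult_mono)
      show "diameter (cube a s) powr p \<le> A * s powr p" unfolding A_def by (rule diameter_powr[OF s0(1)])
      have "g (card (\<zeta> \<inter> cube a s)) \<le> \<epsilon>' * real (card (\<zeta> \<inter> cube a s)) powr \<theta> + G" by (rule gb)
      also have "\<dots> \<le> \<epsilon>' * (K * s ^ d) powr \<theta> + G"
        using card p \<epsilon>'(1) by (intro add_right_mono mult_left_mono powr_mono2) auto
      finally show "g (card (\<zeta> \<inter> cube a s)) \<le> \<epsilon>' * (K * s ^ d) powr \<theta> + G" .
      show "0 \<le> A * s powr p" using A by simp
      show "0 \<le> g (card (\<zeta> \<inter> cube a s))" using g by simp
    qed
    also have "\<dots> = A * \<epsilon>' * (s powr p * (K * s ^ d) powr \<theta>) + A * G * s powr p"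
      by (simp add: algebra_simps)
    also have "s powr p * (K * s ^ d) powr \<theta> = K powr \<theta> * s ^ d" by (rule powr_combine[OF s0(1) K])
    also have "s powr p = s powr (p - real d) * s ^ d"
      using s0 by (simp add: powr_diff powr_realpow)
    also have "A * \<epsilon>' * (K powr \<theta> * s ^ d) + A * G * (s powr (p - real d) * s ^ d) =
        (A * \<epsilon>' * K powr \<theta> + A * G * s powr (p - real d)) * s ^ d" by (simp add: algebra_simps)
    also have "\<dots> \<le> (\<epsilon> / 2 + \<epsilon> / 2) * s ^ d"
    proof (intro mult_right_mono add_mono)
      have "A * \<epsilon>' * K powr \<theta> \<le> A * (\<epsilon>' * (K powr \<theta> + 1))" using A \<epsilon>'(1) by (simp add: algebra_simps)
      then show "A * \<epsilon>' * K powr \<theta> \<le> \<epsilon> / 2" using \<epsilon>'(2) by simp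
      show "A * G * s powr (p - real d) \<le> \<epsilon> / 2" using s1[of s] s by simp
      show "0 \<le> s ^ d" using s0 by simp
    qed
    finally show ?thesis by simp
  qed
  then show ?thesis by (intro exI[of _ "max 1 s1"]) auto
qed

section \<open>Comparison of a cube with its subcubes\<close>

lemma subcube_union: "s > 0 \<Longrightarrow> \<zeta> \<inter> cube a (real m * s) = (\<Union>z\<in>grid m. \<zeta> \<inter> subcube a s z)"
  unfolding cube_eq_UN_subcubes by blast

lemma grid_nonempty: "m > 0 \<Longrightarrow> (grid m :: ('n \<Rightarrow> int) set) \<noteq> {}"
proof -
  assume "m > 0"
  then have "(\<lambda>_. 0) \<in> (grid m :: ('n \<Rightarrow> int) set)" by (simp add: mem_grid)
  then show ?thesis by blast
qed

text \<open>Bisecting repeatedly keeps the errors summable, because \<open>p < d\<close>; the error after \<open>k\<close> steps is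
  written as a telescoping difference.\<close>

lemma dyadic_subadditive:
  obtains B where "B \<ge> 0" "\<And>k a s \<zeta>. s > 0 \<Longrightarrow> locally_finite \<zeta> \<Longrightarrow>
    S (cube a (2 ^ k * s)) \<zeta> \<le> (\<Sum>z\<in>grid (2 ^ k). S (subcube a s z) \<zeta>) + B * s powr p * (2 ^ k) ^ d"
proof -
  obtain C where C: "C > 0" "\<And>a s I (\<zeta> :: ('n \<Rightarrow> int) \<Rightarrow> _). s > 0 \<Longrightarrow> finite I \<Longrightarrow> I \<noteq> {} \<Longrightarrow>
    (\<And>i. i \<in> I \<Longrightarrow> locally_finite (\<zeta> i)) \<Longrightarrow>
    S (cube a s) (\<Union>i\<in>I. \<zeta> i) \<le> (\<Sum>i\<in>I. S (cube a s) (\<zeta> i)) + real (card I) * (C * s powr p)"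
    by (fact subadditive_cube)
  define \<delta> where "\<delta> = 2 ^ d - 2 powr p"
  have \<delta>: "\<delta> > 0" using p powr_less_mono[of p "real d" 2] by (simp add: \<delta>_def powr_realpow)
  \<comment> \<open>Solves \<open>B * (2 ^ d - 2 powr p) = 2 ^ d * C * 2 powr p\<close>, so that the
    new error of one bisection is exactly the increment of the telescoping expression.\<close>
  define B where "B = 2 ^ d * C * 2 powr p / \<delta>"
  have B: "B \<ge> 0" "B * \<delta> = 2 ^ d * C * 2 powr p" using C(1) \<delta> by (simp_all add: B_def)
  have main: "S (cube a (2 ^ k * s)) \<zeta> \<le> (\<Sum>z\<in>grid (2 ^ k). S (subcube a s z) \<zeta>) +
      B * s powr p * ((2 ^ k) ^ d - (2 ^ k) powr p)"
    if s: "s > 0" and lf: "locally_finite \<zeta>" for k a s \<zeta>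
  proof (induction k arbitrary: a)
    case 0
    have "z \<in> grid (Suc 0) \<longleftrightarrow> z \<in> {\<lambda>_. 0}" for z :: "'n \<Rightarrow> int"
      unfolding mem_grid singleton_iff fun_eq_iff by (intro iff_allI) auto
    then have "grid (Suc 0) = {\<lambda>_ :: 'n. 0 :: int}" by blast
    then show ?case by (simp add: subcube_def lattice_point_def zero_vec_def[symmetric])
  next
    case (Suc k)
    let ?N = "2 ^ k :: nat"
    let ?Q = "cube a (2 ^ Suc k * s)"
    have Ns: "real ?N * s > 0" using s by simp
    have Q: "?Q = cube a (real 2 * (real ?N * s))" by (simp add: mult.assoc)
    have lQ: "?Q \<in> lipschitz_sets" using s by (intro cube_lipschitz) simp
    have lf': "locally_finite (\<zeta> \<inter> X)" for X using lf by (rule locally_finite_subset) blast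
    \<comment> \<open>Subadditivity cuts the point set while the domain stays fixed. Localization
      converts this into a statement on subdomains: each piece of the point set lies in one subcube,
      to which the domain may shrink.\<close>
    have "S ?Q \<zeta> = S ?Q (\<zeta> \<inter> ?Q)" by (rule S_cong[OF lQ lQ lf lf']) blast
    also have "\<zeta> \<inter> ?Q = (\<Union>b\<in>grid 2. \<zeta> \<inter> subcube a (real ?N * s) b)"
      unfolding Q by (rule subcube_union[OF Ns])
    finally have "S ?Q \<zeta> = S ?Q (\<Union>b\<in>grid 2. \<zeta> \<inter> subcube a (real ?N * s) b)" .
    also have "\<dots> \<le> (\<Sum>b\<in>grid 2. S ?Q (\<zeta> \<inter> subcube a (real ?N * s) b)) +
        real (card (grid 2 :: ('n \<Rightarrow> int) set)) * (C * (2 ^ Suc k * s) powr p)"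
      using s lf' grid_nonempty[of 2] by (intro C(2)) auto
    also have "(\<Sum>b\<in>grid 2. S ?Q (\<zeta> \<inter> subcube a (real ?N * s) b)) = (\<Sum>b\<in>grid 2. S (subcube a (real ?N * s) b) \<zeta>)"
    proof (rule sum.cong[OF refl])
      fix b :: "'n \<Rightarrow> int" assume b: "b \<in> grid 2"
      have "subcube a (real ?N * s) b \<subseteq> ?Q" unfolding Q cube_eq_UN_subcubes[OF Ns] using b by blast
      moreover have "subcube a (real ?N * s) b \<in> lipschitz_sets"
        unfolding subcube_def by (rule cube_lipschitz[OF Ns])
      ultimately show "S ?Q (\<zeta> \<inter> subcube a (real ?N * s) b) = S (subcube a (real ?N * s) b) \<zeta>"
        using lQ lf lf' by (intro S_cong) auto
    qed
    also have "\<dots> \<le> (\<Sum>b\<in>grid 2. (\<Sum>z\<in>grid ?N. S (subcube a s (\<lambda>i. int ?N * b i + z i)) \<zeta>) +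
        B * s powr p * ((2 ^ k) ^ d - (2 ^ k) powr p))"
    proof (rule sum_mono)
      fix b :: "'n \<Rightarrow> int"
      have "S (cube (a + lattice_point (real ?N * s) b) (2 ^ k * s)) \<zeta> \<le>
          (\<Sum>z\<in>grid ?N. S (subcube (a + lattice_point (real ?N * s) b) s z) \<zeta>) +
          B * s powr p * ((2 ^ k) ^ d - (2 ^ k) powr p)" by (rule Suc.IH)
      then show "S (subcube a (real ?N * s) b) \<zeta> \<le> (\<Sum>z\<in>grid ?N. S (subcube a s (\<lambda>i. int ?N * b i + z i)) \<zeta>) +
          B * s powr p * ((2 ^ k) ^ d - (2 ^ k) powr p)"
        unfolding subcube_subcube by (simp add: subcube_def)
    qed
    also have "\<dots> = (\<Sum>z\<in>grid (2 * ?N). S (subcube a s z) \<zeta>) +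
        2 ^ d * (B * s powr p * ((2 ^ k) ^ d - (2 ^ k) powr p))"
      by (simp add: sum.distrib card_grid_d sum_grid_mult)
    finally have "S ?Q \<zeta> \<le> (\<Sum>z\<in>grid (2 * ?N). S (subcube a s z) \<zeta>) +
        (2 ^ d * (B * s powr p * ((2 ^ k) ^ d - (2 ^ k) powr p)) + 2 ^ d * (C * (2 ^ Suc k * s) powr p))"
      by (simp add: card_grid_d)
    also have "2 ^ d * (B * s powr p * ((2 ^ k) ^ d - (2 ^ k) powr p)) + 2 ^ d * (C * (2 ^ Suc k * s) powr p) =
        B * s powr p * ((2 ^ Suc k) ^ d - (2 ^ Suc k) powr p)"
    proof -
      have e1: "(2 ^ Suc k * s) powr p = 2 powr p * (2 ^ k) powr p * s powr p"
        using s by (simp add: powr_mult)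
      have e2: "((2::real) ^ Suc k) powr p = 2 powr p * (2 ^ k) powr p" by (simp add: powr_mult)
      have e3: "((2::real) ^ Suc k) ^ d = 2 ^ d * (2 ^ k) ^ d" by (simp add: power_mult_distrib)
      have "2 ^ d * (C * (2 ^ Suc k * s) powr p) = (B * \<delta>) * ((2 ^ k) powr p * s powr p)"
        unfolding e1 B(2) by (simp add: algebra_simps)
      also have "\<dots> = B * s powr p * (2 ^ d * (2 ^ k) powr p - 2 powr p * (2 ^ k) powr p)"
        by (simp add: \<delta>_def algebra_simps)
      finally show ?thesis unfolding e2 e3 by (simp add: algebra_simps)
    qed
    finally show ?case by simp
  qed
  show ?thesis
  proof (rule that[OF B(1)])
    fix k and a :: "(real, 'n) vec" and s :: real and \<zeta> :: "(real, 'n) vec set"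
    assume h: "s > 0" "locally_finite \<zeta>"
    have "B * s powr p * ((2 ^ k) ^ d - (2 ^ k) powr p) \<le> B * s powr p * (2 ^ k) ^ d"
      using B(1) by (intro mult_left_mono) auto
    then show "S (cube a (2 ^ k * s)) \<zeta> \<le> (\<Sum>z\<in>grid (2 ^ k). S (subcube a s z) \<zeta>) + B * s powr p * (2 ^ k) ^ d"
      using main[OF h, where k = k and a = a] by linarith
  qed
qed

text \<open>For the lower bound closeness is paid twice with half of \<epsilon>: in the cells, where
  the errors add up to the volume of the large cube, and once on the large cube itself. The
  threshold for \<open>s\<close> is uniform in the number \<open>k\<close> of bisections.\<close>

lemma nearly_additive:
  assumes K: "K \<ge> 0" and \<epsilon>: "\<epsilon> > 0"
  shows "\<exists>s\<^sub>0\<ge>1. \<forall>s\<ge>s\<^sub>0. \<forall>k a \<zeta>. bounded_density K \<zeta> \<longrightarrow>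
    \<bar>S (cube a (2 ^ k * s)) \<zeta> - (\<Sum>z\<in>grid (2 ^ k). S (subcube a s z) \<zeta>)\<bar> \<le> \<epsilon> * (2 ^ k * s) ^ d"
proof -
  obtain B where B: "B \<ge> 0" "\<And>k a s \<zeta>. s > 0 \<Longrightarrow> locally_finite \<zeta> \<Longrightarrow>
    S (cube a (2 ^ k * s)) \<zeta> \<le> (\<Sum>z\<in>grid (2 ^ k). S (subcube a s z) \<zeta>) + B * s powr p * (2 ^ k) ^ d"
    by (fact dyadic_subadditive)
  obtain s1 where s1: "s1 \<ge> 1" "\<And>s a \<zeta>. s \<ge> s1 \<Longrightarrow> bounded_density K \<zeta> \<Longrightarrow>
      \<bar>S (cube a s) \<zeta> - T (cube a s) \<zeta>\<bar> \<le> \<epsilon> / 2 * s ^ d"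
    using close_cube[OF K half_gt_zero[OF \<epsilon>]] by blast
  have "((\<lambda>s. B * s powr (p - real d)) \<longlongrightarrow> B * 0) at_top"
    using p by (intro tendsto_intros tendsto_neg_powr filterlim_ident) auto
  then have "eventually (\<lambda>s. B * s powr (p - real d) < \<epsilon>) at_top"
    using \<epsilon> by (intro order_tendstoD(2)) auto
  then obtain s2 where s2: "\<And>s. s \<ge> s2 \<Longrightarrow> B * s powr (p - real d) < \<epsilon>"
    unfolding eventually_at_top_linorder by blast
  have "\<bar>S (cube a (2 ^ k * s)) \<zeta> - (\<Sum>z\<in>grid (2 ^ k). S (subcube a s z) \<zeta>)\<bar> \<le> \<epsilon> * (2 ^ k * s) ^ d"
    if s: "s \<ge> max s1 s2" and \<zeta>: "bounded_density K \<zeta>" for s k a \<zeta>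
  proof -
    have s0: "s > 0" "s \<ge> s1" "s \<ge> s2" using s s1(1) by auto
    have lf: "locally_finite \<zeta>" by (rule bounded_densityD(1)[OF \<zeta>])
    let ?N = "2 ^ k :: nat"
    let ?Q = "cube a (2 ^ k * s)"
    have Q: "?Q = cube a (real ?N * s)" by simp
    have up: "S ?Q \<zeta> \<le> (\<Sum>z\<in>grid (2 ^ k). S (subcube a s z) \<zeta>) + \<epsilon> * (2 ^ k * s) ^ d"
    proof -
      have "B * s powr p * (2 ^ k) ^ d = B * s powr (p - real d) * (2 ^ k * s) ^ d"
        using s0 by (simp add: powr_diff powr_realpow power_mult_distrib)
      also have "\<dots> \<le> \<epsilon> * (2 ^ k * s) ^ d"
        using s2[OF s0(3)] s0(1) by (intro mult_right_mono) auto
      finally show ?thesis using B(2)[OF s0(1) lf, of a k] by linarith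
    qed
    have "(\<Sum>z\<in>grid ?N. T (subcube a s z) \<zeta>) \<le> T ?Q \<zeta>"
    proof -
      let ?\<D> = "subcube a s ` grid ?N"
      have part: "partition_on ?Q ?\<D>"
      proof (rule partition_onI)
        show "\<Union> ?\<D> = ?Q" unfolding Q cube_eq_UN_subcubes[OF s0(1)] by simp
        show "disjnt X Y" if XY: "X \<in> ?\<D>" "Y \<in> ?\<D>" "X \<noteq> Y" for X Y
        proof -
          obtain z z' where "X = subcube a s z" "Y = subcube a s z'" using XY by blast
          then show ?thesis using disjoint_subcubes[OF s0(1)] XY(3) unfolding disjnt_def by metis
        qed
        show "{} \<notin> ?\<D>" using corner_mem_cube[OF s0(1)] unfolding subcube_def by blast
      qed
      have so: "semi_open_rectangle X" if "X \<in> ?\<D>" for X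
        using that cube_semi_open[OF s0(1)] unfolding subcube_def by blast
      have "semi_open_rectangle ?Q" using s0 by (intro cube_semi_open) simp
      from superT[unfolded superadditive_on_rectangles_def, rule_format, OF this _ part so lf]
      have "(\<Sum>X\<in>?\<D>. T X \<zeta>) \<le> T ?Q \<zeta>" by simp
      moreover have "inj_on (subcube a s) (grid ?N)"
        using inj_subcube[OF s0(1), of a] by (rule inj_on_subset) simp
      ultimately show ?thesis by (simp add: sum.reindex)
    qed
    moreover have "S (subcube a s z) \<zeta> - \<epsilon> / 2 * s ^ d \<le> T (subcube a s z) \<zeta>" for z
      using s1(2)[OF s0(2) \<zeta>, of "a + lattice_point s z"] unfolding subcube_def abs_le_iff by linarith
    then have "(\<Sum>z\<in>grid ?N. S (subcube a s z) \<zeta> - \<epsilon> / 2 * s ^ d) \<le> (\<Sum>z\<in>grid ?N. T (subcube a s z) \<zeta>)"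
      by (intro sum_mono)
    moreover have "(\<Sum>z\<in>grid ?N. S (subcube a s z) \<zeta> - \<epsilon> / 2 * s ^ d) =
        (\<Sum>z\<in>grid ?N. S (subcube a s z) \<zeta>) - \<epsilon> / 2 * (2 ^ k * s) ^ d"
      by (simp add: sum_subtractf card_grid_d power_mult_distrib)
    moreover have "T ?Q \<zeta> \<le> S ?Q \<zeta> + \<epsilon> / 2 * (2 ^ k * s) ^ d"
    proof -
      have "1 * s \<le> 2 ^ k * s" using s0 by (intro mult_right_mono) auto
      then have "2 ^ k * s \<ge> s1" using s0 by linarith
      from s1(2)[OF this \<zeta>, of a] show ?thesis unfolding abs_le_iff by linarith
    qed
    ultimately have "(\<Sum>z\<in>grid ?N. S (subcube a s z) \<zeta>) - \<epsilon> * (2 ^ k * s) ^ d \<le> S ?Q \<zeta>" by linarith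
    with up show ?thesis unfolding abs_le_iff by linarith
  qed
  then show ?thesis using s1(1) by (intro exI[of _ "max s1 s2"]) auto
qed

end

section \<open>Stationarity and the strong law over cells\<close>

text \<open>Off-diagonal covariances vanish, so the squared average has mean at most
  \<open>K * K * C / n ^ d\<close>. These means are summable, hence the squares are almost surely
  summable and tend to zero. No relation between the index sets \<open>I n\<close> for different
  \<open>n\<close> is used.\<close>

lemma (in prob_space) strong_law_uncorrelated:
  fixes X :: "'i \<Rightarrow> 'a \<Rightarrow> real"
  assumes meas [measurable]: "\<And>i. X i \<in> borel_measurable M"
    and bound: "\<And>i \<omega>. \<omega> \<in> space M \<Longrightarrow> \<bar>X i \<omega>\<bar> \<le> K"
    and mean: "\<And>i. expectation (X i) = m"
    and uncorr: "\<And>i j. i \<noteq> j \<Longrightarrow> expectation (\<lambda>\<omega>. X i \<omega> * X j \<omega>) = m * m"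
    and I: "\<And>n. finite (I n)" "\<And>n. real (card (I n)) \<le> C * real n ^ d" and d: "d \<ge> 2"
  shows "AE \<omega> in M. (\<lambda>n. (\<Sum>i\<in>I n. X i \<omega> - m) / real n ^ d) \<longlonglongrightarrow> 0"
proof -
  define Y where "Y n \<omega> = ((\<Sum>i\<in>I n. X i \<omega> - m) / real n ^ d)\<^sup>2" for n \<omega>
  have [measurable]: "Y n \<in> borel_measurable M" for n unfolding Y_def by measurable
  have intX: "integrable M (X i)" for i
    using bound by (intro integrable_const_bound[of _ K]) auto
  have intXX: "integrable M (\<lambda>\<omega>. X i \<omega> * X j \<omega>)" for i j
  proof (rule integrable_const_bound[of _ "K * K"])
    show "AE \<omega> in M. norm (X i \<omega> * X j \<omega>) \<le> K * K"
    proof (rule AE_I2)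
      fix \<omega> assume \<omega>: "\<omega> \<in> space M"
      have "\<bar>X i \<omega>\<bar> * \<bar>X j \<omega>\<bar> \<le> K * K"
        using bound[OF \<omega>] order_trans[OF abs_ge_zero bound[OF \<omega>]] by (intro mult_mono) auto
      then show "norm (X i \<omega> * X j \<omega>) \<le> K * K" by (simp add: abs_mult)
    qed
  qed measurable
  have eq: "(X i \<omega> - m) * (X j \<omega> - m) = X i \<omega> * X j \<omega> - m * X i \<omega> - m * X j \<omega> + m * m" for i j \<omega>
    by (simp add: algebra_simps)
  have intc: "integrable M (\<lambda>\<omega>. (X i \<omega> - m) * (X j \<omega> - m))" for i j
    unfolding eq using intX intXX by simp
  have ec: "expectation (\<lambda>\<omega>. (X i \<omega> - m) * (X j \<omega> - m)) = expectation (\<lambda>\<omega>. X i \<omega> * X j \<omega>) - m * m" for i j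
    unfolding eq using intX intXX mean by (simp add: prob_space)
  have K: "expectation (\<lambda>\<omega>. X i \<omega> * X i \<omega>) \<le> K * K" for i
  proof -
    have "expectation (\<lambda>\<omega>. X i \<omega> * X i \<omega>) \<le> expectation (\<lambda>\<omega>. K * K)"
    proof (rule integral_mono[OF intXX])
      fix \<omega> assume \<omega>: "\<omega> \<in> space M"
      have "\<bar>X i \<omega>\<bar> * \<bar>X i \<omega>\<bar> \<le> K * K"
        using bound[OF \<omega>] order_trans[OF abs_ge_zero bound[OF \<omega>]] by (intro mult_mono) auto
      then show "X i \<omega> * X i \<omega> \<le> K * K" by simp
    qed simp
    then show ?thesis by (simp add: prob_space)
  qed
  have EY: "expectation (Y n) \<le> K * K * C * (1 / real n ^ d)" and intY: "integrable M (Y n)" for n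
  proof -
    have Yeq: "Y n \<omega> = (\<Sum>i\<in>I n. \<Sum>j\<in>I n. (X i \<omega> - m) * (X j \<omega> - m)) / (real n ^ d)\<^sup>2" for \<omega>
      unfolding Y_def power_divide by (simp only: power2_eq_square sum_product)
    show "integrable M (Y n)" unfolding Yeq using intc by simp
    have "expectation (Y n) = (\<Sum>i\<in>I n. \<Sum>j\<in>I n. expectation (\<lambda>\<omega>. (X i \<omega> - m) * (X j \<omega> - m))) / (real n ^ d)\<^sup>2"
      unfolding Yeq using intc by (simp add: Bochner_Integration.integral_sum)
    also have "(\<Sum>i\<in>I n. \<Sum>j\<in>I n. expectation (\<lambda>\<omega>. (X i \<omega> - m) * (X j \<omega> - m))) =
        (\<Sum>i\<in>I n. expectation (\<lambda>\<omega>. X i \<omega> * X i \<omega>) - m * m)"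
    proof (rule sum.cong[OF refl])
      fix i assume i: "i \<in> I n"
      have "(\<Sum>j\<in>I n. expectation (\<lambda>\<omega>. (X i \<omega> - m) * (X j \<omega> - m))) =
          (\<Sum>j\<in>I n. if j = i then expectation (\<lambda>\<omega>. X i \<omega> * X i \<omega>) - m * m else 0)"
        unfolding ec using uncorr by (intro sum.cong) auto
      then show "(\<Sum>j\<in>I n. expectation (\<lambda>\<omega>. (X i \<omega> - m) * (X j \<omega> - m))) = expectation (\<lambda>\<omega>. X i \<omega> * X i \<omega>) - m * m"
        using i I(1) by (simp add: sum.delta)
    qed
    also have "\<dots> / (real n ^ d)\<^sup>2 \<le> (\<Sum>i\<in>I n. K * K) / (real n ^ d)\<^sup>2"
    proof (intro divide_right_mono sum_mono)
      fix i show "expectation (\<lambda>\<omega>. X i \<omega> * X i \<omega>) - m * m \<le> K * K"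
        using K[of i] zero_le_square[of m] by linarith
    qed simp
    also have "\<dots> = K * K * real (card (I n)) / (real n ^ d)\<^sup>2" by (simp add: mult.commute)
    also have "\<dots> \<le> K * K * (C * real n ^ d) / (real n ^ d)\<^sup>2"
      using I(2)[of n] by (intro divide_right_mono mult_left_mono) auto
    also have "\<dots> = K * K * C * (1 / real n ^ d)"
      by (cases "n = 0") (use d in \<open>auto simp: power2_eq_square\<close>)
    finally show "expectation (Y n) \<le> K * K * C * (1 / real n ^ d)" .
  qed
  have sm: "summable (\<lambda>n. K * K * C * (1 / real n ^ d))"
    using inverse_power_summable[OF d, where 'a = real] by (intro summable_mult) (simp add: inverse_eq_divide)
  have pos: "expectation (Y n) \<ge> 0" for n
    by (rule integral_nonneg_AE) (simp add: Y_def)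
  have "summable (\<lambda>n. expectation (Y n))"
  proof (rule summable_comparison_test'[OF sm, of 0])
    show "norm (expectation (Y n)) \<le> K * K * C * (1 / real n ^ d)" for n
      unfolding real_norm_def abs_of_nonneg[OF pos] by (rule EY)
  qed
  from ennreal_suminf_neq_top[OF this pos] have "(\<Sum>n. ennreal (expectation (Y n))) \<noteq> \<infinity>"
    by (simp only: infinity_ennreal_def) simp
  moreover have "(\<integral>\<^sup>+\<omega>. (\<Sum>n. ennreal (Y n \<omega>)) \<partial>M) = (\<Sum>n. ennreal (expectation (Y n)))"
  proof -
    have e: "(\<integral>\<^sup>+\<omega>. ennreal (Y n \<omega>) \<partial>M) = ennreal (expectation (Y n))" for n
      by (rule nn_integral_eq_integral[OF intY]) (simp add: Y_def)
    have "(\<integral>\<^sup>+\<omega>. (\<Sum>n. ennreal (Y n \<omega>)) \<partial>M) = (\<Sum>n. \<integral>\<^sup>+\<omega>. ennreal (Y n \<omega>) \<partial>M)"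
      by (rule nn_integral_suminf) measurable
    then show ?thesis unfolding e .
  qed
  ultimately have "(\<integral>\<^sup>+\<omega>. (\<Sum>n. ennreal (Y n \<omega>)) \<partial>M) \<noteq> \<infinity>" by (simp only:) simp
  moreover have "(\<lambda>\<omega>. \<Sum>n. ennreal (Y n \<omega>)) \<in> borel_measurable M" by measurable
  ultimately have "AE \<omega> in M. (\<Sum>n. ennreal (Y n \<omega>)) \<noteq> \<infinity>"
    by (intro nn_integral_PInf_AE)
  then show ?thesis
  proof (rule AE_mp, intro AE_I2 impI)
    fix \<omega> assume "(\<Sum>n. ennreal (Y n \<omega>)) \<noteq> \<infinity>"
    then have "summable (\<lambda>n. Y n \<omega>)" by (intro summable_suminf_not_top) (auto simp: Y_def)
    then have "(\<lambda>n. Y n \<omega>) \<longlonglongrightarrow> 0" by (rule summable_LIMSEQ_zero)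
    then have "(\<lambda>n. sqrt (Y n \<omega>)) \<longlonglongrightarrow> sqrt 0" by (rule tendsto_real_sqrt)
    then have "(\<lambda>n. \<bar>(\<Sum>i\<in>I n. X i \<omega> - m) / real n ^ d\<bar>) \<longlonglongrightarrow> 0" by (simp add: Y_def)
    then show "(\<lambda>n. (\<Sum>i\<in>I n. X i \<omega> - m) / real n ^ d) \<longlonglongrightarrow> 0" by (rule tendsto_rabs_zero_cancel)
  qed
qed

section \<open>Equivariance under translations and stationarity\<close>

lemma Collect_image: "{y \<in> h ` V. Q y} = h ` {x \<in> V. Q (h x)}"
  by blast

lemma bex_image: "(\<exists>y\<in>h ` V. Q y) \<longleftrightarrow> (\<exists>x\<in>V. Q (h x))"
  by blast

lemma ball_image: "(\<forall>y\<in>h ` V. Q y) \<longleftrightarrow> (\<forall>x\<in>V. Q (h x))"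
  by blast

lemma image_Int_vimage: "(\<And>x. h x \<in> B \<longleftrightarrow> x \<in> B') \<Longrightarrow> h ` V \<inter> B = h ` (V \<inter> B')"
  by blast

context
  fixes h :: "(real ^ 'n::{finite,linorder}) \<times> real \<Rightarrow> (real ^ 'n::{finite,linorder}) \<times> real" and \<rho> :: real
  assumes inj: "inj h" and edge: "\<And>x y. parking_edge \<rho> (h x) (h y) \<longleftrightarrow> parking_edge \<rho> x y"
begin

lemma graph_roots_image:
  "graph_roots (parking_edge \<rho>) (h ` V) = h ` graph_roots (parking_edge \<rho>) V"
  unfolding graph_roots_def Collect_image bex_image edge ..

lemma graph_offspring_image:
  "graph_offspring (parking_edge \<rho>) (h ` V) (h ` W) = h ` graph_offspring (parking_edge \<rho>) V W"
  unfolding graph_offspring_def Collect_image bex_image edge ..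

lemma parking_rest_image: "parking_rest \<rho> (h ` V) i = h ` parking_rest \<rho> V i"
proof (induction i)
  case (Suc i)
  show ?case
    unfolding parking_rest.simps Let_def Suc graph_roots_image graph_offspring_image
    by (simp only: image_set_diff[OF inj] image_Un)
qed simp

lemma accepted_image: "accepted \<rho> (h ` V) = h ` accepted \<rho> V"
  unfolding accepted_def parking_accepted_def parking_rest_image graph_roots_image image_UN ..

lemma tainted_image:
  assumes C: "\<And>x. fst (h x) \<in> C' \<longleftrightarrow> fst x \<in> C"
  shows "tainted \<rho> C' (h ` V) = h ` tainted \<rho> C V"
proof -
  have "tainted_upto \<rho> C' (h ` V) i = h ` tainted_upto \<rho> C V i" for i
  proof (induction i)
    case 0 show ?case unfolding tainted_upto.simps Collect_image C ..
  next
    case (Suc i)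
    show ?case unfolding tainted_upto.simps Suc Collect_image bex_image edge ..
  qed
  then show ?thesis unfolding tainted_def image_UN by simp
qed

end

definition lift_shift :: "real ^ 'n \<Rightarrow> (real ^ 'n) \<times> real \<Rightarrow> (real ^ 'n) \<times> real" where
  "lift_shift v = (+) (v, 0)"

lemma lift_shift_simps [simp]: "fst (lift_shift v x) = v + fst x" "snd (lift_shift v x) = snd x"
  by (simp_all add: lift_shift_def)

lemma inj_lift_shift: "inj (lift_shift v)"
  by (simp add: lift_shift_def)

lemma parking_edge_shift:
  assumes "\<rho> > 0" shows "parking_edge \<rho> (lift_shift v x) (lift_shift v y) \<longleftrightarrow> parking_edge \<rho> x y"
  unfolding parking_edge_iff[OF assms] by (simp add: lex_less_def dist_norm)

lemma mem_translate: "v + x \<in> (+) v ` A \<longleftrightarrow> x \<in> A" for v :: "'a::ab_group_add"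
  by auto

lemma shift_over: "lift_shift v ` V \<inter> over ((+) v ` A) = lift_shift v ` (V \<inter> over A)"
proof (rule image_Int_vimage)
  show "lift_shift v x \<in> over ((+) v ` A) \<longleftrightarrow> x \<in> over A" for x
    unfolding mem_Times_iff lift_shift_simps mem_translate ..
qed

lemma random_parking_shift:
  assumes "\<rho> > 0"
  shows "random_parking \<rho> ((+) v ` A) (lift_shift v ` V) = (+) v ` random_parking \<rho> A V"
  unfolding random_parking_eq shift_over accepted_image[OF inj_lift_shift parking_edge_shift[OF assms]]
  by (simp add: image_image)

lemma mem_core_translate:
  fixes v :: "'a::real_normed_vector"
  shows "v + x \<in> core r ((+) v ` A) \<longleftrightarrow> x \<in> core r A"
proof -
  have "inj ((+) v)" by (rule injI) (rule add_left_imp_eq)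
  then show ?thesis unfolding core_def mem_Collect_eq ball_translation by (rule inj_image_subset_iff)
qed

lemma determined_shift:
  assumes "\<rho> > 0"
  shows "determined \<rho> ((+) v ` c) ((+) v ` A) (lift_shift v ` V) \<longleftrightarrow> determined \<rho> c A V"
proof -
  have t: "tainted \<rho> (core r ((+) v ` A)) (lift_shift v ` W) = lift_shift v ` tainted \<rho> (core r A) W" for W r
    by (rule tainted_image[OF inj_lift_shift parking_edge_shift[OF assms]]) (simp add: mem_core_translate)
  show ?thesis
    unfolding determined_def shift_over t accepted_image[OF inj_lift_shift parking_edge_shift[OF assms]]
      image_set_diff[OF inj_lift_shift, symmetric] ball_image bex_image
      inj_image_mem_iff[OF inj_lift_shift] lift_shift_simps mem_translate parking_edge_shift[OF assms] ..
qed

lemma unit_poisson_process_shift: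
  fixes v :: "real ^ 'n"
  assumes "unit_poisson_process M (UNIV \<times> {0..}) P"
  shows "unit_poisson_process M (UNIV \<times> {0..}) (\<lambda>\<omega>. lift_shift v ` P \<omega>)"
  unfolding lift_shift_def
proof (rule unit_poisson_process_translate[OF assms])
  have "y \<in> (+) (v, 0) ` (UNIV \<times> {0..})" if "snd y \<ge> 0" for y :: "(real ^ 'n) \<times> real"
    using that by (intro image_eqI[of _ _ "(fst y - v, snd y)"]) (auto simp: prod_eq_iff)
  then show "(+) (v, 0) ` (UNIV \<times> {0..}) = UNIV \<times> {0 :: real..}" by auto
qed

text \<open>Stationarity enters through laws only: the process and its translate are both unit
  Poisson processes, so they have the same law, and no shift has to act on the sample space.\<close>

lemma expectation_shift:
  fixes P :: "'w \<Rightarrow> ((real ^ 'n) \<times> real) set" and \<Phi> \<Psi> :: "((real ^ 'n) \<times> real) set \<Rightarrow> real"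
  assumes U: "unit_poisson_process M (UNIV \<times> {0..}) P"
    and \<Phi>: "\<Phi> \<in> borel_measurable (configurations (over A))"
    and eq: "\<And>V. locally_finite V \<Longrightarrow> \<Phi> (lift_shift v ` V) = \<Psi> V"
  shows "integral\<^sup>L M (\<lambda>\<omega>. \<Phi> (P \<omega>)) = integral\<^sup>L M (\<lambda>\<omega>. \<Psi> (P \<omega>))"
proof -
  note U' = unit_poisson_process_shift[OF U, of v]
  have sub: "over A \<subseteq> UNIV \<times> {0..}" by blast
  have "integral\<^sup>L M (\<lambda>\<omega>. \<Phi> (P \<omega>)) = integral\<^sup>L (distr M (configurations (over A)) P) \<Phi>"
    by (rule integral_distr[symmetric, OF measurable_configurations[OF U sub] \<Phi>])
  also have "\<dots> = integral\<^sup>L (distr M (configurations (over A)) (\<lambda>\<omega>. lift_shift v ` P \<omega>)) \<Phi>"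
    by (simp only: distr_poisson_eq[OF U U' sub])
  also have "\<dots> = integral\<^sup>L M (\<lambda>\<omega>. \<Phi> (lift_shift v ` P \<omega>))"
    by (rule integral_distr[OF measurable_configurations[OF U' sub] \<Phi>])
  also have "\<dots> = integral\<^sup>L M (\<lambda>\<omega>. \<Psi> (P \<omega>))"
    using unit_poisson_processD(3)[OF U] by (intro Bochner_Integration.integral_cong) (auto simp: eq)
  finally show ?thesis .
qed

text \<open>Functions of the events over disjoint cells are independent, hence uncorrelated.\<close>

lemma strong_law_cells:
  fixes P :: "'w \<Rightarrow> ((real ^ 'n) \<times> real) set" and \<Phi> :: "('n \<Rightarrow> int) \<Rightarrow> ((real ^ 'n) \<times> real) set \<Rightarrow> real"
  assumes U: "unit_poisson_process M (UNIV \<times> {0..}) P" and r: "r > 0"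
    and \<Phi>: "\<And>z. \<Phi> z \<in> borel_measurable (configurations (over (cell r z)))"
    and bound: "\<And>z V. locally_finite V \<Longrightarrow> \<bar>\<Phi> z V\<bar> \<le> K"
    and mean: "\<And>z. integral\<^sup>L M (\<lambda>\<omega>. \<Phi> z (P \<omega>)) = m"
    and I: "\<And>n. finite (I n)" "\<And>n. real (card (I n)) \<le> C * real n ^ d" and d: "d \<ge> 2"
  shows "AE \<omega> in M. (\<lambda>n. (\<Sum>z\<in>I n. \<Phi> z (P \<omega>) - m) / real n ^ d) \<longlonglongrightarrow> 0"
proof -
  interpret prob_space M by (rule unit_poisson_processD(1)[OF U])
  have sub: "over A \<subseteq> UNIV \<times> {0..}" for A :: "(real ^ 'n) set" by blast
  have meas [measurable]: "(\<lambda>\<omega>. \<Phi> z (P \<omega>)) \<in> borel_measurable M" for z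
    by (rule measurable_compose[OF measurable_configurations[OF U sub] \<Phi>])
  have bd: "\<bar>\<Phi> z (P \<omega>)\<bar> \<le> K" if "\<omega> \<in> space M" for z \<omega>
    by (rule bound[OF unit_poisson_processD(3)[OF U that]])
  show ?thesis
  proof (rule strong_law_uncorrelated[OF meas bd mean _ I d])
    fix z z' :: "'n \<Rightarrow> int" assume "z \<noteq> z'"
    then have "cell r z \<inter> cell r z' = {}" by (auto simp: mem_cell_iff[OF r])
    then have "over (cell r z) \<inter> over (cell r z') = {}" by blast
    from indep_var_poisson[OF U sub sub this]
    have "indep_var borel (\<Phi> z \<circ> P) borel (\<Phi> z' \<circ> P)" by (rule indep_var_compose[OF _ \<Phi> \<Phi>])
    then have iv: "indep_var borel (\<lambda>\<omega>. \<Phi> z (P \<omega>)) borel (\<lambda>\<omega>. \<Phi> z' (P \<omega>))" by (simp add: comp_def)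
    have int: "integrable M (\<lambda>\<omega>. \<Phi> z (P \<omega>))" for z
      using bd by (intro integrable_const_bound[of _ K]) auto
    show "expectation (\<lambda>\<omega>. \<Phi> z (P \<omega>) * \<Phi> z' (P \<omega>)) = m * m"
      using indep_var_lebesgue_integral[OF iv int int] mean by simp
  qed
qed

section \<open>Lattice cells in scaled domains\<close>

lemma dist_cell:
  fixes x y :: "real ^ 'n" and r :: real
  assumes "r > 0" "x \<in> cell r z" "y \<in> cell r z" shows "dist x y \<le> real CARD('n) * r"
proof -
  have "dist x y \<le> diameter (cell r z)"
    using diameter_bounded_bound[OF bounded_cell assms(2,3)] .
  then show ?thesis using diameter_cube[OF assms(1), of "lattice_point r z"] by (simp add: cell_def)
qed

lemma disjoint_cells: "r > 0 \<Longrightarrow> z \<noteq> z' \<Longrightarrow> cell r z \<inter> cell r z' = {}"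
  by (auto simp: mem_cell_iff)

lemma measure_cell:
  fixes z :: "'n::finite \<Rightarrow> int"
  assumes "r > 0" shows "measure lborel (cell r z) = r ^ CARD('n)"
  using assms by (simp add: cell_def measure_cube)

lemma measure_UN_cells:
  fixes Z :: "('n::finite \<Rightarrow> int) set"
  assumes r: "r > 0" and Z: "finite Z"
  shows "measure lborel (\<Union>z\<in>Z. cell r z) = real (card Z) * r ^ CARD('n)"
proof -
  have "measure lborel (\<Union>z\<in>Z. cell r z) = (\<Sum>z\<in>Z. measure lborel (cell r z))"
  proof (rule measure_finite_Union[OF Z])
    show "cell r ` Z \<subseteq> sets lborel" by auto
    show "disjoint_family_on (cell r) Z"
      using disjoint_cells[OF r] by (auto simp: disjoint_family_on_def)
    show "emeasure lborel (cell r z) \<noteq> \<infinity>" for z :: "'n \<Rightarrow> int"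
      using emeasure_bounded_finite[OF bounded_cell[of r z]] by simp
  qed
  then show ?thesis by (simp add: measure_cell[OF r])
qed

lemma card_cells_le:
  fixes Z :: "('n::finite \<Rightarrow> int) set"
  assumes r: "r > 0" and Z: "finite Z" "(\<Union>z\<in>Z. cell r z) \<subseteq> B" and B: "bounded B" "B \<in> sets borel"
  shows "real (card Z) * r ^ CARD('n) \<le> measure lborel B"
proof -
  have "(\<Union>z\<in>Z. cell r z) \<in> sets lborel" using Z(1) by (intro sets.finite_UN) auto
  then show ?thesis unfolding measure_UN_cells[OF r Z(1), symmetric]
    using Z(2) fmeasurable_lborel_bounded[OF B] by (intro measure_mono_fmeasurable)
qed

lemma finite_cells_meeting:
  fixes B :: "(real ^ 'n) set"
  assumes r: "r > 0" and B: "bounded B"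
  shows "finite {z. cell r z \<inter> B \<noteq> {}}"
proof -
  obtain b where b: "\<And>x. x \<in> B \<Longrightarrow> norm x \<le> b" using B by (auto simp: bounded_iff)
  have "{z. cell r z \<inter> B \<noteq> {}} \<subseteq> PiE UNIV (\<lambda>_. {\<lfloor>- b / r\<rfloor>..\<lfloor>b / r\<rfloor>})"
  proof
    fix z assume "z \<in> {z. cell r z \<inter> B \<noteq> {}}"
    then obtain x where x: "x \<in> cell r z" "x \<in> B" by blast
    then have z: "z = cell_index r x" using mem_cell_iff[OF r] by blast
    have "z i \<in> {\<lfloor>- b / r\<rfloor>..\<lfloor>b / r\<rfloor>}" for i
    proof -
      have "\<bar>x $ i\<bar> \<le> b" using component_le_norm_cart[of x i] b[OF x(2)] by linarith
      then have "- b / r \<le> x $ i / r" "x $ i / r \<le> b / r" using r by (auto simp: field_simps)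
      then show ?thesis unfolding z cell_index_def by (auto intro: floor_mono)
    qed
    then show "z \<in> PiE UNIV (\<lambda>_. {\<lfloor>- b / r\<rfloor>..\<lfloor>b / r\<rfloor>})" by auto
  qed
  moreover have "finite (PiE (UNIV :: 'n set) (\<lambda>_. {\<lfloor>- b / r\<rfloor>..\<lfloor>b / r\<rfloor>}))" by (intro finite_PiE) auto
  ultimately show ?thesis by (rule finite_subset)
qed

text \<open>Indexed by integer scales, because the strong law runs along a sequence; real scales
  between \<open>n\<close> and \<open>n + 1\<close> are absorbed into a wider boundary
  layer.\<close>

definition inner_cells :: "real \<Rightarrow> (real ^ 'n) set \<Rightarrow> nat \<Rightarrow> ('n \<Rightarrow> int) set" where
  "inner_cells r D n = {z. cell r z \<subseteq> (*\<^sub>R) (real n) ` D}"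

definition boundary_cells :: "real \<Rightarrow> real \<Rightarrow> (real ^ 'n) set \<Rightarrow> nat \<Rightarrow> ('n \<Rightarrow> int) set" where
  "boundary_cells r c D n = {z. \<exists>x\<in>cell r z. \<exists>y\<in>frontier D. dist x (real n *\<^sub>R y) \<le> c}"

lemma cell_nonempty: "r > 0 \<Longrightarrow> cell r z \<noteq> {}"
  using corner_mem_cube[of r "lattice_point r z"] unfolding cell_def by blast

lemma finite_inner_cells:
  assumes "r > 0" "bounded D" shows "finite (inner_cells r D n)"
proof -
  have "inner_cells r D n \<subseteq> {z. cell r z \<inter> (*\<^sub>R) (real n) ` D \<noteq> {}}"
    using cell_nonempty[OF assms(1)] unfolding inner_cells_def by blast
  then show ?thesis
    using finite_cells_meeting[OF assms(1) bounded_scaling[OF assms(2)]] by (rule finite_subset)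
qed

lemma card_inner_cells_le:
  fixes D :: "(real ^ 'n) set"
  assumes r: "r > 0" and D: "D \<in> lipschitz_sets"
  shows "real (card (inner_cells r D n)) * r ^ CARD('n) \<le> real n ^ CARD('n) * measure lborel D"
proof (cases "n = 0")
  case True
  \<comment> \<open>The strong law asks for the bound at \<open>n = 0\<close> as well; there the
    scaled domain is at most a point and contains no cell.\<close>
  have "inner_cells r D 0 = {}"
  proof (rule ccontr)
    assume "inner_cells r D 0 \<noteq> {}"
    then obtain z where z: "cell r z \<subseteq> (*\<^sub>R) 0 ` D" unfolding inner_cells_def by auto
    then have "cell r z \<subseteq> {0}" by auto
    then have "measure lborel (cell r z) \<le> measure lborel {0 :: real ^ 'n}"
      using fmeasurable_lborel_bounded[of "{0 :: real ^ 'n}"] by (intro measure_mono_fmeasurable) auto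
    then show False using measure_cell[OF r, of z] zero_less_power[OF r, of "CARD('n)"] by simp
  qed
  then show ?thesis using True by simp
next
  case False
  have n: "real n > 0" using False by simp
  note b = lipschitz_setsD(2,3)[OF D]
  have "real (card (inner_cells r D n)) * r ^ CARD('n) \<le> measure lborel ((*\<^sub>R) (real n) ` D)"
    by (rule card_cells_le[OF r finite_inner_cells[OF r b(1)] _ bounded_scaling[OF b(1)] borel_scale[OF n b(2)]])
      (auto simp: inner_cells_def)
  then show ?thesis using measure_scale[OF n b(2)] by simp
qed

section \<open>Cells near the boundary\<close>

lemma frontier_lipschitz_compact: "D \<in> lipschitz_sets \<Longrightarrow> compact (frontier D)"
  by (intro compact_frontier_bounded lipschitz_setsD)

lemma frontier_lipschitz_nonempty:
  fixes D :: "(real ^ 'n) set"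
  shows "D \<in> lipschitz_sets \<Longrightarrow> frontier D \<noteq> {}"
  using lipschitz_setsD(1,2)[of D] frontier_not_empty[of D] not_bounded_UNIV by metis

definition collar :: "'a::metric_space set \<Rightarrow> real \<Rightarrow> 'a set" where
  "collar F \<delta> = {x. infdist x F \<le> \<delta>}"

lemma closed_collar: "closed (collar F \<delta>)"
  unfolding collar_def by (intro closed_Collect_le continuous_intros)

lemma bounded_collar:
  fixes F :: "'a::euclidean_space set"
  assumes "compact F" "F \<noteq> {}" shows "bounded (collar F \<delta>)"
proof -
  obtain b where b: "\<And>x. x \<in> F \<Longrightarrow> norm x \<le> b"
    using compact_imp_bounded[OF assms(1)] by (auto simp: bounded_iff)
  have "norm x \<le> b + \<delta>" if "x \<in> collar F \<delta>" for x
  proof -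
    obtain y where "y \<in> F" "infdist x F = dist x y"
      using infdist_attains_inf[OF compact_imp_closed[OF assms(1)] assms(2)] by blast
    then show ?thesis using b[of y] that norm_triangle_sub[of x y] by (simp add: collar_def dist_norm)
  qed
  then show ?thesis by (auto simp: bounded_iff)
qed

text \<open>Closed collars of finite measure decrease to the frontier, which is closed and
  null.\<close>

lemma measure_collar_tendsto:
  fixes D :: "(real ^ 'n) set"
  assumes D: "D \<in> lipschitz_sets" and c: "c \<ge> 0"
  shows "(\<lambda>n. measure lborel (collar (frontier D) (c / real n))) \<longlonglongrightarrow> 0"
proof -
  \<comment> \<open>Shifted by one, since \<open>c / 0 = 0\<close> would break monotonicity at the
    start.\<close>
  let ?A = "\<lambda>n. collar (frontier D) (c / real (Suc n))"
  have "(\<lambda>n. measure lborel (?A n)) \<longlonglongrightarrow> measure lborel (\<Inter>n. ?A n)"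
  proof (rule Lim_measure_decseq)
    show "range ?A \<subseteq> sets lborel" using closed_collar by (auto intro: borel_closed)
    show "decseq ?A"
      unfolding decseq_def collar_def using c by (auto elim!: order_trans intro!: divide_left_mono)
    show "emeasure lborel (?A n) \<noteq> \<infinity>" for n
      using emeasure_bounded_finite[OF bounded_collar[OF frontier_lipschitz_compact[OF D] frontier_lipschitz_nonempty[OF D], of "c / real (Suc n)"]]
      by simp
  qed
  moreover have "(\<Inter>n. ?A n) = frontier D"
  proof (intro antisym subsetI)
    fix x assume x: "x \<in> (\<Inter>n. ?A n)"
    have "(\<lambda>n. c / real (Suc n)) \<longlonglongrightarrow> 0"
      using tendsto_mult_right_zero[OF LIMSEQ_inverse_real_of_nat, of c] by (simp add: divide_inverse)
    moreover have "infdist x (frontier D) \<le> c / real (Suc n)" for n using x by (simp add: collar_def)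
    ultimately have "infdist x (frontier D) \<le> 0" by (intro LIMSEQ_le_const) auto
    then have "infdist x (frontier D) = 0" using infdist_nonneg[of x "frontier D"] by simp
    then show "x \<in> frontier D"
      using in_closed_iff_infdist_zero[OF frontier_closed frontier_lipschitz_nonempty[OF D]] by blast
  next
    fix x assume "x \<in> frontier D"
    then show "x \<in> (\<Inter>n. ?A n)" using c by (simp add: collar_def)
  qed
  ultimately have "(\<lambda>n. measure lborel (?A n)) \<longlonglongrightarrow> 0" by (simp add: measure_frontier_lipschitz[OF D])
  then show ?thesis by (rule LIMSEQ_imp_Suc)
qed

text \<open>All points of such a cell are within \<open>c\<close> plus the cell diameter of the
  scaled frontier; scaling back by \<open>n\<close> puts them into a collar, and disjoint cells are
  counted by volume.\<close>

lemma
  fixes D :: "(real ^ 'n) set" and r c :: real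
  assumes r: "r > 0" and D: "D \<in> lipschitz_sets"
  shows finite_boundary_cells: "finite (boundary_cells r c D n)"
    and card_boundary_cells_le: "n > 0 \<Longrightarrow> real (card (boundary_cells r c D n)) * r ^ CARD('n) \<le>
      real n ^ CARD('n) * measure lborel (collar (frontier D) ((c + real CARD('n) * r) / real n))"
proof -
  obtain b where b: "\<And>x. x \<in> frontier D \<Longrightarrow> norm x \<le> b"
    using compact_imp_bounded[OF frontier_lipschitz_compact[OF D]] by (auto simp: bounded_iff)
  have "boundary_cells r c D n \<subseteq> {z. cell r z \<inter> cball 0 (real n * b + c) \<noteq> {}}"
  proof
    fix z assume "z \<in> boundary_cells r c D n"
    then obtain x y where x: "x \<in> cell r z" "y \<in> frontier D" "dist x (real n *\<^sub>R y) \<le> c"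
      unfolding boundary_cells_def by blast
    have "norm x \<le> norm (real n *\<^sub>R y) + norm (x - real n *\<^sub>R y)" by (rule norm_triangle_sub)
    also have "\<dots> \<le> real n * b + c"
      using x(3) b[OF x(2)] by (intro add_mono) (auto simp: dist_norm intro!: mult_left_mono)
    finally have "x \<in> cell r z \<inter> cball 0 (real n * b + c)" using x(1) by simp
    then show "z \<in> {z. cell r z \<inter> cball 0 (real n * b + c) \<noteq> {}}" by blast
  qed
  moreover have "finite {z. cell r z \<inter> cball (0 :: real ^ 'n) (real n * b + c) \<noteq> {}}"
    by (rule finite_cells_meeting[OF r bounded_cball])
  ultimately show fin: "finite (boundary_cells r c D n)" by (rule finite_subset)
  assume "n > 0"
  then have n: "real n > 0" by simp
  let ?C = "collar (frontier D) ((c + real CARD('n) * r) / real n)"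
  have bC: "bounded ?C" by (intro bounded_collar frontier_lipschitz_compact frontier_lipschitz_nonempty D)
  have mC: "?C \<in> sets borel" by (intro borel_closed closed_collar)
  have "(\<Union>z\<in>boundary_cells r c D n. cell r z) \<subseteq> (*\<^sub>R) (real n) ` ?C"
  proof
    fix x' assume "x' \<in> (\<Union>z\<in>boundary_cells r c D n. cell r z)"
    then obtain z x y where x: "x' \<in> cell r z" "x \<in> cell r z" "y \<in> frontier D" "dist x (real n *\<^sub>R y) \<le> c"
      unfolding boundary_cells_def by blast
    have "dist x' (real n *\<^sub>R y) \<le> c + real CARD('n) * r"
      using dist_triangle[of x' "real n *\<^sub>R y" x] dist_cell[OF r x(1,2)] x(4) by linarith
    moreover have "x' - real n *\<^sub>R y = real n *\<^sub>R ((1 / real n) *\<^sub>R x' - y)"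
      using n by (simp add: scaleR_diff_right)
    ultimately have "real n * dist ((1 / real n) *\<^sub>R x') y \<le> c + real CARD('n) * r"
      using n by (simp add: dist_norm)
    then have "dist ((1 / real n) *\<^sub>R x') y \<le> (c + real CARD('n) * r) / real n"
      using n by (simp add: field_simps)
    then have "(1 / real n) *\<^sub>R x' \<in> ?C"
      using infdist_le[OF x(3), of "(1 / real n) *\<^sub>R x'"] by (simp add: collar_def)
    moreover have "x' = real n *\<^sub>R ((1 / real n) *\<^sub>R x')" using n by simp
    ultimately show "x' \<in> (*\<^sub>R) (real n) ` ?C" by (rule rev_image_eqI)
  qed
  from card_cells_le[OF r fin this bounded_scaling[OF bC] borel_scale[OF n mC]]
  show "real (card (boundary_cells r c D n)) * r ^ CARD('n) \<le> real n ^ CARD('n) * measure lborel ?C"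
    by (simp add: measure_scale[OF n mC])
qed

lemma card_boundary_cells_tendsto:
  fixes D :: "(real ^ 'n) set" and r c :: real
  assumes r: "r > 0" and D: "D \<in> lipschitz_sets" and c: "c \<ge> 0"
  shows "(\<lambda>n. real (card (boundary_cells r c D n)) / real n ^ CARD('n)) \<longlonglongrightarrow> 0"
proof -
  let ?\<mu> = "\<lambda>n. measure lborel (collar (frontier D) ((c + real CARD('n) * r) / real n)) / r ^ CARD('n)"
  have lim: "(\<lambda>n. ?\<mu> n) \<longlonglongrightarrow> 0"
    using tendsto_divide[OF measure_collar_tendsto[OF D, of "c + real CARD('n) * r"] tendsto_const[of "r ^ CARD('n)"]] r c by simp
  have up: "eventually (\<lambda>n. real (card (boundary_cells r c D n)) / real n ^ CARD('n) \<le> ?\<mu> n) sequentially"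
  proof (rule eventually_sequentiallyI[of 1])
    fix n :: nat assume "n \<ge> 1"
    then have "real (card (boundary_cells r c D n)) * r ^ CARD('n) \<le>
      real n ^ CARD('n) * measure lborel (collar (frontier D) ((c + real CARD('n) * r) / real n))"
      using card_boundary_cells_le[OF r D, of n c] by simp
    then show "real (card (boundary_cells r c D n)) / real n ^ CARD('n) \<le> ?\<mu> n"
      using \<open>n \<ge> 1\<close> r by (simp add: field_simps)
  qed
  have low: "eventually (\<lambda>n. 0 \<le> real (card (boundary_cells r c D n)) / real n ^ CARD('n)) sequentially"
    by simp
  show ?thesis by (rule tendsto_sandwich[OF low up tendsto_const lim])
qed

text \<open>If a cell meets the domain at scale \<open>R\<close> and leaves it at scale
  \<open>R'\<close>, the segment between the rescaled points crosses the frontier, and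
  \<open>n\<close> times the crossing point is near the cell. It is used in both directions between
  the scales \<open>n\<close> and \<open>R\<close>.\<close>

lemma cell_not_boundary:
  fixes D :: "(real ^ 'n) set" and r b :: real
  assumes r: "r > 0" and M: "\<And>x. x \<in> D \<Longrightarrow> norm x \<le> b" and n: "n > 0"
    and R: "real n \<le> R" "R \<le> real n + 1" "real n \<le> R'" "R' \<le> real n + 1"
    and z: "z \<notin> boundary_cells r (2 * b + real CARD('n) * r) D n" and meets: "cell r z \<inter> (*\<^sub>R) R ` D \<noteq> {}"
  shows "cell r z \<subseteq> (*\<^sub>R) R' ` D"
proof (rule ccontr)
  assume "\<not> ?thesis"
  then obtain y where y: "y \<in> cell r z" "y \<notin> (*\<^sub>R) R' ` D" by blast
  obtain x' where x': "x' \<in> D" and x: "R *\<^sub>R x' \<in> cell r z" using meets by blast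
  have pos: "R > 0" "R' > 0" "real n > 0" using R n by auto
  define y' where "y' = (1 / R') *\<^sub>R y"
  have yy: "y = R' *\<^sub>R y'" using pos by (simp add: y'_def)
  then have "y' \<notin> D" using y(2) by blast
  then have "closed_segment x' y' \<inter> frontier D \<noteq> {}"
    using x' by (intro connected_Int_frontier) auto
  then obtain w where w: "w \<in> closed_segment x' y'" "w \<in> frontier D" by blast
  then obtain t where t: "0 \<le> t" "t \<le> 1" "w = (1 - t) *\<^sub>R x' + t *\<^sub>R y'" by (auto simp: in_segment)
  have nx: "norm x' \<le> b" by (rule M[OF x'])
  have d: "norm (y - R *\<^sub>R x') \<le> real CARD('n) * r" using dist_cell[OF r y(1) x] by (simp add: dist_norm)
  \<comment> \<open>Three displacements: passing from scale \<open>R\<close> to \<open>n\<close> and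
    from \<open>R\<close> to \<open>R'\<close> moves a point by at most \<open>b\<close> each, and
    the cell diameter accounts for the rest.\<close>
  have e: "real n *\<^sub>R w - R *\<^sub>R x' = (real n - R) *\<^sub>R x' + (t * (real n / R')) *\<^sub>R ((y - R *\<^sub>R x') + (R - R') *\<^sub>R x')"
  proof -
    have w': "w = x' + t *\<^sub>R (y' - x')" by (simp add: t(3) algebra_simps)
    have "(y - R *\<^sub>R x') + (R - R') *\<^sub>R x' = R' *\<^sub>R (y' - x')" by (simp add: yy algebra_simps)
    then have "(t * (real n / R')) *\<^sub>R ((y - R *\<^sub>R x') + (R - R') *\<^sub>R x') = (t * real n) *\<^sub>R (y' - x')"
      using pos by simp
    moreover have "real n *\<^sub>R w - R *\<^sub>R x' = (real n - R) *\<^sub>R x' + (t * real n) *\<^sub>R (y' - x')"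
      unfolding w' by (simp add: algebra_simps)
    ultimately show ?thesis by simp
  qed
  have b: "b \<ge> 0" using nx norm_ge_zero[of x'] by linarith
  have k: "0 \<le> t * (real n / R')" "t * (real n / R') \<le> 1"
  proof -
    show "0 \<le> t * (real n / R')" using t pos by simp
    have "real n / R' \<le> 1" using pos R by simp
    then show "t * (real n / R') \<le> 1" using t pos by (intro mult_le_one) auto
  qed
  have s: "\<bar>q\<bar> * norm x' \<le> b" if "\<bar>q\<bar> \<le> 1" for q :: real
    using mult_mono[OF that nx] b by simp
  have "norm (real n *\<^sub>R w - R *\<^sub>R x') \<le> norm ((real n - R) *\<^sub>R x') +
      norm ((t * (real n / R')) *\<^sub>R ((y - R *\<^sub>R x') + (R - R') *\<^sub>R x'))"
    unfolding e by (rule norm_triangle_ineq)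
  also have "norm ((real n - R) *\<^sub>R x') \<le> b" using s[of "real n - R"] R by simp
  also have "norm ((t * (real n / R')) *\<^sub>R ((y - R *\<^sub>R x') + (R - R') *\<^sub>R x')) \<le>
      norm ((y - R *\<^sub>R x') + (R - R') *\<^sub>R x')"
    using mult_right_mono[OF k(2) norm_ge_zero]
    unfolding norm_scaleR abs_of_nonneg[OF k(1)] mult_1_left .
  also have "\<dots> \<le> norm (y - R *\<^sub>R x') + norm ((R - R') *\<^sub>R x')" by (rule norm_triangle_ineq)
  also have "\<dots> \<le> real CARD('n) * r + b" using d s[of "R - R'"] R by (intro add_mono) auto
  finally have "dist (R *\<^sub>R x') (real n *\<^sub>R w) \<le> 2 * b + real CARD('n) * r"
    by (simp add: dist_norm norm_minus_commute)
  then show False using z x w(2) unfolding boundary_cells_def by blast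
qed

text \<open>Volume sandwich: the inner cells are contained in the scaled domain, which is covered by
  inner and boundary cells together.\<close>

lemma card_inner_cells_tendsto:
  fixes D :: "(real ^ 'n) set"
  assumes r: "r > 0" and D: "D \<in> lipschitz_sets"
  shows "(\<lambda>n. real (card (inner_cells r D n)) / real n ^ CARD('n)) \<longlonglongrightarrow> measure lborel D / r ^ CARD('n)"
proof -
  let ?\<mu> = "measure lborel D / r ^ CARD('n)"
  have rd: "r ^ CARD('n) > 0" using r by simp
  obtain b where b: "\<And>x. x \<in> D \<Longrightarrow> norm x \<le> b" using lipschitz_setsD(2)[OF D] by (auto simp: bounded_iff)
  have b0: "b \<ge> 0" using lipschitz_setsD(1)[OF D] b norm_ge_zero order_trans by blast
  let ?c = "2 * b + real CARD('n) * r"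
  let ?I = "\<lambda>n. real (card (inner_cells r D n)) / real n ^ CARD('n)"
  let ?B = "\<lambda>n. real (card (boundary_cells r ?c D n)) / real n ^ CARD('n)"
  have B: "?B \<longlonglongrightarrow> 0" using b0 r by (intro card_boundary_cells_tendsto r D) simp
  have up: "?I n \<le> ?\<mu>" if "n \<ge> 1" for n
    using card_inner_cells_le[OF r D, of n] rd that by (simp add: field_simps)
  have low: "?\<mu> - ?B n \<le> ?I n" if n: "n \<ge> 1" for n
  proof -
    have n0: "real n > 0" using n by simp
    note bD = lipschitz_setsD(2,3)[OF D]
    let ?Z = "inner_cells r D n \<union> boundary_cells r ?c D n"
    have fin: "finite ?Z" using finite_inner_cells[OF r bD(1)] finite_boundary_cells[OF r D] by simp
    have sub: "(*\<^sub>R) (real n) ` D \<subseteq> (\<Union>z\<in>?Z. cell r z)"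
    proof
      fix x assume x: "x \<in> (*\<^sub>R) (real n) ` D"
      let ?z = "cell_index r x"
      have xz: "x \<in> cell r ?z" using mem_cell_iff[OF r] by blast
      have "cell r ?z \<subseteq> (*\<^sub>R) (real n) ` D" if "?z \<notin> boundary_cells r ?c D n"
      proof (rule cell_not_boundary[OF r b _ _ _ _ _ that])
        show "cell r ?z \<inter> (*\<^sub>R) (real n) ` D \<noteq> {}" using x xz by blast
      qed (use n in auto)
      then have "?z \<in> ?Z" by (auto simp: inner_cells_def)
      then show "x \<in> (\<Union>z\<in>?Z. cell r z)" using xz by blast
    qed
    have "real n ^ CARD('n) * measure lborel D = measure lborel ((*\<^sub>R) (real n) ` D)"
      by (simp add: measure_scale[OF n0 bD(2)])
    also have "\<dots> \<le> measure lborel (\<Union>z\<in>?Z. cell r z)"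
    proof (rule measure_mono_fmeasurable[OF sub])
      show "(*\<^sub>R) (real n) ` D \<in> sets lborel" using borel_scale[OF n0 bD(2)] by simp
      show "(\<Union>z\<in>?Z. cell r z) \<in> fmeasurable lborel"
        using fin by (intro fmeasurable_lborel_bounded bounded_UN sets.finite_UN) auto
    qed
    also have "\<dots> = real (card ?Z) * r ^ CARD('n)" by (rule measure_UN_cells[OF r fin])
    also have "\<dots> \<le> (real (card (inner_cells r D n)) + real (card (boundary_cells r ?c D n))) * r ^ CARD('n)"
      using card_Un_le[of "inner_cells r D n" "boundary_cells r ?c D n"] rd
      by (intro mult_right_mono) linarith+
    finally have h: "real n ^ CARD('n) * measure lborel D \<le>
      (real (card (inner_cells r D n)) + real (card (boundary_cells r ?c D n))) * r ^ CARD('n)" .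
    have N: "real n ^ CARD('n) > 0" using n0 by simp
    have "?\<mu> \<le> (real (card (inner_cells r D n)) + real (card (boundary_cells r ?c D n))) / real n ^ CARD('n)"
      unfolding pos_divide_le_eq[OF rd] times_divide_eq_left pos_le_divide_eq[OF N]
      using h by (simp add: mult.commute)
    then show ?thesis by (simp add: add_divide_distrib)
  qed
  show ?thesis
  proof (rule tendsto_sandwich[where f = "\<lambda>n. ?\<mu> - ?B n" and h = "\<lambda>_. ?\<mu>"])
    show "eventually (\<lambda>n. ?\<mu> - ?B n \<le> ?I n) sequentially" using low by (intro eventually_sequentiallyI)
    show "eventually (\<lambda>n. ?I n \<le> ?\<mu>) sequentially" using up by (intro eventually_sequentiallyI)
    show "(\<lambda>n. ?\<mu> - ?B n) \<longlonglongrightarrow> ?\<mu>" using tendsto_diff[OF tendsto_const B] by simp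
  qed simp
qed

section \<open>The parking process restricted to cells\<close>

text \<open>Pigeonhole with cells so small that each holds at most one point; a cube of side
  \<open>s \<ge> 1\<close> meets at most \<open>s / l + 2 \<le> s * (1 / l + 2)\<close> of them in
  every direction.\<close>

lemma hard_core_bounded_density:
  fixes \<rho> :: real
  assumes \<rho>: "\<rho> > 0"
  shows "\<exists>K\<ge>0. \<forall>Z :: (real ^ 'n) set. (\<forall>x\<in>Z. \<forall>y\<in>Z. x \<noteq> y \<longrightarrow> 2 * \<rho> \<le> dist x y) \<longrightarrow> bounded_density K Z"
proof -
  \<comment> \<open>The diameter of such a cell is at most \<rho>, below the separation
    \<open>2 * \<rho>\<close>.\<close>
  define l where "l = \<rho> / real CARD('n)"
  have l: "l > 0" "real CARD('n) * l = \<rho>" using \<rho> by (simp_all add: l_def)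
  define K where "K = (1 / l + 2) ^ CARD('n)"
  have K: "K \<ge> 0" using l by (simp add: K_def)
  have "bounded_density K Z" if Z: "\<forall>x\<in>Z. \<forall>y\<in>Z. x \<noteq> y \<longrightarrow> 2 * \<rho> \<le> dist x y" for Z :: "(real ^ 'n) set"
    unfolding bounded_density_def
  proof (intro conjI allI impI)
    show lf: "locally_finite Z"
      unfolding locally_finite_def
    proof (intro allI impI)
      fix B :: "(real ^ 'n) set" assume "bounded B"
      then show "finite (Z \<inter> B)"
        using Z \<rho> by (intro finite_hard_core_Int_bounded[of "2 * \<rho>"]) auto
    qed
    fix a :: "real ^ 'n" and s :: real assume s: "s \<ge> 1"
    let ?I = "\<lambda>i. {\<lfloor>a $ i / l\<rfloor>..\<lfloor>(a $ i + s) / l\<rfloor>}"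
    have inj: "inj_on (cell_index l) (Z \<inter> cube a s)"
    proof (rule inj_onI, rule ccontr)
      fix x y assume xy: "x \<in> Z \<inter> cube a s" "y \<in> Z \<inter> cube a s" "cell_index l x = cell_index l y" "x \<noteq> y"
      have "x \<in> cell l (cell_index l x)" "y \<in> cell l (cell_index l x)"
        unfolding mem_cell_iff[OF l(1)] using xy(3) by simp_all
      then have "dist x y \<le> real CARD('n) * l" by (rule dist_cell[OF l(1)])
      then show False using Z xy l \<rho> by fastforce
    qed
    have sub: "cell_index l ` (Z \<inter> cube a s) \<subseteq> PiE UNIV ?I"
    proof (rule image_subsetI)
      fix x assume "x \<in> Z \<inter> cube a s"
      then have "a $ i \<le> x $ i" "x $ i \<le> a $ i + s" for i by (auto simp: cube_def less_imp_le)
      then have "\<lfloor>x $ i / l\<rfloor> \<in> ?I i" for i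
        using l by (auto intro!: floor_mono divide_right_mono)
      then show "cell_index l x \<in> PiE UNIV ?I" by (auto simp: cell_index_def)
    qed
    have fin: "finite (PiE UNIV ?I)" by (intro finite_PiE) auto
    have "card (Z \<inter> cube a s) \<le> card (PiE UNIV ?I)" by (rule card_inj_on_le[OF inj sub fin])
    also have "card (PiE UNIV ?I) = (\<Prod>i\<in>UNIV. card (?I i))" by (simp add: card_PiE)
    finally have "real (card (Z \<inter> cube a s)) \<le> (\<Prod>i\<in>(UNIV :: 'n set). real (card (?I i)))"
      by (simp flip: of_nat_prod del: card_atLeastAtMost_int)
    also have "\<dots> \<le> (\<Prod>i\<in>(UNIV :: 'n set). s * (1 / l + 2))"
    proof (intro prod_mono conjI)
      fix i
      have "real (card (?I i)) = of_int (\<lfloor>(a $ i + s) / l\<rfloor> + 1 - \<lfloor>a $ i / l\<rfloor>)"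
      proof -
        have "\<lfloor>a $ i / l\<rfloor> \<le> \<lfloor>(a $ i + s) / l\<rfloor>" using l s by (intro floor_mono divide_right_mono) auto
        then show ?thesis by simp
      qed
      also have "\<dots> \<le> (a $ i + s) / l - a $ i / l + 2"
        using of_int_floor_le[of "(a $ i + s) / l"] floor_correct[of "a $ i / l"] by simp linarith
      also have "\<dots> = s / l + 2" by (simp add: add_divide_distrib)
      also have "\<dots> \<le> s * (1 / l + 2)" using s by (simp add: distrib_left)
      finally show "real (card (?I i)) \<le> s * (1 / l + 2)" .
    qed simp
    also have "\<dots> = K * s ^ CARD('n)" by (simp add: K_def power_mult_distrib)
    finally show "real (card (Z \<inter> cube a s)) \<le> K * s ^ CARD('n)" .
  qed
  with K show ?thesis by blast
qed

lemma random_parking_hard_core: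
  assumes "\<rho> > 0" "x \<in> random_parking \<rho> A V" "y \<in> random_parking \<rho> A V" "x \<noteq> y"
  shows "2 * \<rho> \<le> dist x y"
  using assms accepted_hard_core[OF assms(1)] unfolding random_parking_eq by blast

text \<open>Up to \<epsilon> the constant suffices; beyond it \<open>x powr (\<theta> - 1)\<close>
  is decreasing. The concave power becomes affine, so that means and the strong law for counts can
  be used.\<close>

lemma powr_interpolate:
  fixes x \<epsilon> \<theta> :: real
  assumes "x \<ge> 0" "\<epsilon> > 0" "0 < \<theta>" "\<theta> < 1"
  shows "x powr \<theta> \<le> \<epsilon> powr \<theta> + \<epsilon> powr (\<theta> - 1) * x"
proof (cases "x \<le> \<epsilon>")
  case True
  then have "x powr \<theta> \<le> \<epsilon> powr \<theta>" using assms by (intro powr_mono2) auto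
  moreover have "0 \<le> \<epsilon> powr (\<theta> - 1) * x" using assms by simp
  ultimately show ?thesis by linarith
next
  case False
  then have x: "x > 0" using assms by simp
  have "x powr \<theta> = x powr (\<theta> - 1) * x" using x by (simp add: powr_diff)
  also have "\<dots> \<le> \<epsilon> powr (\<theta> - 1) * x"
    using x assms False by (intro mult_right_mono powr_mono2') auto
  finally show ?thesis using powr_ge_zero[of \<epsilon> \<theta>] by linarith
qed

lemma translate_cube: "(+) v ` cube a s = cube (v + a) s"
proof (rule set_eqI)
  fix x
  have "x \<in> (+) v ` cube a s \<longleftrightarrow> x - v \<in> cube a s"
    by (metis add_diff_cancel_left' diff_add_cancel add.commute mem_translate)
  also have "\<dots> \<longleftrightarrow> x \<in> cube (v + a) s" by (simp add: cube_def algebra_simps)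
  finally show "x \<in> (+) v ` cube a s \<longleftrightarrow> x \<in> cube (v + a) s" .
qed

text \<open>Cell sides are integers from here on, so that a cell is exactly a union of unit
  cells.\<close>

definition fine_index :: "nat \<Rightarrow> ('n \<Rightarrow> int) \<Rightarrow> ('n \<Rightarrow> int) \<Rightarrow> 'n \<Rightarrow> int" where
  "fine_index r z g = (\<lambda>i. int r * z i + g i)"

lemma subcube_lattice: "subcube (lattice_point s z) s g = cell s (\<lambda>i. z i + g i)"
proof -
  have "lattice_point s z + lattice_point s g = lattice_point s (\<lambda>i. z i + g i)"
    by (simp add: lattice_point_def vec_eq_iff distrib_left)
  then show ?thesis by (simp add: subcube_def cell_def)
qed

lemma cell_eq_UN_fine: "cell (real r) z = (\<Union>g\<in>grid r. cell 1 (fine_index r z g))"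
proof -
  have "lattice_point (real r) z = lattice_point 1 (\<lambda>i. int r * z i)"
    by (simp add: lattice_point_def vec_eq_iff)
  then have "cell (real r) z = cube (lattice_point 1 (\<lambda>i. int r * z i)) (real r * 1)" by (simp add: cell_def)
  also have "\<dots> = (\<Union>g\<in>grid r. subcube (lattice_point 1 (\<lambda>i. int r * z i)) 1 g)"
    by (rule cube_eq_UN_subcubes) simp
  finally show ?thesis by (simp add: subcube_lattice fine_index_def)
qed

lemma translate_cell: "(+) (lattice_point s z) ` cell s w = cell s (\<lambda>i. z i + w i)"
  unfolding cell_def translate_cube
  by (rule arg_cong[where f = "\<lambda>a. cube a s"]) (simp add: lattice_point_def vec_eq_iff distrib_left)

text \<open>\<open>K\<close> bounds the density of every hard-core set, so it serves all regions and
  all realisations at once.\<close>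

locale parking = functionals d p S T
  for d p and S T :: "'n::{finite,linorder} functional" +
  fixes \<rho> :: real and M :: "'w measure"
    and P :: "'w \<Rightarrow> ((real ^ 'n::{finite,linorder}) \<times> real) set" and K :: real
  assumes \<rho>: "\<rho> > 0" and U: "unit_poisson_process M (UNIV \<times> {0..}) P"
    and K0: "K \<ge> 0"
    and K: "\<And>Z :: (real, 'n) vec set. (\<forall>x\<in>Z. \<forall>y\<in>Z. x \<noteq> y \<longrightarrow> 2 * \<rho> \<le> dist x y) \<Longrightarrow> bounded_density K Z"
begin

sublocale prob_space M by (rule unit_poisson_processD(1)[OF U])

lemma theta: "0 < \<theta>" "\<theta> < 1"
  using p by (simp_all add: field_simps)

lemma density_parking:
  fixes A :: "(real, 'n) vec set"
  shows "bounded_density K (random_parking \<rho> A V)"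
  using random_parking_hard_core[OF \<rho>] by (intro K) blast

lemma lf_parking:
  fixes A :: "(real, 'n) vec set"
  shows "locally_finite (random_parking \<rho> A V)"
  by (rule bounded_densityD(1)[OF density_parking])

definition cell_value :: "nat \<Rightarrow> ('n \<Rightarrow> int) \<Rightarrow> ((real, 'n) vec \<times> real) set \<Rightarrow> real" where
  "cell_value r z V = S (cell (real r) z) (random_parking \<rho> (cell (real r) z) V)"

definition undetermined_cells :: "nat \<Rightarrow> ('n \<Rightarrow> int) \<Rightarrow> ((real, 'n) vec \<times> real) set \<Rightarrow> real" where
  "undetermined_cells r z V = (\<Sum>g\<in>grid r. of_bool (\<not> determined \<rho> (cell 1 (fine_index r z g)) (cell (real r) z) V))"

lemma undetermined_cells_nonneg: "undetermined_cells r z V \<ge> 0"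
  unfolding undetermined_cells_def by (intro sum_nonneg) simp

lemma undetermined_cells_le: "undetermined_cells r z V \<le> real r ^ d"
proof -
  have "undetermined_cells r z V \<le> (\<Sum>g\<in>(grid r :: ('n \<Rightarrow> int) set). 1)" unfolding undetermined_cells_def by (intro sum_mono) simp
  then show ?thesis by (simp add: card_grid_d)
qed

text \<open>All points of \<open>X\<close> lie in undetermined unit cells, and bounded density with
  side 1 allows at most \<open>K\<close> in each.\<close>

lemma card_undetermined_le:
  assumes X: "bounded_density K X" "X \<subseteq> cell (real r) z"
    and empty: "\<And>g. g \<in> grid r \<Longrightarrow> determined \<rho> (cell 1 (fine_index r z g)) (cell (real r) z) V \<Longrightarrow>
      X \<inter> cell 1 (fine_index r z g) = {}"
  shows "real (card X) \<le> K * undetermined_cells r z V"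
proof -
  have eq: "X = (\<Union>g\<in>grid r. X \<inter> cell 1 (fine_index r z g))"
    using X(2) unfolding cell_eq_UN_fine by blast
  have "card X \<le> (\<Sum>g\<in>grid r. card (X \<inter> cell 1 (fine_index r z g)))"
    by (subst eq) (rule card_UN_le, simp)
  then have "real (card X) \<le> (\<Sum>g\<in>grid r. real (card (X \<inter> cell 1 (fine_index r z g))))"
    by (simp flip: of_nat_sum)
  also have "\<dots> \<le> (\<Sum>g\<in>grid r. K * of_bool (\<not> determined \<rho> (cell 1 (fine_index r z g)) (cell (real r) z) V))"
  proof (rule sum_mono)
    fix g :: "'n \<Rightarrow> int" assume g: "g \<in> grid r"
    show "real (card (X \<inter> cell 1 (fine_index r z g))) \<le>
        K * of_bool (\<not> determined \<rho> (cell 1 (fine_index r z g)) (cell (real r) z) V)"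
    proof (cases "determined \<rho> (cell 1 (fine_index r z g)) (cell (real r) z) V")
      case True then show ?thesis using empty[OF g True] by simp
    next
      case False
      then show ?thesis using bounded_densityD(2)[OF X(1), of 1 "lattice_point 1 (fine_index r z g)"]
        by (simp add: cell_def)
    qed
  qed
  also have "\<dots> = K * undetermined_cells r z V" by (simp add: undetermined_cells_def sum_distrib_left)
  finally show ?thesis .
qed

text \<open>By smoothness the difference is at most a multiple of \<open>r powr p\<close> times the \<open>\<theta>\<close>-th power of the number
  of differing points, and \<open>p + d * \<theta> = d\<close>, so that
  interpolating \<open>x powr \<theta>\<close> between a constant and \<open>x\<close> keeps the order of the volume.\<close>

lemma cell_estimate:
  assumes \<kappa>: "\<kappa> > 0"
  shows "\<exists>H\<ge>0. \<forall>r\<ge>1. \<forall>z V A. parking_wf \<rho> V \<longrightarrow> cell (real r) z \<subseteq> A \<longrightarrow>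
    \<bar>S (cell (real r) z) (random_parking \<rho> A V) - cell_value r z V\<bar> \<le> \<kappa> * real r ^ d + H * undetermined_cells r z V"
proof -
  obtain C where C: "C > 0" "\<And>a s \<zeta> \<zeta>'. s > 0 \<Longrightarrow> locally_finite \<zeta> \<Longrightarrow> locally_finite \<zeta>' \<Longrightarrow>
    \<bar>S (cube a s) (\<zeta> \<union> \<zeta>') - S (cube a s) \<zeta>\<bar> \<le> C * s powr p * real (card (\<zeta>' \<inter> cube a s)) powr \<theta>"
    by (fact smooth_cube)
  \<comment> \<open>Chosen so that the constant part of the interpolation contributes exactly
    \<kappa>.\<close>
  define \<epsilon> where "\<epsilon> = (\<kappa> / (2 * C)) powr (1 / \<theta>)"
  have \<epsilon>: "\<epsilon> > 0" using \<kappa> C(1) by (simp add: \<epsilon>_def)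
  have \<epsilon>\<theta>: "2 * C * \<epsilon> powr \<theta> = \<kappa>"
  proof -
    have "1 / t * t = 1" if "t > 0" for t :: real using that by simp
    from this[OF theta(1)] show ?thesis unfolding \<epsilon>_def powr_powr using \<kappa> C(1) by (simp only:) simp
  qed
  define H where "H = 2 * C * \<epsilon> powr (\<theta> - 1) * K"
  have H: "H \<ge> 0" using C(1) K0 by (simp add: H_def)
  have "\<bar>S (cell (real r) z) (random_parking \<rho> A V) - cell_value r z V\<bar> \<le> \<kappa> * real r ^ d + H * undetermined_cells r z V"
    if r: "r \<ge> 1" and wf: "parking_wf \<rho> V" and A: "cell (real r) z \<subseteq> A" for r z V A
  proof -
    let ?Q = "cell (real r) z"
    let ?x = "random_parking \<rho> A V" and ?y = "random_parking \<rho> ?Q V"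
    let ?B = "C * real r powr p * (K * undetermined_cells r z V) powr \<theta>"
    have r0: "real r > 0" using r by simp
    have agree: "?x \<inter> cell 1 (fine_index r z g) = ?y \<inter> cell 1 (fine_index r z g)"
      if "g \<in> grid r" "determined \<rho> (cell 1 (fine_index r z g)) ?Q V" for g
      by (rule random_parking_determined[OF \<rho> wf A that(2)]) (use that(1) in \<open>unfold cell_eq_UN_fine, blast\<close>)
    \<comment> \<open>Smoothness compares a set only with a larger one, so the two configurations
      are both compared with their intersection.\<close>
    have one: "\<bar>S ?Q u - S ?Q (u \<inter> w)\<bar> \<le> ?B"
      if u: "bounded_density K u" and w: "locally_finite w"
        and ag: "\<And>g. g \<in> grid r \<Longrightarrow> determined \<rho> (cell 1 (fine_index r z g)) ?Q V \<Longrightarrow>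
          u \<inter> cell 1 (fine_index r z g) = w \<inter> cell 1 (fine_index r z g)" for u w
    proof -
      have lu: "locally_finite u" by (rule bounded_densityD(1)[OF u])
      have l: "locally_finite (u \<inter> w)" "locally_finite (u - w)"
        by (rule locally_finite_subset[OF lu]; blast)+
      have "real (card ((u - w) \<inter> ?Q)) \<le> K * undetermined_cells r z V"
      proof (rule card_undetermined_le)
        show "bounded_density K ((u - w) \<inter> ?Q)" by (rule bounded_density_subset[OF u]) blast
        show "(u - w) \<inter> ?Q \<inter> cell 1 (fine_index r z g) = {}"
          if "g \<in> grid r" "determined \<rho> (cell 1 (fine_index r z g)) ?Q V" for g
          using ag[OF that] by blast
      qed blast
      then have "real (card ((u - w) \<inter> ?Q)) powr \<theta> \<le> (K * undetermined_cells r z V) powr \<theta>"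
        using theta by (intro powr_mono2) auto
      then have "C * real r powr p * real (card ((u - w) \<inter> ?Q)) powr \<theta> \<le> ?B"
        using C(1) by (intro mult_left_mono) auto
      moreover have "(u \<inter> w) \<union> (u - w) = u" by blast
      ultimately show ?thesis using C(2)[OF r0 l, of "lattice_point (real r) z"] unfolding cell_def by simp
    qed
    have "\<bar>S ?Q ?x - S ?Q (?x \<inter> ?y)\<bar> \<le> ?B"
      by (rule one[OF density_parking lf_parking agree])
    moreover have "\<bar>S ?Q ?y - S ?Q (?y \<inter> ?x)\<bar> \<le> ?B"
      by (rule one[OF density_parking lf_parking agree[symmetric]])
    ultimately have "\<bar>S ?Q ?x - S ?Q ?y\<bar> \<le> 2 * ?B" unfolding Int_commute[of ?y ?x] by linarith
    \<comment> \<open>The volume is taken out of the power, leaving the fraction of undetermined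
      unit cells as the variable to be interpolated.\<close>
    also have "2 * ?B = 2 * C * ((K * (undetermined_cells r z V / real r ^ d)) powr \<theta> * real r ^ d)"
      using powr_combine[OF r0, of "K * (undetermined_cells r z V / real r ^ d)"] K0 undetermined_cells_nonneg[of r z V] r0
      by (simp add: mult.assoc)
    also have "\<dots> \<le> 2 * C * ((\<epsilon> powr \<theta> + \<epsilon> powr (\<theta> - 1) * (K * (undetermined_cells r z V / real r ^ d))) * real r ^ d)"
      using C(1) K0 undetermined_cells_nonneg[of r z V] \<epsilon> theta
      by (intro mult_left_mono mult_right_mono powr_interpolate) auto
    also have "\<dots> = (2 * C * \<epsilon> powr \<theta>) * real r ^ d + H * undetermined_cells r z V"
      using r0 by (simp add: H_def algebra_simps)
    finally show ?thesis unfolding \<epsilon>\<theta> cell_value_def .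
  qed
  with H show ?thesis by blast
qed

section \<open>Measurability and stationarity of the cell variables\<close>

lemma cell_lipschitz: "r \<ge> 1 \<Longrightarrow> cell (real r) z \<in> lipschitz_sets"
  unfolding cell_def by (rule cube_lipschitz) simp

lemma measurable_cell_value:
  assumes "r \<ge> 1" shows "cell_value r z \<in> borel_measurable (configurations (over (cell (real r) z)))"
proof -
  have "random_parking \<rho> (cell (real r) z) \<in> measurable (configurations (over (cell (real r) z))) lf_space"
    by (rule measurable_lf_space[OF random_set_random_parking[OF \<rho>]]) simp
  moreover have "S (cell (real r) z) \<in> borel_measurable lf_space"
    using measS cell_lipschitz[OF assms] unfolding measurable_functional_def by blast
  ultimately have "(\<lambda>V. S (cell (real r) z) (random_parking \<rho> (cell (real r) z) V)) \<in>
      borel_measurable (configurations (over (cell (real r) z)))"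
    by (rule measurable_compose)
  then show ?thesis unfolding cell_value_def[abs_def] .
qed

lemma measurable_undetermined:
  fixes A :: "(real, 'n) vec set"
  assumes "A \<in> sets borel" "c \<in> sets borel"
  shows "(\<lambda>V. of_bool (\<not> determined \<rho> c A V) :: real) \<in> borel_measurable (configurations (over A))"
proof -
  have "over A \<in> sets borel" using assms(1) by (simp add: borel_Times)
  then have "random_set (configurations (over A)) (\<lambda>V. V \<inter> over A)" by (rule random_set_configurations)
  from pred_determined[OF \<rho> this assms(2)]
  have [measurable]: "Measurable.pred (configurations (over A)) (\<lambda>V. determined \<rho> c A V)" .
  show ?thesis by measurable
qed

lemma measurable_undetermined_cells: "undetermined_cells r z \<in> borel_measurable (configurations (over (cell (real r) z)))"
  unfolding undetermined_cells_def[abs_def] by (intro borel_measurable_sum measurable_undetermined) auto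

lemma translate_fine_cell:
  "(+) (lattice_point (real r) z) ` cell 1 (fine_index r (\<lambda>_. 0) g) = cell 1 (fine_index r z g)"
proof -
  have "lattice_point (real r) z = lattice_point 1 (\<lambda>i. int r * z i)"
    by (simp add: lattice_point_def vec_eq_iff)
  then show ?thesis by (simp add: translate_cell fine_index_def)
qed

lemma expectation_cell_value:
  assumes "r \<ge> 1" shows "expectation (\<lambda>\<omega>. cell_value r z (P \<omega>)) = expectation (\<lambda>\<omega>. cell_value r (\<lambda>_. 0) (P \<omega>))"
proof (rule expectation_shift[OF U measurable_cell_value[OF assms], where v = "lattice_point (real r) z"])
  fix V :: "((real, 'n) vec \<times> real) set"
  have c: "cell (real r) z = (+) (lattice_point (real r) z) ` cell (real r) (\<lambda>_. 0)" by (simp add: translate_cell)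
  show "cell_value r z (lift_shift (lattice_point (real r) z) ` V) = cell_value r (\<lambda>_. 0) V"
    unfolding cell_value_def c random_parking_shift[OF \<rho>]
    using tiS cell_lipschitz[OF assms] lf_parking unfolding translation_invariant_def by blast
qed

lemma expectation_undetermined_cells: "expectation (\<lambda>\<omega>. undetermined_cells r z (P \<omega>)) = expectation (\<lambda>\<omega>. undetermined_cells r (\<lambda>_. 0) (P \<omega>))"
proof (rule expectation_shift[OF U measurable_undetermined_cells, where v = "lattice_point (real r) z"])
  fix V :: "((real, 'n) vec \<times> real) set"
  have c: "cell (real r) z = (+) (lattice_point (real r) z) ` cell (real r) (\<lambda>_. 0)" by (simp add: translate_cell)
  show "undetermined_cells r z (lift_shift (lattice_point (real r) z) ` V) = undetermined_cells r (\<lambda>_. 0) V"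
    unfolding undetermined_cells_def c translate_fine_cell[of r z, symmetric] determined_shift[OF \<rho>] ..
qed

text \<open>The unit cell at the origin with \<open>L\<close> further unit cells on every
  side.\<close>

definition window :: "nat \<Rightarrow> (real, 'n) vec set" where
  "window L = cube (lattice_point 1 (\<lambda>_. - int L)) (2 * real L + 1)"

text \<open>All unit cells at distance at least \<open>L\<close> from the boundary of a large cell are, up to a translation, no
  less determined than the central cell of the window, so \<open>defect L\<close> bounds their contribution.\<close>

definition defect :: "nat \<Rightarrow> real" where
  "defect L = expectation (\<lambda>\<omega>. of_bool (\<not> determined \<rho> (cell 1 (\<lambda>_. 0)) (window L) (P \<omega>)))"

section \<open>Undetermined cells are rare\<close>

lemma over_subset: "over A \<subseteq> UNIV \<times> {0..}"
  by blast

lemma integrable_undetermined: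
  fixes A :: "(real, 'n) vec set"
  assumes "A \<in> sets borel" "c \<in> sets borel"
  shows "integrable M (\<lambda>\<omega>. of_bool (\<not> determined \<rho> c A (P \<omega>)) :: real)"
proof (rule integrable_const_bound[of _ 1])
  show "(\<lambda>\<omega>. of_bool (\<not> determined \<rho> c A (P \<omega>)) :: real) \<in> borel_measurable M"
    by (rule measurable_compose[OF measurable_configurations[OF U over_subset] measurable_undetermined[OF assms]])
qed simp

lemma eventually_subset_window:
  fixes B :: "(real, 'n) vec set"
  assumes "bounded B" shows "eventually (\<lambda>L. B \<subseteq> window L) sequentially"
proof -
  obtain b where b: "\<And>x. x \<in> B \<Longrightarrow> norm x \<le> b" using assms by (auto simp: bounded_iff)
  obtain L0 :: nat where L0: "b \<le> real L0" using real_arch_simple by blast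
  have "B \<subseteq> window L" if "L \<ge> L0" for L
  proof
    fix x assume "x \<in> B"
    then have "\<bar>x $ i\<bar> \<le> real L" for i
      using component_le_norm_cart[of x i] b[of x] L0 that by (meson of_nat_mono order_trans)
    then have "- real L \<le> x $ i \<and> x $ i < - real L + (2 * real L + 1)" for i
      by (smt (verit))
    then show "x \<in> window L" by (simp add: window_def cube_def lattice_point_def)
  qed
  then show ?thesis unfolding eventually_sequentially by blast
qed

text \<open>Almost surely ancestry is well-founded and the windows exhaust the space, so the
  indicator is eventually zero; dominated convergence by 1 applies.\<close>

lemma defect_tendsto: "defect \<longlonglongrightarrow> 0"
proof -
  have "(\<lambda>L. defect L) \<longlonglongrightarrow> expectation (\<lambda>_. 0)"
    unfolding defect_def
  proof (rule integral_dominated_convergence[where w = "\<lambda>_. 1"])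
    show "AE \<omega> in M. (\<lambda>L. of_bool (\<not> determined \<rho> (cell 1 (\<lambda>_. 0)) (window L) (P \<omega>))) \<longlonglongrightarrow> (0::real)"
    proof (rule AE_mp[OF AE_parking_wf[OF U \<rho>]], intro AE_I2 impI)
      fix \<omega> assume "parking_wf \<rho> (P \<omega>)"
      then have "eventually (\<lambda>L. determined \<rho> (cell 1 (\<lambda>_. 0)) (window L) (P \<omega>)) sequentially"
        by (intro eventually_determined \<rho> eventually_subset_window) auto
      then show "(\<lambda>L. of_bool (\<not> determined \<rho> (cell 1 (\<lambda>_. 0)) (window L) (P \<omega>))) \<longlonglongrightarrow> (0::real)"
        by (rule tendsto_eventually[OF eventually_mono]) simp
    qed
    show "(\<lambda>\<omega>. of_bool (\<not> determined \<rho> (cell 1 (\<lambda>_. 0)) (window L) (P \<omega>)) :: real) \<in> borel_measurable M" for L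
      by (rule borel_measurable_integrable[OF integrable_undetermined]) (simp_all add: window_def)
  qed simp_all
  then show ?thesis by simp
qed

text \<open>The condition on \<open>g\<close> makes the window translated by \<open>g\<close> fit
  into the large cell. Monotonicity in the region needs well-founded ancestry and so holds almost
  surely; stationarity then moves the window back to the origin.\<close>

lemma expectation_undetermined_le:
  assumes g: "\<And>i. int L \<le> g i \<and> g i < int r - int L"
  shows "expectation (\<lambda>\<omega>. of_bool (\<not> determined \<rho> (cell 1 (fine_index r (\<lambda>_. 0) g)) (cell (real r) (\<lambda>_. 0)) (P \<omega>))) \<le> defect L"
proof -
  let ?v = "lattice_point 1 g :: (real, 'n) vec"
  let ?A = "(+) ?v ` window L"
  let ?c = "cell 1 g :: (real, 'n) vec set"
  have fi: "fine_index r (\<lambda>_. 0) g = g" by (simp add: fine_index_def)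
  have c: "?c = (+) ?v ` cell 1 (\<lambda>_. 0)" by (simp add: translate_cell)
  have A: "?A \<in> sets borel" unfolding window_def translate_cube by simp
  have cA: "?c \<subseteq> ?A"
    unfolding c by (rule image_mono) (auto simp: cell_def window_def cube_def lattice_point_def intro: order_trans[rotated] less_le_trans)
  have sub: "?A \<subseteq> cell (real r) (\<lambda>_. 0)"
  proof
    fix x assume "x \<in> ?A"
    then have x: "real_of_int (g i) - real L \<le> x $ i" "x $ i < real_of_int (g i) - real L + (2 * real L + 1)" for i
      unfolding window_def translate_cube by (simp_all add: cube_def lattice_point_def)
    have "0 \<le> x $ i \<and> x $ i < real r" for i
    proof -
      have "real L \<le> real_of_int (g i)" using g[of i] by linarith
      moreover have "real_of_int (g i) + 1 \<le> real r - real L" using g[of i] by linarith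
      ultimately show ?thesis using x[of i] by linarith
    qed
    then show "x \<in> cell (real r) (\<lambda>_. 0)" by (simp add: cell_def cube_def lattice_point_def)
  qed
  have "expectation (\<lambda>\<omega>. of_bool (\<not> determined \<rho> ?c (cell (real r) (\<lambda>_. 0)) (P \<omega>))) \<le>
      expectation (\<lambda>\<omega>. of_bool (\<not> determined \<rho> ?c ?A (P \<omega>)) :: real)"
  proof (rule integral_mono_AE)
    show "AE \<omega> in M. of_bool (\<not> determined \<rho> ?c (cell (real r) (\<lambda>_. 0)) (P \<omega>)) \<le> (of_bool (\<not> determined \<rho> ?c ?A (P \<omega>)) :: real)"
    proof (rule AE_mp[OF AE_parking_wf[OF U \<rho>]], intro AE_I2 impI)
      fix \<omega> assume wf: "parking_wf \<rho> (P \<omega>)"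
      show "of_bool (\<not> determined \<rho> ?c (cell (real r) (\<lambda>_. 0)) (P \<omega>)) \<le> (of_bool (\<not> determined \<rho> ?c ?A (P \<omega>)) :: real)"
        using determined_mono[OF \<rho> wf sub _ cA] by (cases "determined \<rho> ?c ?A (P \<omega>)") simp_all
    qed
  qed (intro integrable_undetermined A cell_borel)+
  also have "\<dots> = defect L"
    unfolding defect_def
  proof (rule expectation_shift[OF U measurable_undetermined[OF A cell_borel], where v = ?v])
    show "(of_bool (\<not> determined \<rho> ?c ?A (lift_shift ?v ` V)) :: real) =
        of_bool (\<not> determined \<rho> (cell 1 (\<lambda>_. 0)) (window L) V)" for V
      unfolding c determined_shift[OF \<rho>] ..
  qed
  finally show ?thesis unfolding fi .
qed

text \<open>\<open>L\<close> is fixed first to make the defect small. The unit cells within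
  \<open>L\<close> of the boundary are all counted, but their fraction
  \<open>1 - (1 - 2 * L / r) ^ d\<close> vanishes as \<open>r\<close> grows.\<close>

lemma expectation_undetermined_cells_small:
  assumes \<eta>: "\<eta> > 0"
  shows "eventually (\<lambda>r. expectation (\<lambda>\<omega>. undetermined_cells r (\<lambda>_. 0) (P \<omega>)) \<le> \<eta> * real r ^ d) sequentially"
proof -
  obtain L where L: "defect L < \<eta> / 2"
    using order_tendstoD(2)[OF defect_tendsto half_gt_zero[OF \<eta>]] eventually_happens'[OF sequentially_bot] by blast
  have bound: "expectation (\<lambda>\<omega>. undetermined_cells r (\<lambda>_. 0) (P \<omega>)) \<le> real r ^ d - (real r - 2 * real L) ^ d + defect L * real r ^ d"
    if r: "r \<ge> 2 * L" for r
  proof -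
    let ?I = "PiE (UNIV :: 'n set) (\<lambda>_. {int L..<int r - int L})"
    let ?e = "\<lambda>g. expectation (\<lambda>\<omega>. of_bool (\<not> determined \<rho> (cell 1 (fine_index r (\<lambda>_. 0) g)) (cell (real r) (\<lambda>_. 0)) (P \<omega>)) :: real)"
    have IG: "?I \<subseteq> grid r"
    proof
      fix g assume "g \<in> ?I"
      then have "int L \<le> g i \<and> g i < int r - int L" for i by (auto simp: PiE_def Pi_def)
      then have "0 \<le> g i \<and> g i < int r" for i by (smt (verit) of_nat_0_le_iff)
      then show "g \<in> grid r" by (simp add: mem_grid)
    qed
    have cI: "real (card ?I) = (real r - 2 * real L) ^ d"
    proof -
      have "card ?I = (r - 2 * L) ^ CARD('n)" by (simp add: card_PiE) (simp add: nat_diff_distrib' nat_mult_distrib)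
      then show ?thesis using r by (simp add: d_def of_nat_diff)
    qed
    have "expectation (\<lambda>\<omega>. undetermined_cells r (\<lambda>_. 0) (P \<omega>)) = (\<Sum>g\<in>grid r. ?e g)"
      unfolding undetermined_cells_def by (intro Bochner_Integration.integral_sum integrable_undetermined cell_borel)
    also have "\<dots> = (\<Sum>g\<in>grid r - ?I. ?e g) + (\<Sum>g\<in>?I. ?e g)"
      by (rule sum.subset_diff[OF IG]) simp
    also have "\<dots> \<le> (\<Sum>g\<in>grid r - ?I. 1) + (\<Sum>g\<in>?I. defect L)"
    proof (intro add_mono sum_mono)
      fix g :: "'n \<Rightarrow> int"
      have "?e g \<le> expectation (\<lambda>_. 1)" by (intro integral_mono integrable_undetermined cell_borel) auto
      then show "?e g \<le> 1" by (simp add: prob_space)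
    next
      fix g assume "g \<in> ?I"
      then show "?e g \<le> defect L" by (intro expectation_undetermined_le) (auto simp: PiE_def Pi_def)
    qed
    also have "(\<Sum>g\<in>grid r - ?I. 1) = real r ^ d - (real r - 2 * real L) ^ d"
    proof -
      have "card (grid r - ?I) = card (grid r :: ('n \<Rightarrow> int) set) - card ?I"
        using IG finite_subset[OF IG] by (intro card_Diff_subset) auto
      moreover have "card ?I \<le> card (grid r :: ('n \<Rightarrow> int) set)" using IG by (intro card_mono) auto
      ultimately show ?thesis using cI by (simp add: of_nat_diff card_grid_d)
    qed
    also have "(\<Sum>g\<in>?I. defect L) \<le> defect L * real r ^ d"
    proof -
      have "0 \<le> defect L" unfolding defect_def by (intro integral_nonneg_AE) simp
      moreover have "card ?I \<le> card (grid r :: ('n \<Rightarrow> int) set)" using IG by (intro card_mono) auto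
      then have "real (card ?I) \<le> real r ^ d" by (simp add: card_grid_d flip: of_nat_power)
      ultimately have "real (card ?I) * defect L \<le> real r ^ d * defect L" by (intro mult_right_mono)
      then show ?thesis unfolding sum_constant by (simp only: mult.commute)
    qed
    finally show ?thesis by simp
  qed
  have "(\<lambda>r. 1 - (1 - 2 * real L * inverse (real r)) ^ d) \<longlonglongrightarrow> 1 - (1 - 2 * real L * 0) ^ d"
    by (intro tendsto_intros lim_inverse_n)
  then have "eventually (\<lambda>r. 1 - (1 - 2 * real L * inverse (real r)) ^ d < \<eta> / 2) sequentially"
    using \<eta> by (intro order_tendstoD(2)) auto
  moreover have "eventually (\<lambda>r. r \<ge> max 1 (2 * L)) sequentially" by (rule eventually_ge_at_top)
  ultimately show ?thesis
  proof eventually_elim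
    case (elim r)
    have r: "real r > 0" using elim by simp
    have e: "(1 - 2 * real L * inverse (real r)) * real r = real r - 2 * real L" using r by (simp add: field_simps)
    have "(1 - q ^ d) * real r ^ d = real r ^ d - (q * real r) ^ d" for q :: real
      by (simp add: left_diff_distrib power_mult_distrib)
    from this[of "1 - 2 * real L * inverse (real r)"]
    have "(1 - (1 - 2 * real L * inverse (real r)) ^ d) * real r ^ d = real r ^ d - (real r - 2 * real L) ^ d"
      unfolding e .
    moreover have "(1 - (1 - 2 * real L * inverse (real r)) ^ d) * real r ^ d \<le> \<eta> / 2 * real r ^ d"
      using elim by (intro mult_right_mono) auto
    moreover have "defect L * real r ^ d \<le> \<eta> / 2 * real r ^ d" using L by (intro mult_right_mono) auto
    moreover have "expectation (\<lambda>\<omega>. undetermined_cells r (\<lambda>_. 0) (P \<omega>)) \<le> real r ^ d - (real r - 2 * real L) ^ d + defect L * real r ^ d"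
      using elim by (intro bound) simp
    ultimately show ?case by (simp add: field_simps)
  qed
qed

end

section \<open>Convergence of the density\<close>

text \<open>The least admissible exponent overshoots by at most a factor of two, so a dyadic cube
  around the domain has comparable volume.\<close>

lemma ex_power2_scale:
  fixes x r :: real
  assumes "r > 0" "x \<ge> 0"
  shows "\<exists>k. x \<le> 2 ^ k * r \<and> 2 ^ k * r \<le> 2 * x + r"
proof -
  obtain k0 :: nat where "x / r < 2 ^ k0" using real_arch_pow[of 2 "x / r"] by auto
  then have ex: "x \<le> 2 ^ k0 * r" using assms by (simp add: pos_divide_less_eq less_imp_le)
  define k where "k = (LEAST k. x \<le> 2 ^ k * r)"
  have k: "x \<le> 2 ^ k * r" unfolding k_def using ex by (rule LeastI)
  show ?thesis
  proof (cases k)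
    case 0
    then show ?thesis using k assms by (intro exI[of _ 0]) simp
  next
    case (Suc j)
    then have "\<not> x \<le> 2 ^ j * r" using not_less_Least[of j "\<lambda>k. x \<le> 2 ^ k * r"] k_def by simp
    then show ?thesis using k Suc assms by (intro exI[of _ k]) simp
  qed
qed

context parking
begin

text \<open>By localization the trace on the scaled domain is studied in a dyadic cube of lattice
  cells, where near additivity applies. Inner cells are replaced by their restricted values, outer
  cells are empty and give \<open>c\<^sub>0\<close>, boundary cells are bounded crudely; the
  right-hand side collects these errors. Nothing random is left: \<open>V\<close> is fixed, and only
  the count of undetermined cells remains to be averaged.\<close>

lemma cell_sum_estimate:
  fixes D :: "(real, 'n) vec set" and b \<epsilon> \<kappa> H C R :: real and r n :: nat
  assumes D: "D \<in> lipschitz_sets" and b: "b \<ge> 1" "\<And>x. x \<in> D \<Longrightarrow> norm x < b"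
    and r: "r \<ge> 1" and \<epsilon>: "\<epsilon> \<ge> 0"
    and na: "\<And>k a \<zeta>. bounded_density K \<zeta> \<Longrightarrow>
      \<bar>S (cube a (2 ^ k * real r)) \<zeta> - (\<Sum>z\<in>grid (2 ^ k). S (subcube a (real r) z) \<zeta>)\<bar> \<le> \<epsilon> * (2 ^ k * real r) ^ d"
    and \<kappa>: "\<kappa> \<ge> 0" and H: "H \<ge> 0"
    and ce: "\<And>z V A. parking_wf \<rho> V \<Longrightarrow> cell (real r) z \<subseteq> A \<Longrightarrow>
      \<bar>S (cell (real r) z) (random_parking \<rho> A V) - cell_value r z V\<bar> \<le> \<kappa> * real r ^ d + H * undetermined_cells r z V"
    and C: "C \<ge> 0"
    and sb: "\<And>a s \<zeta>. s \<ge> 1 \<Longrightarrow> bounded_density K \<zeta> \<Longrightarrow> \<bar>S (cube a s) \<zeta> - c\<^sub>0\<bar> \<le> C * s ^ d"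
    and wf: "parking_wf \<rho> V" and n: "n \<ge> r"
    and R: "real n \<le> R" "R \<le> real n + 1" and A: "(*\<^sub>R) R ` D \<subseteq> A"
  shows "\<bar>S ((*\<^sub>R) R ` D) (random_parking \<rho> A V) - (\<Sum>z\<in>inner_cells (real r) D n. cell_value r z V)\<bar> \<le>
    (\<epsilon> + \<bar>c\<^sub>0\<bar> / real r ^ d) * (12 * b * real n) ^ d +
    (\<Sum>z\<in>inner_cells (real r) D n. \<kappa> * real r ^ d + H * undetermined_cells r z V) +
    2 * (\<bar>c\<^sub>0\<bar> + C * real r ^ d) * real (card (boundary_cells (real r) (2 * b + real CARD('n) * real r) D n))"
proof -
  have r0: "real r > 0" "real r \<ge> 1" and n0: "n > 0" "real n \<ge> 1" and R0: "R > 0" using r n R by auto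
  let ?RD = "(*\<^sub>R) R ` D"
  let ?x = "random_parking \<rho> A V"
  let ?I = "inner_cells (real r) D n"
  let ?B = "boundary_cells (real r) (2 * b + real CARD('n) * real r) D n"
  let ?c = "\<lambda>z. cell (real r) z :: (real, 'n) vec set"
  \<comment> \<open>Cutting to the domain makes the values on the domain and on any cube around it
    agree.\<close>
  define \<zeta> where "\<zeta> = ?x \<inter> ?RD"
  have dens: "bounded_density K \<zeta>" unfolding \<zeta>_def by (rule bounded_density_subset[OF density_parking]) blast
  have lf: "locally_finite \<zeta>" by (rule bounded_densityD(1)[OF dens])
  obtain k where k: "(real n + 1) * b \<le> 2 ^ k * real r" "2 ^ k * real r \<le> 2 * ((real n + 1) * b) + real r"
    using ex_power2_scale[of "real r" "(real n + 1) * b"] r0 b(1) by auto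
  \<comment> \<open>The cube of side \<open>2 ^ Suc k * r\<close> centred at the origin; its corner
    is a lattice point, so its subcubes are cells.\<close>
  define a where "a = (lattice_point (real r) (\<lambda>_. - (2 ^ k)) :: (real, 'n) vec)"
  let ?Q = "cube a (2 ^ Suc k * real r)"
  \<comment> \<open>With \<open>n + 1 \<le> 2 * n\<close> and \<open>r \<le> n * b\<close> the side
    is at most \<open>10 * b * n\<close>; 12 is generous.\<close>
  have side: "2 ^ Suc k * real r \<le> 12 * b * real n"
  proof -
    have "real r \<le> real n * b" using n b(1) mult_mono[of "real r" "real n" 1 b] by simp
    moreover have "(real n + 1) * b \<le> 2 * (real n * b)" using n0 b(1) mult_right_mono[of 1 "real n" b] by (simp add: distrib_right)
    moreover have "0 \<le> real n * b" using b(1) by simp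
    ultimately have "2 * (2 ^ k * real r) \<le> 12 * (real n * b)" using k(2) by linarith
    then show ?thesis by (simp add: mult.commute mult.left_commute)
  qed
  have RDQ: "?RD \<subseteq> ?Q"
  proof
    fix y assume "y \<in> ?RD"
    then obtain x where x: "x \<in> D" "y = R *\<^sub>R x" by blast
    have "\<bar>y $ i\<bar> < 2 ^ k * real r" for i
    proof -
      have "\<bar>y $ i\<bar> \<le> norm y" by (rule component_le_norm_cart)
      also have "\<dots> = R * norm x" using R0 by (simp add: x(2))
      also have "\<dots> < R * b" using R0 b(2)[OF x(1)] by simp
      also have "\<dots> \<le> (real n + 1) * b" using R(2) b(1) by (intro mult_right_mono) auto
      finally show ?thesis using k(1) by linarith
    qed
    then have "- (2 ^ k * real r) \<le> y $ i \<and> y $ i < 2 ^ k * real r" for i by (smt (verit))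
    then show "y \<in> ?Q" by (simp add: a_def cube_def lattice_point_def mult.commute)
  qed
  have RDl: "?RD \<in> lipschitz_sets" by (rule lipschitz_sets_scale[OF D R0])
  have Ql: "?Q \<in> lipschitz_sets" using r0 by (intro cube_lipschitz) simp
  have SQ: "S ?RD ?x = S ?Q \<zeta>"
    by (rule S_cong[OF RDl Ql lf_parking lf]) (use RDQ in \<open>unfold \<zeta>_def, blast\<close>)
  define Z where "Z = (\<lambda>g i. - (2 ^ k) + g i) ` (grid (2 ^ Suc k) :: ('n \<Rightarrow> int) set)"
  have inj: "inj (\<lambda>(g :: 'n \<Rightarrow> int) i. - (2 ^ k) + g i)" by (rule injI) (simp add: fun_eq_iff)
  have finZ: "finite Z" by (simp add: Z_def)
  have cardZ: "card Z = (2 ^ Suc k) ^ d"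
    unfolding Z_def by (subst card_image[OF inj_on_subset[OF inj subset_UNIV]]) (simp only: card_grid_d)
  have QZ: "?Q = (\<Union>z\<in>Z. ?c z)"
  proof -
    have "?Q = cube a (real (2 ^ Suc k) * real r)" by simp
    also have "\<dots> = (\<Union>g\<in>grid (2 ^ Suc k). subcube a (real r) g)" by (rule cube_eq_UN_subcubes[OF r0(1)])
    finally show ?thesis unfolding a_def subcube_lattice Z_def image_image .
  qed
  have sumZ: "(\<Sum>g\<in>grid (2 ^ Suc k). S (subcube a (real r) g) \<zeta>) = (\<Sum>z\<in>Z. S (?c z) \<zeta>)"
    unfolding Z_def a_def subcube_lattice by (subst sum.reindex[OF inj_on_subset[OF inj subset_UNIV]]) simp
  have IZ: "?I \<subseteq> Z"
  proof
    fix z assume z: "z \<in> ?I"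
    then have "?c z \<subseteq> (*\<^sub>R) (real n) ` D" by (simp add: inner_cells_def)
    moreover have "(*\<^sub>R) (real n) ` D \<subseteq> ?Q"
    proof
      fix y assume "y \<in> (*\<^sub>R) (real n) ` D"
      then obtain x where x: "x \<in> D" "y = real n *\<^sub>R x" by blast
      have "\<bar>y $ i\<bar> < 2 ^ k * real r" for i
      proof -
        have "\<bar>y $ i\<bar> \<le> norm y" by (rule component_le_norm_cart)
        also have "\<dots> = real n * norm x" by (simp add: x(2))
        also have "\<dots> < real n * b" using n0 b(2)[OF x(1)] by simp
        also have "\<dots> \<le> (real n + 1) * b" using b(1) by (intro mult_right_mono) auto
        finally show ?thesis using k(1) by linarith
      qed
      then have "- (2 ^ k * real r) \<le> y $ i \<and> y $ i < 2 ^ k * real r" for i by (smt (verit))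
      then show "y \<in> ?Q" by (simp add: a_def cube_def lattice_point_def mult.commute)
    qed
    ultimately have "?c z \<subseteq> (\<Union>z\<in>Z. ?c z)" using QZ by blast
    moreover obtain y where y: "y \<in> ?c z" using cell_nonempty[OF r0(1)] by blast
    ultimately obtain z' where "z' \<in> Z" "y \<in> ?c z'" by blast
    then show "z \<in> Z" using y mem_cell_iff[OF r0(1)] by metis
  qed
  have finI: "finite ?I" using IZ finZ by (rule finite_subset)
  have finB: "finite ?B" by (rule finite_boundary_cells[OF r0(1) D])
  have b': "norm x \<le> b" if "x \<in> D" for x using b(2)[OF that] by simp
  let ?w = "2 * (\<bar>c\<^sub>0\<bar> + C * real r ^ d)"
  let ?E = "\<lambda>z. \<kappa> * real r ^ d + H * undetermined_cells r z V"
  have E0: "?E z \<ge> 0" for z using \<kappa> H undetermined_cells_nonneg[of r z V] by simp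
  have w0: "?w \<ge> 0" using C by simp
  have SY: "\<bar>S (?c z) \<xi>\<bar> \<le> \<bar>c\<^sub>0\<bar> + C * real r ^ d" if "bounded_density K \<xi>" for z \<xi>
    using sb[OF r0(2) that, of "lattice_point (real r) z"] unfolding cell_def by linarith
  \<comment> \<open>A cell off the boundary layer lies in both scaled domains or misses the one at
    scale \<open>R\<close>. In the first case its trace is that of the full parking set, in the
    second it is empty.\<close>
  have summand: "\<bar>S (?c z) \<zeta> - (if z \<in> ?I then cell_value r z V else 0)\<bar> \<le>
      \<bar>c\<^sub>0\<bar> + (if z \<in> ?I then ?E z else 0) + (if z \<in> ?B then ?w else 0)" for z
  proof (cases "z \<in> ?B")
    case True
    have "\<bar>S (?c z) \<zeta>\<bar> \<le> \<bar>c\<^sub>0\<bar> + C * real r ^ d" by (rule SY[OF dens])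
    moreover have "\<bar>cell_value r z V\<bar> \<le> \<bar>c\<^sub>0\<bar> + C * real r ^ d" unfolding cell_value_def by (rule SY[OF density_parking])
    ultimately show ?thesis using True E0[of z] w0 by (cases "z \<in> ?I") simp_all
  next
    case notB: False
    show ?thesis
    proof (cases "z \<in> ?I")
      case True
      have "?c z \<inter> (*\<^sub>R) (real n) ` D \<noteq> {}"
        using True cell_nonempty[OF r0(1), of z] unfolding inner_cells_def by blast
      then have sub: "?c z \<subseteq> ?RD"
        by (rule cell_not_boundary[OF r0(1) b' n0(1) _ _ R notB, rotated -1]) auto
      have "S (?c z) \<zeta> = S (?c z) ?x"
        by (rule S_cong[OF cell_lipschitz[OF r] cell_lipschitz[OF r] lf lf_parking]) (use sub in \<open>unfold \<zeta>_def, blast\<close>)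
      moreover have "\<bar>S (?c z) ?x - cell_value r z V\<bar> \<le> ?E z" using sub A by (intro ce wf) blast
      ultimately show ?thesis using True notB by simp
    next
      case False
      have "?c z \<inter> ?RD = {}"
      proof (rule ccontr)
        assume "?c z \<inter> ?RD \<noteq> {}"
        then have "?c z \<subseteq> (*\<^sub>R) (real n) ` D"
          by (rule cell_not_boundary[OF r0(1) b' n0(1) R _ _ notB, rotated -1]) auto
        then show False using False by (simp add: inner_cells_def)
      qed
      then have "S (?c z) \<zeta> = c\<^sub>0" by (intro S_empty cell_lipschitz r lf) (unfold \<zeta>_def, blast)
      then show ?thesis using False notB by simp
    qed
  qed
  have "\<bar>(\<Sum>z\<in>Z. S (?c z) \<zeta>) - (\<Sum>z\<in>?I. cell_value r z V)\<bar> = \<bar>\<Sum>z\<in>Z. S (?c z) \<zeta> - (if z \<in> ?I then cell_value r z V else 0)\<bar>"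
    using IZ finZ by (simp add: sum_subtractf sum.inter_restrict[symmetric] Int_absorb1)
  also have "\<dots> \<le> (\<Sum>z\<in>Z. \<bar>S (?c z) \<zeta> - (if z \<in> ?I then cell_value r z V else 0)\<bar>)" by (rule sum_abs)
  also have "\<dots> \<le> (\<Sum>z\<in>Z. \<bar>c\<^sub>0\<bar> + (if z \<in> ?I then ?E z else 0) + (if z \<in> ?B then ?w else 0))"
    by (rule sum_mono) (rule summand)
  also have "\<dots> = real (card Z) * \<bar>c\<^sub>0\<bar> + (\<Sum>z\<in>?I. ?E z) + real (card (Z \<inter> ?B)) * ?w"
    using IZ finZ by (simp add: sum.distrib sum.inter_restrict[symmetric] Int_absorb1)
  also have "\<dots> \<le> real (card Z) * \<bar>c\<^sub>0\<bar> + (\<Sum>z\<in>?I. ?E z) + real (card ?B) * ?w"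
    using w0 card_mono[OF finB, of "Z \<inter> ?B"] by (intro add_left_mono mult_right_mono) auto
  finally have 1: "\<bar>(\<Sum>z\<in>Z. S (?c z) \<zeta>) - (\<Sum>z\<in>?I. cell_value r z V)\<bar> \<le>
      real (card Z) * \<bar>c\<^sub>0\<bar> + (\<Sum>z\<in>?I. ?E z) + ?w * real (card ?B)" by (simp add: mult.commute)
  have vol: "(2 ^ Suc k * real r) ^ d \<le> (12 * b * real n) ^ d"
    using side r0 by (intro power_mono) auto
  have 2: "\<bar>S ?Q \<zeta> - (\<Sum>z\<in>Z. S (?c z) \<zeta>)\<bar> \<le> \<epsilon> * (12 * b * real n) ^ d"
    using na[OF dens, of a "Suc k"] mult_left_mono[OF vol \<epsilon>] unfolding sumZ by linarith
  have 3: "real (card Z) * \<bar>c\<^sub>0\<bar> \<le> \<bar>c\<^sub>0\<bar> / real r ^ d * (12 * b * real n) ^ d"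
  proof -
    have "real (card Z) * \<bar>c\<^sub>0\<bar> = \<bar>c\<^sub>0\<bar> / real r ^ d * (2 ^ Suc k * real r) ^ d"
      using r0 by (simp add: cardZ power_mult_distrib)
    also have "\<dots> \<le> \<bar>c\<^sub>0\<bar> / real r ^ d * (12 * b * real n) ^ d" using vol by (intro mult_left_mono) auto
    finally show ?thesis .
  qed
  show ?thesis unfolding SQ distrib_right using 1 2 3 by linarith
qed

section \<open>From cell sums to densities\<close>

definition cell_mean :: "nat \<Rightarrow> real" where
  "cell_mean r = expectation (\<lambda>\<omega>. cell_value r (\<lambda>_. 0) (P \<omega>)) / real r ^ d"

lemma floor_ratio_tendsto: "((\<lambda>R. (real (nat \<lfloor>R\<rfloor>) / R) ^ d) \<longlongrightarrow> 1) at_top"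
proof -
  have "((\<lambda>R::real. real (nat \<lfloor>R\<rfloor>) / R) \<longlongrightarrow> 1) at_top"
  proof (rule tendsto_sandwich[where f = "\<lambda>R. 1 - inverse R" and h = "\<lambda>_. 1"])
    show "eventually (\<lambda>R::real. 1 - inverse R \<le> real (nat \<lfloor>R\<rfloor>) / R) at_top"
      using eventually_gt_at_top[of 0]
    proof eventually_elim
      case (elim R)
      then have "real (nat \<lfloor>R\<rfloor>) = of_int \<lfloor>R\<rfloor>" by simp
      then have "R - 1 \<le> real (nat \<lfloor>R\<rfloor>)" by linarith
      then have "(R - 1) / R \<le> real (nat \<lfloor>R\<rfloor>) / R" using elim by (intro divide_right_mono) auto
      then show ?case using elim by (simp add: diff_divide_distrib inverse_eq_divide)
    qed
    show "eventually (\<lambda>R::real. real (nat \<lfloor>R\<rfloor>) / R \<le> 1) at_top"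
      using eventually_gt_at_top[of 0]
    proof eventually_elim
      case (elim R)
      then have "real (nat \<lfloor>R\<rfloor>) = of_int \<lfloor>R\<rfloor>" by simp
      then have "real (nat \<lfloor>R\<rfloor>) \<le> R" by linarith
      then show ?case using elim by simp
    qed
    have "((\<lambda>R::real. 1 - inverse R) \<longlongrightarrow> 1 - 0) at_top"
      by (intro tendsto_diff tendsto_const tendsto_inverse_0_at_top filterlim_ident)
    then show "((\<lambda>R::real. 1 - inverse R) \<longlongrightarrow> 1) at_top" by simp
  qed (rule tendsto_const)
  from tendsto_power[OF this, of d] show ?thesis by simp
qed

lemma filterlim_nat_floor: "filterlim (\<lambda>R::real. nat \<lfloor>R\<rfloor>) sequentially at_top"
  by (rule filterlim_compose[OF filterlim_nat_sequentially filterlim_floor_sequentially])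

text \<open>Order of choices: \<tau> fixes \<kappa>, which fixes \<open>H\<close>, which fixes
  \<eta>; then \<open>r\<close> is taken large, and \<open>R\<close> tends to infinity last.
  Quantifying over \<open>A\<close> inside the almost sure event makes the exceptional set
  independent of the region.\<close>

lemma density_close_to_cell_mean:
  fixes D :: "(real, 'n) vec set"
  assumes D: "D \<in> lipschitz_sets" and \<tau>: "\<tau> > 0"
  shows "eventually (\<lambda>r. AE \<omega> in M. eventually (\<lambda>R. \<forall>A. (*\<^sub>R) R ` D \<subseteq> A \<longrightarrow>
    \<bar>S ((*\<^sub>R) R ` D) (random_parking \<rho> A (P \<omega>)) / measure lborel ((*\<^sub>R) R ` D) - cell_mean r\<bar> \<le> \<tau>) at_top) sequentially"
proof -
  let ?m = "measure lborel D"
  have m: "?m > 0" by (rule measure_lipschitz_pos[OF D])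
  note bD = lipschitz_setsD(2,3)[OF D]
  obtain b0 where b0: "\<And>x. x \<in> D \<Longrightarrow> norm x \<le> b0" using bD(1) by (auto simp: bounded_iff)
  define b where "b = max 1 (b0 + 1)"
  have b: "b \<ge> 1" "\<And>x. x \<in> D \<Longrightarrow> norm x < b" using b0 by (force simp: b_def)+
  define CD where "CD = (12 * b) ^ d"
  have CD: "CD > 0" using b(1) by (simp add: CD_def)
  obtain C where C: "C > 0" "\<And>a s \<zeta>. s \<ge> 1 \<Longrightarrow> bounded_density K \<zeta> \<Longrightarrow> \<bar>S (cube a s) \<zeta> - c\<^sub>0\<bar> \<le> C * s ^ d"
    using S_bounded[OF K0] by metis
  define \<kappa> where "\<kappa> = \<tau> / 8"
  have \<kappa>: "\<kappa> > 0" using \<tau> by (simp add: \<kappa>_def)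
  obtain H where H: "H \<ge> 0" "\<forall>r\<ge>1. \<forall>z V A. parking_wf \<rho> V \<longrightarrow> cell (real r) z \<subseteq> A \<longrightarrow>
    \<bar>S (cell (real r) z) (random_parking \<rho> A V) - cell_value r z V\<bar> \<le> \<kappa> * real r ^ d + H * undetermined_cells r z V"
    using cell_estimate[OF \<kappa>] by blast
  \<comment> \<open>\<open>H + 1\<close> instead of \<open>H\<close> avoids dividing by
    zero.\<close>
  define \<eta> where "\<eta> = \<tau> / 8 / (H + 1)"
  have \<eta>: "\<eta> > 0" using \<tau> H(1) by (simp add: \<eta>_def)
  have H\<eta>: "H * \<eta> \<le> \<tau> / 8"
  proof -
    have "H * \<eta> \<le> (H + 1) * \<eta>" using \<eta> by (intro mult_right_mono) auto
    also have "\<dots> = \<tau> / 8"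
    proof -
      have "h * (\<tau> / 8 / h) = \<tau> / 8" if "h > 0" for h :: real using that by simp
      from this[of "H + 1"] show ?thesis unfolding \<eta>_def using H(1) by linarith
    qed
    finally show ?thesis .
  qed
  \<comment> \<open>\<open>CD * n ^ d\<close> bounds the volume of the enclosing cube; the
    near-additivity error on it becomes one eighth of the tolerated total.\<close>
  define \<epsilon> where "\<epsilon> = \<tau> * ?m / (8 * CD)"
  have \<epsilon>: "\<epsilon> > 0" "\<epsilon> * CD = \<tau> * ?m / 8" using \<tau> m CD by (simp_all add: \<epsilon>_def)
  obtain s0 where s0: "s0 \<ge> 1" "\<forall>s\<ge>s0. \<forall>k a \<zeta>. bounded_density K \<zeta> \<longrightarrow>
    \<bar>S (cube a (2 ^ k * s)) \<zeta> - (\<Sum>z\<in>grid (2 ^ k). S (subcube a s z) \<zeta>)\<bar> \<le> \<epsilon> * (2 ^ k * s) ^ d"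
    using nearly_additive[OF K0 \<epsilon>(1)] by blast
  have "(\<lambda>r. \<bar>c\<^sub>0\<bar> * CD * inverse (real r) ^ d) \<longlonglongrightarrow> \<bar>c\<^sub>0\<bar> * CD * 0 ^ d"
    by (intro tendsto_intros lim_inverse_n)
  then have "(\<lambda>r. \<bar>c\<^sub>0\<bar> * CD * inverse (real r) ^ d) \<longlonglongrightarrow> 0" by (simp add: zero_power)
  then have "eventually (\<lambda>r. \<bar>c\<^sub>0\<bar> * CD * inverse (real r) ^ d < \<tau> * ?m / 8) sequentially"
    using \<tau> m by (intro order_tendstoD(2)) auto
  moreover have "eventually (\<lambda>r. s0 \<le> real r) sequentially"
    using filterlim_real_sequentially unfolding filterlim_at_top by blast
  moreover note expectation_undetermined_cells_small[OF \<eta>]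
  ultimately show ?thesis
  proof eventually_elim
    case (elim r)
    have r: "r \<ge> 1" "real r > 0" using elim(2) s0(1) by auto
    have rd: "real r ^ d > 0" using r by simp
    let ?c = "2 * b + real CARD('n) * real r"
    let ?I = "inner_cells (real r) D" and ?B = "boundary_cells (real r) ?c D"
    define mY where "mY = expectation (\<lambda>\<omega>. cell_value r (\<lambda>_. 0) (P \<omega>))"
    define mJ where "mJ = expectation (\<lambda>\<omega>. undetermined_cells r (\<lambda>_. 0) (P \<omega>))"
    have mJ: "mJ \<le> \<eta> * real r ^ d" using elim(3) by (simp add: mJ_def)
    have d2: "d \<ge> 2" using p by linarith
    have finI: "finite (?I n)" for n by (rule finite_inner_cells[OF r(2) bD(1)])
    have cardI: "real (card (?I n)) \<le> ?m / real r ^ d * real n ^ d" for n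
      using card_inner_cells_le[OF r(2) D, of n] rd by (simp add: field_simps d_def)
    have limI: "(\<lambda>n. real (card (?I n)) / real n ^ d) \<longlonglongrightarrow> ?m / real r ^ d"
      using card_inner_cells_tendsto[OF r(2) D] by (simp add: d_def)
    have limB: "(\<lambda>n. real (card (?B n)) / real n ^ d) \<longlonglongrightarrow> 0"
      using card_boundary_cells_tendsto[OF r(2) D, of ?c] b(1) r by (simp add: d_def)
    have slln: "AE \<omega> in M. (\<lambda>n. (\<Sum>z\<in>?I n. \<Phi> z (P \<omega>) - \<mu>) / real n ^ d) \<longlonglongrightarrow> 0"
      if "\<And>z. \<Phi> z \<in> borel_measurable (configurations (over (cell (real r) z)))"
        "\<And>z V. locally_finite V \<Longrightarrow> \<bar>\<Phi> z V\<bar> \<le> L" "\<And>z. expectation (\<lambda>\<omega>. \<Phi> z (P \<omega>)) = \<mu>" for \<Phi> L \<mu>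
      by (rule strong_law_cells[OF U r(2) that finI cardI d2])
    have "AE \<omega> in M. (\<lambda>n. (\<Sum>z\<in>?I n. cell_value r z (P \<omega>) - mY) / real n ^ d) \<longlonglongrightarrow> 0"
    proof (rule slln[OF measurable_cell_value[OF r(1)]])
      show "\<bar>cell_value r z V\<bar> \<le> \<bar>c\<^sub>0\<bar> + C * real r ^ d" for z V
        using C(2)[of "real r" "random_parking \<rho> (cell (real r) z) V" "lattice_point (real r) z"] r density_parking
        unfolding cell_value_def cell_def by fastforce
      show "expectation (\<lambda>\<omega>. cell_value r z (P \<omega>)) = mY" for z unfolding mY_def by (rule expectation_cell_value[OF r(1)])
    qed
    moreover have "AE \<omega> in M. (\<lambda>n. (\<Sum>z\<in>?I n. undetermined_cells r z (P \<omega>) - mJ) / real n ^ d) \<longlonglongrightarrow> 0"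
    proof (rule slln[OF measurable_undetermined_cells])
      show "\<bar>undetermined_cells r z V\<bar> \<le> real r ^ d" for z V using undetermined_cells_nonneg[of r z V] undetermined_cells_le[of r z V] by simp
      show "expectation (\<lambda>\<omega>. undetermined_cells r z (P \<omega>)) = mJ" for z unfolding mJ_def by (rule expectation_undetermined_cells)
    qed
    moreover note AE_parking_wf[OF U \<rho>]
    ultimately show ?case
    proof eventually_elim
      case (elim \<omega>)
      let ?V = "P \<omega>"
      define an where "an n = (\<Sum>z\<in>?I n. cell_value r z ?V) / real n ^ d" for n
      define en where "en n = (\<epsilon> + \<bar>c\<^sub>0\<bar> / real r ^ d) * CD +
        (\<kappa> * real r ^ d * (real (card (?I n)) / real n ^ d) + H * ((\<Sum>z\<in>?I n. undetermined_cells r z ?V) / real n ^ d)) +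
        2 * (\<bar>c\<^sub>0\<bar> + C * real r ^ d) * (real (card (?B n)) / real n ^ d)" for n
      \<comment> \<open>The strong law gives the centred sums; the number of inner cells per
        \<open>n ^ d\<close> supplies the factor for the mean.\<close>
      have lim: "(\<lambda>n. (\<Sum>z\<in>?I n. X z) / real n ^ d) \<longlonglongrightarrow> \<mu> * (?m / real r ^ d)"
        if "(\<lambda>n. (\<Sum>z\<in>?I n. X z - \<mu>) / real n ^ d) \<longlonglongrightarrow> 0" for X \<mu>
      proof -
        have "(\<lambda>n. (\<Sum>z\<in>?I n. X z - \<mu>) / real n ^ d + \<mu> * (real (card (?I n)) / real n ^ d)) \<longlonglongrightarrow> 0 + \<mu> * (?m / real r ^ d)"
          by (intro tendsto_intros that limI)
        moreover have "(\<Sum>z\<in>?I n. X z - \<mu>) / real n ^ d + \<mu> * (real (card (?I n)) / real n ^ d) = (\<Sum>z\<in>?I n. X z) / real n ^ d" for n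
          by (simp add: sum_subtractf diff_divide_distrib)
        ultimately show ?thesis by simp
      qed
      let ?a = "mY * (?m / real r ^ d)"
      let ?e = "(\<epsilon> + \<bar>c\<^sub>0\<bar> / real r ^ d) * CD + (\<kappa> * real r ^ d * (?m / real r ^ d) + H * (mJ * (?m / real r ^ d))) +
        2 * (\<bar>c\<^sub>0\<bar> + C * real r ^ d) * 0"
      have liman: "an \<longlonglongrightarrow> ?a" unfolding an_def by (rule lim[OF elim(1)])
      have limen: "en \<longlonglongrightarrow> ?e" unfolding en_def by (intro tendsto_intros limI limB lim[OF elim(2)])
      \<comment> \<open>Four contributions of at most one eighth: near additivity, empty cells,
        smoothness and undetermined cells. The boundary layer disappears in the limit.\<close>
      have e: "?e \<le> \<tau> * ?m / 2"
      proof -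
        have "\<bar>c\<^sub>0\<bar> / real r ^ d * CD = \<bar>c\<^sub>0\<bar> * CD * inverse (real r) ^ d"
          unfolding power_inverse divide_inverse by (simp only: mult_ac)
        then have "\<bar>c\<^sub>0\<bar> / real r ^ d * CD \<le> \<tau> * ?m / 8"
          using \<open>\<bar>c\<^sub>0\<bar> * CD * inverse (real r) ^ d < \<tau> * ?m / 8\<close> by linarith
        moreover have "\<kappa> * real r ^ d * (?m / real r ^ d) = \<tau> * ?m / 8" using r(2) by (simp add: \<kappa>_def)
        moreover have "H * (mJ * (?m / real r ^ d)) \<le> \<tau> * ?m / 8"
        proof -
          have "mJ * (?m / real r ^ d) \<le> \<eta> * real r ^ d * (?m / real r ^ d)"
            using mJ m rd by (intro mult_right_mono) auto
          also have "\<dots> = \<eta> * ?m" using r(2) by simp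
          finally have "H * (mJ * (?m / real r ^ d)) \<le> H * (\<eta> * ?m)"
            using H(1) by (rule mult_left_mono)
          also have "\<dots> = H * \<eta> * ?m" by (simp only: mult.assoc)
          also have "\<dots> \<le> \<tau> / 8 * ?m" using H\<eta> m by (intro mult_right_mono) auto
          finally show ?thesis by simp
        qed
        moreover have "x\<^sub>1 + x\<^sub>2 + (x\<^sub>3 + x\<^sub>4) + 0 \<le> t / 2"
          if "x\<^sub>2 \<le> t / 8" "x\<^sub>3 = t / 8" "x\<^sub>4 \<le> t / 8" "x\<^sub>1 = t / 8" "t > 0" for x\<^sub>1 x\<^sub>2 x\<^sub>3 x\<^sub>4 t :: real
          using that by linarith
        ultimately show ?thesis
          unfolding distrib_right[of \<epsilon>] mult_zero_right using \<epsilon>(2) mult_pos_pos[OF \<tau> m] by blast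
      qed
      have pos: "\<tau> * ?m > 0" using \<tau> m by simp
      \<comment> \<open>One quarter of the tolerance is spent on passing from the limit to finite
        \<open>n\<close>, another is kept for replacing \<open>n ^ d\<close> by
        \<open>R ^ d\<close>.\<close>
      have "(\<lambda>n. \<bar>an n - ?a\<bar> + en n) \<longlonglongrightarrow> \<bar>?a - ?a\<bar> + ?e" by (intro tendsto_intros liman limen)
      moreover have "\<bar>?a - ?a\<bar> + ?e < 3 * (\<tau> * ?m) / 4"
      proof -
        have "\<bar>y - y\<bar> + x < 3 * t / 4" if "x \<le> t / 2" "t > 0" for x y t :: real using that by linarith
        from this[OF e pos] show ?thesis .
      qed
      ultimately have "eventually (\<lambda>n. \<bar>an n - ?a\<bar> + en n < 3 * (\<tau> * ?m) / 4) sequentially"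
        by (rule order_tendstoD(2))
      then have "eventually (\<lambda>n. \<bar>an n - ?a\<bar> + en n < 3 * (\<tau> * ?m) / 4 \<and> n \<ge> r) sequentially"
        using eventually_ge_at_top[of r] by (rule eventually_conj)
      from eventually_compose_filterlim[OF this filterlim_nat_floor]
      have ev1: "eventually (\<lambda>R::real. \<bar>an (nat \<lfloor>R\<rfloor>) - ?a\<bar> + en (nat \<lfloor>R\<rfloor>) < 3 * (\<tau> * ?m) / 4 \<and> nat \<lfloor>R\<rfloor> \<ge> r) at_top" .
      have "((\<lambda>R. \<bar>(real (nat \<lfloor>R\<rfloor>) / R) ^ d - 1\<bar> * \<bar>?a\<bar>) \<longlongrightarrow> \<bar>1 - 1\<bar> * \<bar>?a\<bar>) at_top"
        by (intro tendsto_intros floor_ratio_tendsto)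
      then have ev2: "eventually (\<lambda>R. \<bar>(real (nat \<lfloor>R\<rfloor>) / R) ^ d - 1\<bar> * \<bar>?a\<bar> < \<tau> * ?m / 4) at_top"
        using pos by (intro order_tendstoD(2)) auto
      from ev1 ev2 eventually_gt_at_top[of 0] show ?case
      proof eventually_elim
        case (elim R)
        let ?n = "nat \<lfloor>R\<rfloor>"
        have rn: "?n \<ge> r" using elim(1) by (rule conjunct2)
        then have "?n > 0" using r(1) by linarith
        then have n: "?n \<ge> r" "real ?n > 0" using rn by (simp_all only: of_nat_0_less_iff)
        have Rn: "real ?n \<le> R" "R \<le> real ?n + 1" using elim(3) by linarith+
        have nd: "real ?n ^ d > 0" using n(2) by (rule zero_less_power)
        show ?case
        proof (intro allI impI)
          fix A assume A: "(*\<^sub>R) R ` D \<subseteq> A"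
          let ?S = "S ((*\<^sub>R) R ` D) (random_parking \<rho> A ?V)"
          have na: "\<bar>S (cube a (2 ^ k * real r)) \<zeta> - (\<Sum>z\<in>grid (2 ^ k). S (subcube a (real r) z) \<zeta>)\<bar> \<le> \<epsilon> * (2 ^ k * real r) ^ d"
            if "bounded_density K \<zeta>" for k a \<zeta>
            using s0(2) \<open>s0 \<le> real r\<close> that by blast
          have ce: "\<bar>S (cell (real r) z) (random_parking \<rho> A V) - cell_value r z V\<bar> \<le> \<kappa> * real r ^ d + H * undetermined_cells r z V"
            if "parking_wf \<rho> V" "cell (real r) z \<subseteq> A" for z V A
            using H(2) r(1) that by blast
          have "\<bar>?S - (\<Sum>z\<in>?I ?n. cell_value r z ?V)\<bar> \<le> (\<epsilon> + \<bar>c\<^sub>0\<bar> / real r ^ d) * (12 * b * real ?n) ^ d +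
              (\<Sum>z\<in>?I ?n. \<kappa> * real r ^ d + H * undetermined_cells r z ?V) + 2 * (\<bar>c\<^sub>0\<bar> + C * real r ^ d) * real (card (?B ?n))"
            by (rule cell_sum_estimate[OF D b r(1) less_imp_le[OF \<epsilon>(1)] na less_imp_le[OF \<kappa>] H(1) ce
                  less_imp_le[OF C(1)] C(2) \<open>parking_wf \<rho> ?V\<close> n(1) Rn A])
          also have "\<dots> = en ?n * real ?n ^ d"
          proof -
            have "(12 * b * real ?n) ^ d = CD * real ?n ^ d" by (simp add: CD_def power_mult_distrib)
            moreover have "(\<Sum>z\<in>?I ?n. \<kappa> * real r ^ d + H * undetermined_cells r z ?V) =
                real (card (?I ?n)) * (\<kappa> * real r ^ d) + H * (\<Sum>z\<in>?I ?n. undetermined_cells r z ?V)"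
              by (simp add: sum.distrib sum_distrib_left)
            moreover have "x * (y * N) + (i * q + h * j) + w * v =
                (x * y + (q * (i / N) + h * (j / N)) + w * (v / N)) * N"
              if "N > 0" for x y N i q h j w v :: real
              using that by (simp add: field_simps)
            from this[OF nd] have "(\<epsilon> + \<bar>c\<^sub>0\<bar> / real r ^ d) * (CD * real ?n ^ d) +
                (real (card (?I ?n)) * (\<kappa> * real r ^ d) + H * (\<Sum>z\<in>?I ?n. undetermined_cells r z ?V)) +
                2 * (\<bar>c\<^sub>0\<bar> + C * real r ^ d) * real (card (?B ?n)) = en ?n * real ?n ^ d"
              unfolding en_def .
            ultimately show ?thesis by (simp only:)
          qed
          finally have S: "\<bar>?S - (\<Sum>z\<in>?I ?n. cell_value r z ?V)\<bar> \<le> en ?n * real ?n ^ d" .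
          have "\<bar>?S / real ?n ^ d - an ?n\<bar> = \<bar>?S - (\<Sum>z\<in>?I ?n. cell_value r z ?V)\<bar> / real ?n ^ d"
            unfolding an_def diff_divide_distrib[symmetric] abs_divide using nd by simp
          then have "\<bar>?S / real ?n ^ d - an ?n\<bar> \<le> en ?n"
            using S unfolding pos_divide_le_eq[OF nd, symmetric] by simp
          then have g: "\<bar>?S / real ?n ^ d - ?a\<bar> \<le> 3 * (\<tau> * ?m) / 4" using elim(1) by linarith
          \<comment> \<open>Converts the density per \<open>n ^ d\<close> into the one per
            \<open>R ^ d\<close>; it lies in the unit interval and tends to 1.\<close>
          let ?q = "(real ?n / R) ^ d"
          have q: "0 \<le> ?q" "?q \<le> 1"
          proof -
            have "0 \<le> real ?n / R" "real ?n / R \<le> 1" using elim(3) Rn(1) by simp_all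
            then show "0 \<le> ?q" "?q \<le> 1" by (auto intro: power_le_one zero_le_power)
          qed
          have t1: "\<bar>?q * (?S / real ?n ^ d) - ?a\<bar> \<le> \<bar>?q * (?S / real ?n ^ d - ?a)\<bar> + \<bar>(?q - 1) * ?a\<bar>"
          proof -
            have "q * (x - a) + (q - 1) * a = q * x - a" for q x a :: real by (simp add: algebra_simps)
            from this[symmetric] show ?thesis by (simp only: abs_triangle_ineq)
          qed
          have t2: "\<bar>?q * (?S / real ?n ^ d - ?a)\<bar> \<le> \<bar>?S / real ?n ^ d - ?a\<bar>"
          proof -
            have "\<bar>u * y\<bar> \<le> \<bar>y\<bar>" if "0 \<le> u" "u \<le> 1" for u y :: real
              using that by (simp add: abs_mult mult_left_le_one_le)
            from this[OF q] show ?thesis .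
          qed
          have t3: "\<bar>(?q - 1) * ?a\<bar> \<le> \<tau> * ?m / 4"
            unfolding abs_mult[of "?q - 1"] using elim(2) by (rule less_imp_le)
          have comb: "u \<le> t" if "u \<le> v + w" "v \<le> x" "w \<le> t / 4" "x \<le> 3 * t / 4" for u v w x t :: real
            using that by linarith
          have "\<bar>?q * (?S / real ?n ^ d) - ?a\<bar> \<le> \<tau> * ?m" by (rule comb[OF t1 t2 t3 g])
          moreover have "?q * (?S / real ?n ^ d) = ?S / R ^ d"
          proof -
            have "x / y * (u / x) = u / y" if "x > 0" for x y u :: real using that by simp
            from this[OF nd] show ?thesis unfolding power_divide .
          qed
          ultimately have f: "\<bar>?S / R ^ d - ?a\<bar> \<le> \<tau> * ?m" by (simp only:)
          have "?S / measure lborel ((*\<^sub>R) R ` D) - cell_mean r = (?S / R ^ d - ?a) / ?m"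
          proof -
            have "x / (y * w) - u / v = (x / y - u * (w / v)) / w" if "w > 0" for x y w u v :: real
              using that by (simp add: diff_divide_distrib)
            from this[OF m] show ?thesis
              unfolding measure_scale[OF elim(3) bD(2)] cell_mean_def mY_def[symmetric] d_def[symmetric] .
          qed
          then have "\<bar>?S / measure lborel ((*\<^sub>R) R ` D) - cell_mean r\<bar> = \<bar>?S / R ^ d - ?a\<bar> / ?m"
            using m by simp
          also have "\<dots> \<le> \<tau>" using f m by (simp add: pos_divide_le_eq)
          finally show "\<bar>?S / measure lborel ((*\<^sub>R) R ` D) - cell_mean r\<bar> \<le> \<tau>" .
        qed
      qed
    qed
  qed
qed

lemma cell_mean_convergent: "convergent cell_mean"
proof (rule Cauchy_convergent)
  let ?D = "cube 0 1 :: (real, 'n) vec set"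
  have D: "?D \<in> lipschitz_sets" by (rule cube_lipschitz) simp
  show "Cauchy cell_mean"
  proof (rule metric_CauchyI)
    fix e :: real assume e: "e > 0"
    obtain N where N: "\<And>r. r \<ge> N \<Longrightarrow> AE \<omega> in M. eventually (\<lambda>R. \<forall>A. (*\<^sub>R) R ` ?D \<subseteq> A \<longrightarrow>
        \<bar>S ((*\<^sub>R) R ` ?D) (random_parking \<rho> A (P \<omega>)) / measure lborel ((*\<^sub>R) R ` ?D) - cell_mean r\<bar> \<le> e / 3) at_top"
      using density_close_to_cell_mean[OF D, of "e / 3"] e unfolding eventually_sequentially by auto
    have "dist (cell_mean r) (cell_mean r') < e" if r: "r \<ge> N" "r' \<ge> N" for r r'
    proof -
      have "AE \<omega> in M. \<bar>cell_mean r - cell_mean r'\<bar> \<le> 2 * (e / 3)"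
        using N[OF r(1)] N[OF r(2)]
      proof eventually_elim
        case (elim \<omega>)
        have "eventually (\<lambda>R::real. \<bar>cell_mean r - cell_mean r'\<bar> \<le> 2 * (e / 3)) at_top"
          using elim
        proof eventually_elim
          case (elim R)
          \<comment> \<open>Both means are close to the same quantity, taken at one scale and with
            the whole space as region.\<close>
          from elim(1)[THEN spec, of UNIV] elim(2)[THEN spec, of UNIV] show ?case
            unfolding abs_le_iff by (simp del: le_divide_eq_numeral1)
        qed
        then show ?case by simp
      qed
      \<comment> \<open>The inequality does not involve \<omega>, so holding almost surely it
        holds.\<close>
      then have "\<bar>cell_mean r - cell_mean r'\<bar> \<le> 2 * (e / 3)" by (simp add: AE_const)
      then show ?thesis using e by (simp add: dist_real_def)
    qed
    then show "\<exists>N. \<forall>r\<ge>N. \<forall>r'\<ge>N. dist (cell_mean r) (cell_mean r') < e" by blast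
  qed
qed

text \<open>One cell size per tolerance \<open>2 / (k + 1)\<close> and a countable union of null
  sets. As the bounds are uniform in the region, \<open>A\<close> may vary with \<open>R\<close> in
  any way, even depending on \<omega>.\<close>

lemma density_limit:
  fixes D :: "(real, 'n) vec set"
  assumes D: "D \<in> lipschitz_sets"
  shows "AE \<omega> in M. \<forall>A. (\<forall>R. (*\<^sub>R) R ` D \<subseteq> A R) \<longrightarrow>
    ((\<lambda>R. S ((*\<^sub>R) R ` D) (random_parking \<rho> (A R) (P \<omega>)) / measure lborel ((*\<^sub>R) R ` D)) \<longlongrightarrow> lim cell_mean) at_top"
proof -
  let ?f = "\<lambda>\<omega> A R. S ((*\<^sub>R) R ` D) (random_parking \<rho> A (P \<omega>)) / measure lborel ((*\<^sub>R) R ` D)"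
  have lim: "cell_mean \<longlonglongrightarrow> lim cell_mean" using cell_mean_convergent by (simp add: convergent_LIMSEQ_iff)
  have "AE \<omega> in M. eventually (\<lambda>R. \<forall>A. (*\<^sub>R) R ` D \<subseteq> A \<longrightarrow> \<bar>?f \<omega> A R - lim cell_mean\<bar> \<le> 2 * inverse (real (Suc k))) at_top" for k
  proof -
    let ?t = "inverse (real (Suc k))"
    have t: "?t > 0" by simp
    have "eventually (\<lambda>r. \<bar>cell_mean r - lim cell_mean\<bar> < ?t) sequentially"
      using tendstoD[OF lim t] by (simp add: dist_real_def)
    from eventually_happens'[OF sequentially_bot eventually_conj[OF density_close_to_cell_mean[OF D t] this]]
    obtain r where ae: "AE \<omega> in M. eventually (\<lambda>R. \<forall>A. (*\<^sub>R) R ` D \<subseteq> A \<longrightarrow> \<bar>?f \<omega> A R - cell_mean r\<bar> \<le> ?t) at_top"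
      and r: "\<bar>cell_mean r - lim cell_mean\<bar> < ?t" by blast
    from ae show ?thesis
    proof eventually_elim
      case (elim \<omega>)
      then show ?case
      proof eventually_elim
        case (elim R)
        show ?case
        proof (intro allI impI)
          fix A assume "(*\<^sub>R) R ` D \<subseteq> A"
          then have "\<bar>?f \<omega> A R - cell_mean r\<bar> \<le> ?t" using elim by blast
          then show "\<bar>?f \<omega> A R - lim cell_mean\<bar> \<le> 2 * ?t" using r by linarith
        qed
      qed
    qed
  qed
  then have "AE \<omega> in M. \<forall>k. eventually (\<lambda>R. \<forall>A. (*\<^sub>R) R ` D \<subseteq> A \<longrightarrow> \<bar>?f \<omega> A R - lim cell_mean\<bar> \<le> 2 * inverse (real (Suc k))) at_top"
    unfolding AE_all_countable by blast
  then show ?thesis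
  proof eventually_elim
    case (elim \<omega>)
    show ?case
    proof (intro allI impI)
      fix A assume A: "\<forall>R. (*\<^sub>R) R ` D \<subseteq> A R"
      show "((\<lambda>R. ?f \<omega> (A R) R) \<longlongrightarrow> lim cell_mean) at_top"
      proof (rule tendstoI)
        fix e :: real assume "e > 0"
        then obtain k where k: "inverse (real (Suc k)) < e / 2" using reals_Archimedean[of "e / 2"] by auto
        from elim[THEN spec, of k] show "eventually (\<lambda>R. dist (?f \<omega> (A R) R) (lim cell_mean) < e) at_top"
        proof eventually_elim
          case (elim R)
          then have "\<bar>?f \<omega> (A R) R - lim cell_mean\<bar> \<le> 2 * inverse (real (Suc k))" using A by blast
          then show ?case using k unfolding dist_real_def by linarith
        qed
      qed
    qed
  qed
qed

lemma scale_cube: "R > 0 \<Longrightarrow> (*\<^sub>R) R ` cube 0 1 = cube (0 :: (real, 'n) vec) R"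
proof (rule set_eqI)
  fix y :: "(real, 'n) vec"
  assume R: "R > 0"
  have "y \<in> (*\<^sub>R) R ` cube 0 1 \<longleftrightarrow> (1 / R) *\<^sub>R y \<in> cube 0 1" using R by (force simp: image_iff)
  also have "\<dots> \<longleftrightarrow> y \<in> cube 0 R" using R by (simp add: cube_def field_simps)
  finally show "y \<in> (*\<^sub>R) R ` cube 0 1 \<longleftrightarrow> y \<in> cube 0 R" .
qed

lemma lim_cell_mean_nonneg: "lim cell_mean \<ge> 0"
proof -
  let ?D = "cube 0 1 :: (real, 'n) vec set"
  have D: "?D \<in> lipschitz_sets" by (rule cube_lipschitz) simp
  obtain C where C: "C > 0" "\<And>a s I (\<zeta> :: bool \<Rightarrow> _). s > 0 \<Longrightarrow> finite I \<Longrightarrow> I \<noteq> {} \<Longrightarrow>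
    (\<And>i. i \<in> I \<Longrightarrow> locally_finite (\<zeta> i)) \<Longrightarrow>
    S (cube a s) (\<Union>i\<in>I. \<zeta> i) \<le> (\<Sum>i\<in>I. S (cube a s) (\<zeta> i)) + real (card I) * (C * s powr p)"
    by (fact subadditive_cube)
  \<comment> \<open>The family over \<open>bool\<close> consists of two copies of one set, whose
    union is that set: \<open>S\<close> is at most \<open>2 * S\<close> plus two error
    terms.\<close>
  have low: "- 2 * C * s powr p \<le> S (cube a s) \<zeta>" if "s > 0" "locally_finite \<zeta>" for a s \<zeta>
    using C(2)[of s UNIV "\<lambda>_. \<zeta>" a] that by (simp add: UNIV_bool)
  have "AE \<omega> in M. lim cell_mean \<ge> 0"
    using density_limit[OF D]
  proof eventually_elim
    case (elim \<omega>)
    let ?f = "\<lambda>R. S ((*\<^sub>R) R ` ?D) (random_parking \<rho> UNIV (P \<omega>)) / measure lborel ((*\<^sub>R) R ` ?D)"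
    have lim: "(?f \<longlongrightarrow> lim cell_mean) at_top" using elim[THEN spec, of "\<lambda>_. UNIV"] by simp
    have "((\<lambda>R. - 2 * C * R powr (p - real d)) \<longlongrightarrow> - 2 * C * 0) at_top"
      using p by (intro tendsto_intros tendsto_neg_powr filterlim_ident) auto
    then have lim0: "((\<lambda>R. - 2 * C * R powr (p - real d)) \<longlongrightarrow> 0) at_top" by simp
    have "eventually (\<lambda>R. - 2 * C * R powr (p - real d) \<le> ?f R) at_top"
      using eventually_gt_at_top[of 0]
    proof eventually_elim
      case (elim R)
      have Rd: "R ^ d > 0" using elim by simp
      have m: "measure lborel (cube (0 :: (real, 'n) vec) R) = R ^ d" using measure_cube[of R 0] elim by (simp add: d_def)
      have "- 2 * C * R powr (p - real d) = (- 2 * C * R powr p) / R ^ d"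
        using elim by (simp add: powr_diff powr_realpow)
      also have "\<dots> \<le> S (cube 0 R) (random_parking \<rho> UNIV (P \<omega>)) / R ^ d"
        using low[OF elim lf_parking] Rd by (intro divide_right_mono) auto
      finally show ?case unfolding scale_cube[OF elim] m .
    qed
    then show ?case by (rule tendsto_le[OF _ lim lim0, rotated]) simp
  qed
  then show ?thesis by (simp add: AE_const)
qed

end

theorem theorem3p1:
  fixes \<rho>\<^sub>0 p :: real
    and S T :: "'n::{finite,linorder} functional"
    and M :: "'w measure"
    and P :: "'w \<Rightarrow> ((real ^ 'n::{finite,linorder}) \<times> real) set"
  assumes "\<rho>\<^sub>0 > 0"
    and "1 \<le> p" and "p < real CARD('n)"
    and "measurable_functional S" and "translation_invariant S" and "smooth_of_order p S"
    and "measurable_functional T" and "translation_invariant T" and "smooth_of_order p T"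
    and "localized S" and "almost_subadditive p S"
    and "superadditive_on_rectangles T"
    and "pointwise_close p S T"
    and "unit_poisson_process M (UNIV \<times> {0..}) P"
  shows "\<exists>Sbar::real. Sbar \<ge> 0 \<and>
    (\<forall>D\<in>lipschitz_sets. AE \<omega> in M.
       ((\<lambda>R. S ((*\<^sub>R) R ` D) (random_parking \<rho>\<^sub>0 ((*\<^sub>R) R ` D) (P \<omega>))
              / measure lborel ((*\<^sub>R) R ` D)) \<longlongrightarrow> Sbar) at_top \<and>
       ((\<lambda>R. S ((*\<^sub>R) R ` D) (random_parking \<rho>\<^sub>0 UNIV (P \<omega>))
              / measure lborel ((*\<^sub>R) R ` D)) \<longlongrightarrow> Sbar) at_top)"
proof -
  \<comment> \<open>The density bound depends only on the radius and the dimension, so it can be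
    fixed before any region or realisation is considered.\<close>
  obtain K where K: "K \<ge> 0"
    "\<forall>Z :: (real, 'n) vec set. (\<forall>x\<in>Z. \<forall>y\<in>Z. x \<noteq> y \<longrightarrow> 2 * \<rho>\<^sub>0 \<le> dist x y) \<longrightarrow> bounded_density K Z"
    using hard_core_bounded_density[OF assms(1)] by blast
  interpret parking "CARD('n)" p S T \<rho>\<^sub>0 M P K
    by unfold_locales (use assms K in auto)
  show ?thesis
  proof (intro exI[of _ "lim cell_mean"] conjI ballI lim_cell_mean_nonneg)
    fix D :: "(real, 'n) vec set" assume D: "D \<in> lipschitz_sets"
    show "AE \<omega> in M.
       ((\<lambda>R. S ((*\<^sub>R) R ` D) (random_parking \<rho>\<^sub>0 ((*\<^sub>R) R ` D) (P \<omega>))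
              / measure lborel ((*\<^sub>R) R ` D)) \<longlongrightarrow> lim cell_mean) at_top \<and>
       ((\<lambda>R. S ((*\<^sub>R) R ` D) (random_parking \<rho>\<^sub>0 UNIV (P \<omega>))
              / measure lborel ((*\<^sub>R) R ` D)) \<longlongrightarrow> lim cell_mean) at_top"
      using density_limit[OF D]
    proof eventually_elim
      case (elim \<omega>)
      from elim[THEN spec, of "\<lambda>R. (*\<^sub>R) R ` D"] elim[THEN spec, of "\<lambda>_. UNIV"] show ?case by simp
    qed
  qed
qed

end
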